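(* Let $E$ and $F$ be complex Banach spaces, let $U$ be an open subset of $E$, let $p\in[1,\infty)$ and let $f\in\mathcal{H}^\infty(U,F)$. The following conditions are equivalent: (i) $f$ has relatively $p$-compact range, i.e. $f(U)$ is a relatively $p$-compact subset of $F$. (ii) The linearisation $T_f\colon\mathcal{G}^\infty(U)\to F$ is a $p$-compact linear operator. In this case, $k_p^{\mathcal{H}^\infty}(f)=k_p(T_f)$. Furthermore, the mapping $f\mapsto T_f$ is an isometric isomorphism from $(\mathcal{H}^\infty_{\mathcal{K}_p}(U,F),k_p^{\mathcal{H}^\infty})$ onto $(\mathcal{K}_p(\mathcal{G}^\infty(U),F),k_p)$.
   Context: $\mathcal{L}(X,Y)$ is the Banach space of bounded linear operators between Banach spaces $X,Y$; $B_X$ is the closed unit ball of $X$. $\mathcal{H}^\infty(U,F)$ is the Banach space of all bounded holomorphic mappings $f\colon U\to F$ with the supremum norm $\|\cdot\|_\infty$, and $\mathcal{H}^\infty(U)=\mathcal{H}^\infty(U,\mathbb{C})$. $p$-compactness. For $1<p<\infty$ put $p^*=p/(p-1)$ and, for $(x_n)\in\ell_p(F)$ (absolutely $p$-summable sequences in $F$, with norm $\|(x_n)\|_p=(\sum_n\|x_n\|^p)^{1/p}$), $p\text{-}\mathrm{conv}(x_n)=\{\sum_{n=1}^\infty a_nx_n\colon (a_n)\in B_{\ell_{p^*}}\}$; for $p=1$ and $(x_n)\in\ell_1(F)$, $1\text{-}\mathrm{conv}(x_n)=\{\sum_{n=1}^\infty a_nx_n\colon (a_n)\in B_{c_0}\}$.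 A set $K\subseteq F$ is relatively $p$-compact if $K\subseteq p\text{-}\mathrm{conv}(x_n)$ for some $(x_n)\in\ell_p(F)$; then $m_p(K)$ is the infimum of $\|(x_n)\|_p$ over all such sequences. $\mathcal{K}_p(X,Y)$ is the space of $p$-compact operators, i.e. linear $T\colon X\to Y$ with $T(B_X)$ relatively $p$-compact in $Y$, with norm $k_p(T)=m_p(T(B_X))$. $\mathcal{H}^\infty_{\mathcal{K}_p}(U,F)$ is the set of holomorphic mappings $f\colon U\to F$ with $f(U)$ relatively $p$-compact in $F$, and $k_p^{\mathcal{H}^\infty}(f)=m_p(f(U))$. Linearisation (Mujica). $\mathcal{G}^\infty(U)$ is the norm-closed linear span in $\mathcal{H}^\infty(U)^*$ of the functionals $\delta(x)\colon f\mapsto f(x)$, $x\in U$; $g_U\colon U\to\mathcal{G}^\infty(U)$, $g_U(x)=\delta(x)$, is holomorphic. For $f\in\mathcal{H}^\infty(U,F)$, $T_f\in\mathcal{L}(\mathcal{G}^\infty(U),F)$ is the unique bounded linear operator with $T_f\circ g_U=f$ (it exists and $\|T_f\|=\|f\|_\infty$). *)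

theory Defs
  imports "HOL-Analysis.Analysis" "HOL-Library.Function_Algebras"
begin

section \<open>Complex Banach spaces\<close>

text \<open>
  HOL-Analysis only provides real normed spaces as type classes. The scalar multiplication
  \<open>scaleC\<close> is introduced independently of \<open>scaleR\<close> so that functions with
  values in a complex vector space form a complex vector space under pointwise operations
  without a real normed structure on the function type.
\<close>

class complex_vector = ab_group_add +
  fixes scaleC :: "complex \<Rightarrow> 'a \<Rightarrow> 'a"  (infixr "*\<^sub>C" 75)
  assumes scaleC_add_right: "c *\<^sub>C (x + y) = c *\<^sub>C x + c *\<^sub>C y"
    and scaleC_add_left: "(c + d) *\<^sub>C x = c *\<^sub>C x + d *\<^sub>C x"
    and scaleC_scaleC: "c *\<^sub>C (d *\<^sub>C x) = (c * d) *\<^sub>C x"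
    and scaleC_one: "1 *\<^sub>C x = x"

global_interpretation complex_vector:
  vector_space "scaleC :: complex \<Rightarrow> 'a \<Rightarrow> 'a::complex_vector"
  by unfold_locales (simp_all add: scaleC_add_right scaleC_add_left scaleC_scaleC scaleC_one)

class complex_normed_vector = complex_vector + real_normed_vector +
  assumes scaleR_scaleC: "scaleR r x = scaleC (complex_of_real r) x"
    and norm_scaleC: "norm (scaleC c x) = cmod c * norm x"

class complex_banach = complex_normed_vector + banach

instantiation complex :: complex_banach
begin

definition scaleC_complex :: "complex \<Rightarrow> complex \<Rightarrow> complex" where
  "scaleC_complex c z = c * z"

instance
  by standard (simp_all add: scaleC_complex_def algebra_simps scaleR_conv_of_real norm_mult)

end

instantiation "fun" :: (type, complex_vector) complex_vector
begin

definition scaleC_fun :: "complex \<Rightarrow> ('a \<Rightarrow> 'b) \<Rightarrow> 'a \<Rightarrow> 'b" where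
  "scaleC_fun c f = (\<lambda>x. c *\<^sub>C f x)"

instance
  by standard
    (simp_all add: scaleC_fun_def fun_eq_iff scaleC_add_right scaleC_add_left scaleC_scaleC scaleC_one)

end

section \<open>Normed spaces given by a carrier and a norm\<close>

text \<open>
  Spaces depending on the open set \<open>U\<close> cannot be types. They are given by a carrier \<open>X\<close>
  inside a complex vector space type together with a norm \<open>N\<close> on \<open>X\<close>.
  A map defined on \<open>X\<close> is represented by the total function that vanishes outside \<open>X\<close>,
  so that maps agreeing on \<open>X\<close> are equal and the vector space operations are pointwise.
\<close>

definition vanishes_off :: "'a set \<Rightarrow> ('a \<Rightarrow> 'b::zero) \<Rightarrow> bool" where
  "vanishes_off X f \<longleftrightarrow> (\<forall>x. x \<notin> X \<longrightarrow> f x = 0)"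

definition clinear_on :: "'v::complex_vector set \<Rightarrow> ('v \<Rightarrow> 'w::complex_vector) \<Rightarrow> bool" where
  "clinear_on X T \<longleftrightarrow>
     (\<forall>x\<in>X. \<forall>y\<in>X. T (x + y) = T x + T y) \<and>
     (\<forall>c. \<forall>x\<in>X. T (c *\<^sub>C x) = c *\<^sub>C T x)"

definition cnormed_space :: "'v::complex_vector set \<Rightarrow> ('v \<Rightarrow> real) \<Rightarrow> bool" where
  "cnormed_space X N \<longleftrightarrow>
     complex_vector.subspace X \<and>
     (\<forall>x\<in>X. 0 \<le> N x \<and> (N x = 0 \<longleftrightarrow> x = 0)) \<and>
     (\<forall>x\<in>X. \<forall>y\<in>X. N (x + y) \<le> N x + N y) \<and>
     (\<forall>c. \<forall>x\<in>X. N (c *\<^sub>C x) = cmod c * N x)"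

definition isometric_isomorphism ::
  "'v::complex_vector set \<Rightarrow> ('v \<Rightarrow> real) \<Rightarrow> 'w::complex_vector set \<Rightarrow> ('w \<Rightarrow> real) \<Rightarrow> ('v \<Rightarrow> 'w) \<Rightarrow> bool"
where
  "isometric_isomorphism X N Y M \<Phi> \<longleftrightarrow>
     cnormed_space X N \<and> cnormed_space Y M \<and>
     bij_betw \<Phi> X Y \<and> clinear_on X \<Phi> \<and> (\<forall>x\<in>X. M (\<Phi> x) = N x)"

definition unit_ball :: "'v set \<Rightarrow> ('v \<Rightarrow> real) \<Rightarrow> 'v set" where
  "unit_ball X N = {x\<in>X. N x \<le> 1}"

text \<open>The element \<open>0\<close> is inserted only to get the value \<open>0\<close> when \<open>S\<close> is empty.\<close>

definition sup_norm :: "'a set \<Rightarrow> ('a \<Rightarrow> 'b::real_normed_vector) \<Rightarrow> real" where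
  "sup_norm S f = Sup (insert 0 ((\<lambda>x. norm (f x)) ` S))"

definition bounded_operators ::
  "'v::complex_vector set \<Rightarrow> ('v \<Rightarrow> real) \<Rightarrow> ('v \<Rightarrow> 'w::complex_normed_vector) set" where
  "bounded_operators X N =
     {T. clinear_on X T \<and> (\<exists>K. \<forall>x\<in>X. norm (T x) \<le> K * N x) \<and> vanishes_off X T}"

definition operator_norm ::
  "'v::complex_vector set \<Rightarrow> ('v \<Rightarrow> real) \<Rightarrow> ('v \<Rightarrow> 'w::complex_normed_vector) \<Rightarrow> real" where
  "operator_norm X N T = sup_norm (unit_ball X N) T"

section \<open>Bounded holomorphic mappings and Mujica's linearisation\<close>

text \<open>Holomorphy on an open set is complex Frechet differentiability at each of its points.\<close>

definition holomorphic_map ::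
  "('e::complex_normed_vector \<Rightarrow> 'f::complex_normed_vector) \<Rightarrow> 'e set \<Rightarrow> bool" where
  "holomorphic_map f U \<longleftrightarrow> (\<forall>x\<in>U. \<exists>D. (f has_derivative D) (at x) \<and> clinear_on UNIV D)"

definition Hinf :: "'e::complex_normed_vector set \<Rightarrow> ('e \<Rightarrow> 'f::complex_normed_vector) set" where
  "Hinf U = {f. holomorphic_map f U \<and> bounded (f ` U) \<and> vanishes_off U f}"

definition Hinf_dual :: "'e::complex_normed_vector set \<Rightarrow> (('e \<Rightarrow> complex) \<Rightarrow> complex) set" where
  "Hinf_dual U = bounded_operators (Hinf U) (sup_norm U)"

definition dual_norm :: "'e::complex_normed_vector set \<Rightarrow> (('e \<Rightarrow> complex) \<Rightarrow> complex) \<Rightarrow> real" where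
  "dual_norm U = operator_norm (Hinf U) (sup_norm U)"

definition eval_functional ::
  "'e::complex_normed_vector set \<Rightarrow> 'e \<Rightarrow> ('e \<Rightarrow> complex) \<Rightarrow> complex" where
  "eval_functional U x = (\<lambda>h. if h \<in> Hinf U then h x else 0)"

definition Ginf :: "'e::complex_normed_vector set \<Rightarrow> (('e \<Rightarrow> complex) \<Rightarrow> complex) set" where
  "Ginf U = {\<phi> \<in> Hinf_dual U. \<forall>\<epsilon>>0.
     \<exists>\<psi> \<in> complex_vector.span (eval_functional U ` U). dual_norm U (\<phi> - \<psi>) < \<epsilon>}"

definition linearisation ::
  "'e::complex_normed_vector set \<Rightarrow> ('e \<Rightarrow> 'f::complex_normed_vector) \<Rightarrow>
     (('e \<Rightarrow> complex) \<Rightarrow> complex) \<Rightarrow> 'f" where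
  "linearisation U f =
     (THE T. T \<in> bounded_operators (Ginf U) (dual_norm U) \<and>
             (\<forall>x\<in>U. T (eval_functional U x) = f x))"

section \<open>Relatively \<open>p\<close>-compact sets\<close>

definition lp_seqs :: "real \<Rightarrow> (nat \<Rightarrow> 'a::real_normed_vector) set" where
  "lp_seqs p = {x. summable (\<lambda>n. norm (x n) powr p)}"

definition lp_norm :: "real \<Rightarrow> (nat \<Rightarrow> 'a::real_normed_vector) \<Rightarrow> real" where
  "lp_norm p x = (\<Sum>n. norm (x n) powr p) powr (1 / p)"

text \<open>
  The closed unit ball of the sequence space with exponent \<open>p* = p / (p - 1)\<close> for \<open>p > 1\<close>,
  and of \<open>c\<^sub>0\<close> (not of the space of all bounded sequences) for \<open>p = 1\<close>.
\<close>

definition coeff_ball :: "real \<Rightarrow> (nat \<Rightarrow> complex) set" where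
  "coeff_ball p =
     (if p = 1 then {a. a \<longlonglongrightarrow> 0 \<and> (\<forall>n. cmod (a n) \<le> 1)}
      else {a \<in> lp_seqs (p / (p - 1)). lp_norm (p / (p - 1)) a \<le> 1})"

definition pconv :: "real \<Rightarrow> (nat \<Rightarrow> 'f::complex_normed_vector) \<Rightarrow> 'f set" where
  "pconv p x = {y. \<exists>a \<in> coeff_ball p. (\<lambda>n. a n *\<^sub>C x n) sums y}"

definition rel_p_compact :: "real \<Rightarrow> 'f::complex_normed_vector set \<Rightarrow> bool" where
  "rel_p_compact p K \<longleftrightarrow> (\<exists>x \<in> lp_seqs p. K \<subseteq> pconv p x)"

definition m_p :: "real \<Rightarrow> 'f::complex_normed_vector set \<Rightarrow> real" where
  "m_p p K = Inf {lp_norm p x | x. x \<in> lp_seqs p \<and> K \<subseteq> pconv p x}"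

definition p_compact_operators ::
  "real \<Rightarrow> 'v::complex_vector set \<Rightarrow> ('v \<Rightarrow> real) \<Rightarrow> ('v \<Rightarrow> 'f::complex_normed_vector) set" where
  "p_compact_operators p X N =
     {T. clinear_on X T \<and> rel_p_compact p (T ` unit_ball X N) \<and> vanishes_off X T}"

definition k_p ::
  "real \<Rightarrow> 'v::complex_vector set \<Rightarrow> ('v \<Rightarrow> real) \<Rightarrow> ('v \<Rightarrow> 'f::complex_normed_vector) \<Rightarrow> real" where
  "k_p p X N T = m_p p (T ` unit_ball X N)"

definition Hinf_Kp ::
  "real \<Rightarrow> 'e::complex_normed_vector set \<Rightarrow> ('e \<Rightarrow> 'f::complex_normed_vector) set" where
  "Hinf_Kp p U = {f. holomorphic_map f U \<and> rel_p_compact p (f ` U) \<and> vanishes_off U f}"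

definition k_p_Hinf ::
  "real \<Rightarrow> 'e::complex_normed_vector set \<Rightarrow> ('e \<Rightarrow> 'f::complex_normed_vector) \<Rightarrow> real" where
  "k_p_Hinf p U f = m_p p (f ` U)"

end

theory Submission
  imports Defs "HOL-Complex_Analysis.Complex_Analysis"
begin

text \<open>
  The linearisation \<open>T\<close> of \<open>f\<close> maps the evaluation at \<open>x\<close> to \<open>f x\<close>. Since the evaluations lie in the
  unit ball of the predual, the range of \<open>f\<close> is contained in the image of that ball. In the other direction the
  image of the ball is contained in every closed absolutely convex set \<open>C\<close> that contains the range of
  \<open>f\<close>: if \<open>\<psi>\<close> is a functional with \<open>\<bar>\<psi>\<bar> \<le> 1\<close> on \<open>C\<close>, then \<open>\<psi> \<circ> f\<close> has supremum norm at most \<open>1\<close>, and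
  \<open>\<psi> (T \<phi>) = \<phi> (\<psi> \<circ> f)\<close> has modulus at most \<open>1\<close> for \<open>\<phi>\<close> in the unit ball, so that \<open>T \<phi>\<close> belongs to the bipolar
  of \<open>C\<close> (\<open>weak_value_in_closed_absolutely_convex\<close>, resting on \<open>bipolar\<close> and the Hahn-Banach theorem).

  Hence both sets are contained in the same \<open>p\<close>-convex hulls, provided that these hulls are closed. For
  \<open>p > 1\<close> they are compact, as continuous images of coefficient balls that are compact for
  coordinatewise convergence (\<open>compact_full_pconv\<close>). For \<open>p = 1\<close> the coefficients run through the unit
  ball of \<open>c\<^sub>0\<close> and the hull need not be closed; but the compact hull with bounded coefficients lies in the
  hull of another sequence whose norm is larger by an arbitrarily small amount
  (\<open>full_pconv_subset_pconv\<close>). Thus the two sets are relatively \<open>p\<close>-compact simultaneously, with the same value of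
  \<open>m_p\<close> (\<open>linearisation_unit_ball_p_compact\<close>).

  The same bipolar argument, with balls for \<open>C\<close>, yields existence, uniqueness and boundedness of the
  linearisation: the relation \<open>\<psi> y = \<phi> (\<psi> \<circ> f)\<close> for all \<open>\<psi>\<close> determines \<open>y\<close> and passes from the span of the evaluations to
  limits (\<open>weak_value_exists\<close>). For the isomorphism, injectivity and linearity follow from uniqueness.
  Surjectivity needs that \<open>x \<mapsto> T (\<delta> x)\<close> is holomorphic for every bounded operator \<open>T\<close>: Cauchy's
  estimates on complex lines control the Taylor remainders of all \<open>h\<close> in the unit ball of the bounded
  holomorphic functions uniformly, so that \<open>\<delta>\<close> is differentiable in norm
  (\<open>holomorphic_operator_eval\<close>). Finally \<open>m_p\<close> is a norm on functions with relatively \<open>p\<close>-compact image; the triangle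
  inequality comes from interleaving two sequences with suitable weights (\<open>pconv_add\<close>).
\<close>

section \<open>Complex scalar multiplication\<close>

lemma bounded_linear_scaleC_right: "bounded_linear (\<lambda>x::'a::complex_normed_vector. c *\<^sub>C x)"
  by (rule bounded_linear_intro[of _ "cmod c"])
    (simp_all add: scaleC_add_right scaleR_scaleC norm_scaleC mult.commute)

lemma bounded_linear_scaleC_left: "bounded_linear (\<lambda>c. c *\<^sub>C (x :: 'a::complex_normed_vector))"
  by (rule bounded_linear_intro[of _ "norm x"])
    (simp_all add: scaleC_add_left scaleR_scaleC norm_scaleC scaleR_conv_of_real scaleC_complex_def mult.commute)

section \<open>The Hahn-Banach theorem for sublinear functionals\<close>

definition sublinear :: "('a::real_vector \<Rightarrow> real) \<Rightarrow> bool" where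
  "sublinear q \<longleftrightarrow> (\<forall>x y. q (x + y) \<le> q x + q y) \<and> (\<forall>t>0. \<forall>x. q (t *\<^sub>R x) = t * q x)"

lemma sublinear_add: "sublinear q \<Longrightarrow> q (x + y) \<le> q x + q y"
  by (simp add: sublinear_def)

lemma sublinear_zero:
  assumes "sublinear q"
  shows "q 0 = 0"
proof -
  have "\<forall>x. q (2 *\<^sub>R x) = 2 * q x" using assms by (simp add: sublinear_def)
  then have "q (2 *\<^sub>R 0) = 2 * q 0" ..
  then show ?thesis by simp
qed

lemma sublinear_scale: "sublinear q \<Longrightarrow> 0 \<le> t \<Longrightarrow> q (t *\<^sub>R x) = t * q x"
  by (cases "t = 0") (auto simp: sublinear_zero sublinear_def)

lemma sublinear_lower: "sublinear q \<Longrightarrow> - q (- x) \<le> q x"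
  using sublinear_add[of q x "- x"] sublinear_zero[of q] by simp

text \<open>
  Given a sublinear functional and a point \<open>x\<close>, this produces a smaller one that is as small as possible
  at \<open>- x\<close>. It serves twice: applied to a minimal functional it forces additivity, and applied
  before minimising it forces the value at a prescribed point.
\<close>
lemma sublinear_minorant_shift:
  fixes q :: "'a::real_vector \<Rightarrow> real"
  assumes q: "sublinear q"
  obtains q' where "sublinear q'" and "\<And>y. q' y \<le> q y" and "q' (- x) \<le> - q x"
proof -
  \<comment> \<open>\<open>t * q x\<close> is the largest growth of \<open>q\<close> on the way from \<open>y\<close> to \<open>y + t *\<^sub>R x\<close> that subadditivity permits\<close>
  define S where "S y = (\<lambda>t. q (y + t *\<^sub>R x) - t * q x) ` {0..}" for y
  define q' where "q' y = Inf (S y)" for y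
  have lower: "- q (- y) \<le> s" if s: "s \<in> S y" for s y
  proof -
    obtain t where t: "t \<ge> 0" "s = q (y + t *\<^sub>R x) - t * q x" using s by (auto simp: S_def)
    have "t * q x = q ((y + t *\<^sub>R x) + - y)" using sublinear_scale[OF q t(1)] by simp
    also have "\<dots> \<le> q (y + t *\<^sub>R x) + q (- y)" by (rule sublinear_add[OF q])
    finally show ?thesis using t by simp
  qed
  then have bdd: "bdd_below (S y)" for y by (auto simp: bdd_below_def)
  have ne: "S y \<noteq> {}" for y by (auto simp: S_def)
  have below: "q' y \<le> q (y + t *\<^sub>R x) - t * q x" if "t \<ge> 0" for y t
    unfolding q'_def by (rule cInf_lower[OF _ bdd]) (use that in \<open>auto simp: S_def\<close>)
  have greatest: "c \<le> q' y" if "\<And>t. t \<ge> 0 \<Longrightarrow> c \<le> q (y + t *\<^sub>R x) - t * q x" for c y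
    unfolding q'_def by (rule cInf_greatest[OF ne]) (use that in \<open>auto simp: S_def\<close>)
  have add: "q' (y + z) \<le> q' y + q' z" for y z
  proof -
    have 1: "q' (y + z) - (q (z + t *\<^sub>R x) - t * q x) \<le> q' y" if t: "t \<ge> 0" for t
    proof (rule greatest)
      fix s :: real assume s: "s \<ge> 0"
      have "q' (y + z) \<le> q (y + z + (s + t) *\<^sub>R x) - (s + t) * q x"
        by (rule below) (use s t in simp)
      moreover have "q (y + z + (s + t) *\<^sub>R x) \<le> q (y + s *\<^sub>R x) + q (z + t *\<^sub>R x)"
        using sublinear_add[OF q, of "y + s *\<^sub>R x" "z + t *\<^sub>R x"]
        by (simp add: algebra_simps)
      ultimately show "q' (y + z) - (q (z + t *\<^sub>R x) - t * q x) \<le> q (y + s *\<^sub>R x) - s * q x"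
        by (simp add: algebra_simps)
    qed
    have "q' (y + z) - q' y \<le> q' z"
      by (rule greatest) (use 1 in \<open>simp add: algebra_simps\<close>)
    then show ?thesis by simp
  qed
  have scale_le: "t * q' y \<le> q' (t *\<^sub>R y)" if t: "t > 0" for t y
  proof (rule greatest)
    fix s :: real assume s: "s \<ge> 0"
    have "t * q' y \<le> t * (q (y + (s / t) *\<^sub>R x) - (s / t) * q x)"
      using t s by (intro mult_left_mono below) auto
    also have "\<dots> = q (t *\<^sub>R (y + (s / t) *\<^sub>R x)) - s * q x"
      using t sublinear_scale[OF q, of t "y + (s / t) *\<^sub>R x"] by (simp add: right_diff_distrib)
    also have "t *\<^sub>R (y + (s / t) *\<^sub>R x) = t *\<^sub>R y + s *\<^sub>R x" using t by (simp add: scaleR_add_right)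
    finally show "t * q' y \<le> q (t *\<^sub>R y + s *\<^sub>R x) - s * q x" .
  qed
  have "q' (t *\<^sub>R y) = t * q' y" if t: "t > 0" for t y
  proof (rule antisym[OF _ scale_le[OF t]])
    have "(1 / t) * q' (t *\<^sub>R y) \<le> q' ((1 / t) *\<^sub>R (t *\<^sub>R y))" using t by (intro scale_le) auto
    then show "q' (t *\<^sub>R y) \<le> t * q' y" using t by (simp add: field_simps)
  qed
  with add have "sublinear q'" by (simp add: sublinear_def)
  moreover have "q' y \<le> q y" for y using below[of 0 y] by simp
  moreover have "q' (- x) \<le> - q x" using below[of 1 "- x"] sublinear_zero[OF q] by simp
  ultimately show ?thesis using that by blast
qed

text \<open>
  By minimality the shifted minorant coincides with \<open>q\<close>, so \<open>q (- x) \<le> - q x\<close>; then \<open>q\<close> is odd,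
  and an odd subadditive functional is additive.
\<close>
lemma minimal_sublinear_linear:
  fixes q :: "'a::real_vector \<Rightarrow> real"
  assumes q: "sublinear q"
    and min: "\<And>q'. sublinear q' \<Longrightarrow> (\<And>x. q' x \<le> q x) \<Longrightarrow> q' = q"
  shows "linear q"
proof -
  have neg: "q (- x) = - q x" for x
  proof -
    obtain q' where "sublinear q'" "\<And>y. q' y \<le> q y" "q' (- x) \<le> - q x"
      using sublinear_minorant_shift[OF q] by blast
    with min have "q (- x) \<le> - q x" by metis
    with sublinear_lower[OF q, of x] show ?thesis by simp
  qed
  have add: "q (x + y) = q x + q y" for x y
    using sublinear_add[OF q, of x y] sublinear_add[OF q, of "- x" "- y"] neg[of x] neg[of y] neg[of "x + y"]
    by (simp add: algebra_simps)
  have "q (r *\<^sub>R x) = r *\<^sub>R q x" for r x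
  proof (cases "r \<ge> 0")
    case True
    then show ?thesis by (simp add: sublinear_scale[OF q])
  next
    case False
    then show ?thesis using sublinear_scale[OF q, of "- r" x] neg[of "r *\<^sub>R x"] by simp
  qed
  with add show ?thesis by (intro linearI)
qed

text \<open>
  Zorn's lemma in the set of sublinear functionals below \<open>q\<close>: a pointwise infimum of a nonempty chain is
  again sublinear, being bounded below by \<open>\<lambda>x. - q (- x)\<close>. The empty chain is bounded by \<open>q\<close> itself.
\<close>
lemma ex_linear_below_sublinear:
  fixes q :: "'a::real_vector \<Rightarrow> real"
  assumes q: "sublinear q"
  obtains l where "linear l" and "\<And>x. l x \<le> q x"
proof -
  define A where "A = {s. sublinear s \<and> (\<forall>x. s x \<le> q x)}"
  define P where "P = (\<lambda>s s' :: 'a \<Rightarrow> real. \<forall>x. s' x \<le> s x)"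
  have "\<exists>m\<in>A. \<forall>a\<in>A. P m a \<longrightarrow> a = m"
  proof (rule predicate_Zorn)
    show "partial_order_on A (relation_of P A)"
    proof (rule partial_order_on_relation_ofI)
      fix a b assume "P a b" "P b a"
      then show "a = b" by (auto simp: P_def intro!: ext antisym)
    qed (auto simp: P_def intro: order_trans)
  next
    fix C assume C: "C \<in> Chains (relation_of P A)"
    then have CA: "s \<in> A" if "s \<in> C" for s using that by (auto simp: Chains_def relation_of_def)
    have comp: "P s s' \<or> P s' s" if "s \<in> C" "s' \<in> C" for s s'
      using that C by (auto simp: Chains_def relation_of_def)
    show "\<exists>u\<in>A. \<forall>a\<in>C. P a u"
    proof (cases "C = {}")
      case True
      then show ?thesis using q by (auto simp: A_def)
    next
      case False
      define u where "u x = (INF s\<in>C. s x)" for x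
      have "- q (- x) \<le> s x" if "s \<in> C" for s x
        proof -
        have "s (- x) \<le> q (- x)" "sublinear s" using CA[OF that] by (auto simp: A_def)
        then show ?thesis using sublinear_lower[of s x] by linarith
      qed
      then have bdd: "bdd_below ((\<lambda>s. s x) ` C)" for x by (auto simp: bdd_below_def)
      have le: "u x \<le> s x" if "s \<in> C" for s x
        unfolding u_def by (rule cINF_lower[OF bdd that])
      have gr: "c \<le> u x" if "\<And>s. s \<in> C \<Longrightarrow> c \<le> s x" for c x
        unfolding u_def by (rule cINF_greatest[OF False that])
      have add: "u (x + y) \<le> u x + u y" for x y
      proof -
        have 1: "u (x + y) \<le> s x + s' y" if ss: "s \<in> C" "s' \<in> C" for s s'
        proof -
          \<comment> \<open>in a chain, one of \<open>s\<close> and \<open>s'\<close> is below both\<close>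
          obtain s0 where s0: "s0 \<in> C" "\<And>z. s0 z \<le> s z" "\<And>z. s0 z \<le> s' z"
            using comp[OF ss] ss by (auto simp: P_def)
          have "u (x + y) \<le> s0 x + s0 y"
            using le[OF s0(1), of "x + y"] sublinear_add[of s0 x y] CA[OF s0(1)] by (simp add: A_def)
          also have "\<dots> \<le> s x + s' y" by (intro add_mono s0)
          finally show ?thesis .
        qed
        have "u (x + y) - s' y \<le> u x" if "s' \<in> C" for s'
          by (rule gr) (use 1[OF _ that] in \<open>simp add: algebra_simps\<close>)
        then have "u (x + y) - u x \<le> u y" by (intro gr) (simp add: algebra_simps)
        then show ?thesis by simp
      qed
      have scale: "u (t *\<^sub>R x) = t * u x" if t: "t > 0" for t x
      proof (rule antisym)
        have *: "s (t *\<^sub>R x) = t * s x" if "s \<in> C" for s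
          using CA[OF that] t by (auto simp: A_def sublinear_def)
        show "t * u x \<le> u (t *\<^sub>R x)"
        proof (rule gr)
          fix s assume s: "s \<in> C"
          show "t * u x \<le> s (t *\<^sub>R x)" using le[OF s, of x] t by (simp add: *[OF s])
        qed
        have "u (t *\<^sub>R x) / t \<le> u x"
        proof (rule gr)
          fix s assume s: "s \<in> C"
          have "u (t *\<^sub>R x) \<le> t * s x" using le[OF s, of "t *\<^sub>R x"] *[OF s] by simp
          then show "u (t *\<^sub>R x) / t \<le> s x" using t by (simp add: field_simps)
        qed
        then show "u (t *\<^sub>R x) \<le> t * u x" using t by (simp add: field_simps)
      qed
      obtain s where "s \<in> C" using False by blast
      then have "u x \<le> q x" for x using le[of s x] CA[of s] by (auto simp: A_def intro: order_trans)
      with add scale have "u \<in> A" by (simp add: A_def sublinear_def)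
      with le show ?thesis by (auto simp: P_def)
    qed
  qed
  then obtain m where m: "m \<in> A" and min: "\<And>a. a \<in> A \<Longrightarrow> P m a \<Longrightarrow> a = m" by blast
  have "linear m"
  proof (rule minimal_sublinear_linear)
    show "sublinear m" using m by (simp add: A_def)
    show "q' = m" if "sublinear q'" "\<And>x. q' x \<le> m x" for q'
      using that m by (intro min) (auto simp: A_def P_def intro: order_trans)
  qed
  with m that show ?thesis by (auto simp: A_def)
qed

lemma hahn_banach_sublinear:
  fixes q :: "'a::real_vector \<Rightarrow> real"
  assumes q: "sublinear q"
  obtains l where "linear l" and "\<And>x. l x \<le> q x" and "l x0 = q x0"
proof -
  obtain q' where q': "sublinear q'" "\<And>y. q' y \<le> q y" "q' (- x0) \<le> - q x0"
    using sublinear_minorant_shift[OF q] by blast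
  obtain l where l: "linear l" "\<And>x. l x \<le> q' x" using ex_linear_below_sublinear[OF q'(1)] by blast
  have "l x0 = q x0"
  proof (rule antisym)
    show "l x0 \<le> q x0" using l(2)[of x0] q'(2)[of x0] by simp
    show "q x0 \<le> l x0" using l(2)[of "- x0"] q'(3) linear_neg[OF l(1), of x0] by simp
  qed
  with l q'(2) that show ?thesis by (meson order_trans)
qed

section \<open>Bipolars of closed absolutely convex sets\<close>

definition absolutely_convex :: "'a::complex_vector set \<Rightarrow> bool" where
  "absolutely_convex C \<longleftrightarrow> 0 \<in> C \<and>
     (\<forall>x\<in>C. \<forall>y\<in>C. \<forall>a b. cmod a + cmod b \<le> 1 \<longrightarrow> a *\<^sub>C x + b *\<^sub>C y \<in> C)"

lemma absolutely_convex_scaleC: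
  assumes "absolutely_convex C" "x \<in> C" "cmod a \<le> 1"
  shows "a *\<^sub>C x \<in> C"
proof -
  have "cmod a + cmod 0 \<le> 1" using assms by simp
  then have "a *\<^sub>C x + 0 *\<^sub>C x \<in> C" using assms unfolding absolutely_convex_def by blast
  then show ?thesis by simp
qed

definition bounded_functional :: "('a::complex_normed_vector \<Rightarrow> complex) \<Rightarrow> bool" where
  "bounded_functional \<psi> \<longleftrightarrow> clinear_on UNIV \<psi> \<and> (\<exists>K. \<forall>x. cmod (\<psi> x) \<le> K * norm x)"

text \<open>
  The functional is the Minkowski gauge of the absolutely convex hull of \<open>C\<close> and the ball of radius
  \<open>1 / M\<close>, written as an infimum over all splittings of \<open>x\<close> into a part \<open>t *\<^sub>R c\<close> of cost \<open>t\<close> and a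
  remainder of cost \<open>M\<close> times its norm. Adding the ball makes the gauge finite and continuous even
  though \<open>C\<close> may have empty interior, and a point at distance at least \<open>1 / M\<close> from \<open>C\<close> still has
  gauge at least \<open>1\<close>.
\<close>
lemma sublinear_gauge:
  fixes C :: "'a::complex_normed_vector set"
  assumes C: "absolutely_convex C" and M: "0 \<le> M"
  obtains q where "sublinear q" and "\<And>c x. cmod c = 1 \<Longrightarrow> q (c *\<^sub>C x) = q x"
    and "\<And>x. x \<in> C \<Longrightarrow> q x \<le> 1" and "\<And>x. q x \<le> M * norm x"
    and "\<And>x. (\<And>c. c \<in> C \<Longrightarrow> 1 \<le> M * norm (x - c)) \<Longrightarrow> 1 \<le> q x"
proof -
  define S where "S x = {t + M * norm (x - t *\<^sub>R c) | t c. 0 \<le> t \<and> c \<in> C}" for x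
  define q where "q x = Inf (S x)" for x
  have C0: "0 \<in> C" using C by (simp add: absolutely_convex_def)
  have bdd: "bdd_below (S x)" for x
    unfolding bdd_below_def by (rule exI[of _ 0]) (use M in \<open>auto simp: S_def\<close>)
  have ne: "S x \<noteq> {}" for x using C0 by (auto simp: S_def)
  have below: "q x \<le> t + M * norm (x - t *\<^sub>R c)" if "t \<ge> 0" "c \<in> C" for x t c
    unfolding q_def by (rule cInf_lower[OF _ bdd]) (use that in \<open>auto simp: S_def\<close>)
  have greatest: "k \<le> q x" if "\<And>t c. t \<ge> 0 \<Longrightarrow> c \<in> C \<Longrightarrow> k \<le> t + M * norm (x - t *\<^sub>R c)" for k x
    unfolding q_def by (rule cInf_greatest[OF ne]) (use that in \<open>auto simp: S_def\<close>)
  have add: "q (x + y) \<le> q x + q y" for x y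
  proof -
    have 1: "q (x + y) \<le> (t + M * norm (x - t *\<^sub>R c)) + (s + M * norm (y - s *\<^sub>R d))"
      if tc: "t \<ge> 0" "c \<in> C" and sd: "s \<ge> 0" "d \<in> C" for t c s d
    proof -
      obtain e where e: "e \<in> C" "(t + s) *\<^sub>R e = t *\<^sub>R c + s *\<^sub>R d"
      proof (cases "t + s = 0")
        case True
        then have "t = 0" "s = 0" using tc sd by auto
        then show ?thesis using that[OF C0] by simp
      next
        case False
        then have pos: "t + s > 0" using tc sd by simp
        let ?a = "complex_of_real (t / (t + s))" and ?b = "complex_of_real (s / (t + s))"
        have "cmod ?a + cmod ?b \<le> 1"
          using pos tc sd unfolding norm_of_real by (simp add: add_divide_distrib[symmetric])
        then have "?a *\<^sub>C c + ?b *\<^sub>C d \<in> C" using C tc sd by (auto simp: absolutely_convex_def)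
        moreover have "(t + s) *\<^sub>R (?a *\<^sub>C c + ?b *\<^sub>C d) = t *\<^sub>R c + s *\<^sub>R d"
          using pos unfolding scaleR_scaleC[symmetric] by (simp add: scaleR_add_right)
        ultimately show ?thesis using that by blast
      qed
      have "q (x + y) \<le> (t + s) + M * norm ((x + y) - (t + s) *\<^sub>R e)"
        by (rule below) (use tc sd e in auto)
      also have "(x + y) - (t + s) *\<^sub>R e = (x - t *\<^sub>R c) + (y - s *\<^sub>R d)" by (simp add: e(2))
      also have "(t + s) + M * norm \<dots> \<le> (t + s) + M * (norm (x - t *\<^sub>R c) + norm (y - s *\<^sub>R d))"
        by (intro add_left_mono mult_left_mono norm_triangle_ineq M)
      finally show ?thesis by (simp add: algebra_simps)
    qed
    have "q (x + y) - (s + M * norm (y - s *\<^sub>R d)) \<le> q x" if "s \<ge> 0" "d \<in> C" for s d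
      by (rule greatest) (use 1[OF _ _ that] in \<open>simp add: algebra_simps\<close>)
    then have "q (x + y) - q x \<le> q y" by (intro greatest) (simp add: algebra_simps)
    then show ?thesis by simp
  qed
  have scale_le: "s * q x \<le> q (s *\<^sub>R x)" if s: "s > 0" for s x
  proof (rule greatest)
    fix t c assume tc: "0 \<le> (t::real)" "c \<in> C"
    have "s * q x \<le> s * (t / s + M * norm (x - (t / s) *\<^sub>R c))"
      using s tc by (intro mult_left_mono below) auto
    also have "\<dots> = t + M * norm (s *\<^sub>R (x - (t / s) *\<^sub>R c))"
      unfolding norm_scaleR using s by (simp add: distrib_left)
    also have "s *\<^sub>R (x - (t / s) *\<^sub>R c) = s *\<^sub>R x - t *\<^sub>R c" using s by (simp add: scaleR_diff_right)
    finally show "s * q x \<le> t + M * norm (s *\<^sub>R x - t *\<^sub>R c)" .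
  qed
  have scale: "q (s *\<^sub>R x) = s * q x" if s: "s > 0" for s x
  proof (rule antisym[OF _ scale_le[OF s]])
    have "(1 / s) * q (s *\<^sub>R x) \<le> q ((1 / s) *\<^sub>R (s *\<^sub>R x))" using s by (intro scale_le) auto
    then show "q (s *\<^sub>R x) \<le> s * q x" using s by (simp add: field_simps)
  qed
  have rot_le: "q (a *\<^sub>C x) \<le> q x" if a: "cmod a = 1" for a x
  proof (rule greatest)
    fix t c assume tc: "0 \<le> (t::real)" "c \<in> C"
    have "q (a *\<^sub>C x) \<le> t + M * norm (a *\<^sub>C x - t *\<^sub>R (a *\<^sub>C c))"
      using tc a by (intro below absolutely_convex_scaleC[OF C]) auto
    also have "a *\<^sub>C x - t *\<^sub>R (a *\<^sub>C c) = a *\<^sub>C (x - t *\<^sub>R c)"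
      by (simp add: scaleR_scaleC complex_vector.scale_right_diff_distrib mult.commute)
    finally show "q (a *\<^sub>C x) \<le> t + M * norm (x - t *\<^sub>R c)" by (simp add: norm_scaleC a)
  qed
  have rot: "q (a *\<^sub>C x) = q x" if a: "cmod a = 1" for a x
  proof (rule antisym[OF rot_le[OF a]])
    have "a \<noteq> 0" using a by auto
    then have "x = (1 / a) *\<^sub>C (a *\<^sub>C x)" by simp
    then show "q x \<le> q (a *\<^sub>C x)" using rot_le[of "1 / a" "a *\<^sub>C x"] a by (simp add: norm_divide)
  qed
  have sub: "sublinear q" using add scale by (simp add: sublinear_def)
  have big: "1 \<le> q x" if x: "\<And>c. c \<in> C \<Longrightarrow> 1 \<le> M * norm (x - c)" for x
  proof (rule greatest)
    fix t c assume tc: "0 \<le> (t::real)" "c \<in> C"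
    show "1 \<le> t + M * norm (x - t *\<^sub>R c)"
    proof (cases "t \<ge> 1")
      case True
      then show ?thesis using M by (simp add: add_increasing2)
    next
      case False
      then have "t *\<^sub>R c \<in> C" using tc absolutely_convex_scaleC[OF C tc(2), of "of_real t"]
        by (simp add: scaleR_scaleC)
      from x[OF this] tc show ?thesis by simp
    qed
  qed
  have "q x \<le> 1" if "x \<in> C" for x using below[OF _ that, of 1 x] by simp
  moreover have "q x \<le> M * norm x" for x using below[OF _ C0, of 0 x] by simp
  ultimately show ?thesis using that[OF sub rot _ _ big] by blast
qed

lemma complexify_linear:
  fixes l :: "'a::complex_normed_vector \<Rightarrow> real"
  assumes l: "linear l"
  defines "\<psi> \<equiv> \<lambda>x. Complex (l x) (- l (\<i> *\<^sub>C x))"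
  shows "clinear_on UNIV \<psi>"
proof -
  have add: "\<psi> (x + y) = \<psi> x + \<psi> y" for x y
    using linear_add[OF l] by (simp add: \<psi>_def scaleC_add_right complex_eq_iff)
  have sc: "\<psi> (of_real r *\<^sub>C x) = of_real r * \<psi> x" for r x
  proof -
    have "\<i> *\<^sub>C (of_real r *\<^sub>C x) = r *\<^sub>R (\<i> *\<^sub>C x)" by (simp add: scaleR_scaleC mult.commute)
    then show ?thesis using linear_scale[OF l, of r]
      by (simp add: \<psi>_def complex_eq_iff scaleR_scaleC[symmetric])
  qed
  have im: "\<psi> (\<i> *\<^sub>C x) = \<i> * \<psi> x" for x
  proof -
    have "\<i> *\<^sub>C (\<i> *\<^sub>C x) = - x" by simp
    then show ?thesis using linear_neg[OF l, of x] by (simp add: \<psi>_def complex_eq_iff)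
  qed
  have "\<psi> (c *\<^sub>C x) = c *\<^sub>C \<psi> x" for c x
  proof -
    have c: "c = of_real (Re c) + of_real (Im c) * \<i>" by (simp add: complex_eq_iff)
    have "c *\<^sub>C x = of_real (Re c) *\<^sub>C x + of_real (Im c) *\<^sub>C (\<i> *\<^sub>C x)"
      by (subst c) (simp add: scaleC_add_left)
    then have "\<psi> (c *\<^sub>C x) = (of_real (Re c) + of_real (Im c) * \<i>) * \<psi> x"
      by (simp only: add sc im distrib_right mult.assoc)
    then show ?thesis using c by (simp add: scaleC_complex_def)
  qed
  with add show ?thesis by (simp add: clinear_on_def)
qed

text \<open>
  A point outside \<open>C\<close> is separated from \<open>C\<close> by a linear functional dominated by a gauge as above. The
  separation has to be strict at \<open>y\<close>, so the gauge is adapted to a multiple \<open>s *\<^sub>R y\<close> with \<open>s < 1\<close>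
  that still lies outside \<open>C\<close>: then the gauge of \<open>y\<close> is at least \<open>1 / s > 1\<close>.
\<close>
theorem bipolar:
  fixes C :: "'a::complex_normed_vector set"
  assumes C: "absolutely_convex C" and closed: "closed C"
    and y: "\<And>\<psi>. bounded_functional \<psi> \<Longrightarrow> (\<And>c. c \<in> C \<Longrightarrow> cmod (\<psi> c) \<le> 1) \<Longrightarrow> cmod (\<psi> y) \<le> 1"
  shows "y \<in> C"
proof (rule ccontr)
  assume yC: "y \<notin> C"
  have "((\<lambda>s. s *\<^sub>R y) \<longlongrightarrow> 1 *\<^sub>R y) (at_left (1::real))" by (intro tendsto_intros)
  moreover have "open (- C)" "1 *\<^sub>R y \<in> - C" using closed yC by auto
  ultimately have "\<forall>\<^sub>F s in at_left 1. s *\<^sub>R y \<in> - C" using topological_tendstoD by blast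
  moreover have "\<forall>\<^sub>F s in at_left (1::real). 0 < s" by (rule eventually_at_leftI[of 0]) auto
  moreover have "\<forall>\<^sub>F s in at_left (1::real). s < 1" by (rule eventually_at_leftI[of 0]) auto
  ultimately have "\<forall>\<^sub>F s in at_left 1. s *\<^sub>R y \<in> - C \<and> 0 < s \<and> s < 1" by eventually_elim simp
  from eventually_happens'[OF trivial_limit_at_left_real this]
  obtain s :: real where s: "s *\<^sub>R y \<notin> C" "0 < s" "s < 1" by auto
  obtain d where d: "d > 0" "ball (s *\<^sub>R y) d \<subseteq> - C"
    using open_contains_ball[of "- C"] closed s(1) by auto
  then have dist: "d \<le> dist (s *\<^sub>R y) c" if "c \<in> C" for c
    using that by (meson ComplD in_mono mem_ball not_less)
  obtain q where q: "sublinear q" "\<And>c x. cmod c = 1 \<Longrightarrow> q (c *\<^sub>C x) = q x"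
    "\<And>x. x \<in> C \<Longrightarrow> q x \<le> 1" "\<And>x. q x \<le> (1 / d) * norm x"
    "\<And>x. (\<And>c. c \<in> C \<Longrightarrow> 1 \<le> (1 / d) * norm (x - c)) \<Longrightarrow> 1 \<le> q x"
    using sublinear_gauge[OF C, of "1 / d"] d(1) by auto
  have "1 \<le> q (s *\<^sub>R y)"
    by (rule q(5)) (use d(1) dist in \<open>simp add: dist_norm le_divide_eq\<close>)
  then have "1 \<le> s * q y" using sublinear_scale[OF q(1)] s by simp
  then have qy: "q y > 1" using s
    by (smt (verit) mult_le_cancel_right1 mult_nonneg_nonpos)
  obtain l where l: "linear l" "\<And>x. l x \<le> q x" "l y = q y"
    using hahn_banach_sublinear[OF q(1)] by blast
  define \<psi> where "\<psi> x = Complex (l x) (- l (\<i> *\<^sub>C x))" for x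
  have lin: "clinear_on UNIV \<psi>" unfolding \<psi>_def by (rule complexify_linear[OF l(1)])
  have le: "cmod (\<psi> x) \<le> q x" for x
  proof (cases "\<psi> x = 0")
    case True
    have "l (0 *\<^sub>R x) \<le> q x" using sublinear_scale[OF q(1), of 0 x] l(2)[of x] True
      linear_0[OF l(1)] by (simp add: \<psi>_def complex_eq_iff)
    then show ?thesis using True linear_0[OF l(1)] by simp
  next
    case False
    \<comment> \<open>rotate \<open>x\<close> so that the value of \<open>\<psi>\<close> becomes real, hence equal to that of \<open>l\<close>\<close>
    define c where "c = cmod (\<psi> x) / \<psi> x"
    have c: "cmod c = 1" using False by (simp add: c_def norm_divide)
    have "\<psi> (c *\<^sub>C x) = c * \<psi> x" using lin by (simp add: clinear_on_def scaleC_complex_def)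
    also have "\<dots> = of_real (cmod (\<psi> x))" using False by (simp add: c_def)
    finally have "cmod (\<psi> x) = l (c *\<^sub>C x)" by (simp add: \<psi>_def complex_eq_iff)
    also have "\<dots> \<le> q x" using l(2)[of "c *\<^sub>C x"] q(2)[OF c] by simp
    finally show ?thesis .
  qed
  have "cmod (\<psi> x) \<le> (1 / d) * norm x" for x using le[of x] q(4)[of x] by linarith
  with lin have "bounded_functional \<psi>" unfolding bounded_functional_def by blast
  then have "cmod (\<psi> y) \<le> 1"
  proof (rule y)
    show "cmod (\<psi> c) \<le> 1" if "c \<in> C" for c using le[of c] q(3)[OF that] by linarith
  qed
  moreover have "q y \<le> cmod (\<psi> y)" using l(3) complex_Re_le_cmod[of "\<psi> y"] by (simp add: \<psi>_def)
  ultimately show False using qy by simp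
qed

section \<open>Compact hulls of p-summable sequences\<close>

text \<open>
  Convexity of \<open>\<lambda>u. u powr q\<close> for weights of sum at most \<open>1\<close>; the missing weight falls on the value at \<open>0\<close>.
\<close>
lemma powr_weighted_le:
  fixes s t u v q :: real
  assumes q: "1 \<le> q" and st: "0 \<le> s" "0 \<le> t" "s + t \<le> 1" and uv: "0 \<le> u" "0 \<le> v"
  shows "(s * u + t * v) powr q \<le> s * u powr q + t * v powr q"
proof -
  have one: "(r * w) powr q \<le> r * w powr q" if "0 \<le> r" "r \<le> 1" "0 \<le> w" for r w
  proof -
    have "r powr q \<le> r powr 1" using that q by (intro powr_mono') auto
    then show ?thesis using that by (simp add: powr_mult mult_right_mono)
  qed
  consider "u = 0 \<or> v = 0 \<or> s = 0 \<and> t = 0" | "u > 0" "v > 0" "s + t > 0" using uv st by force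
  then show ?thesis
  proof cases
    case 1
    then show ?thesis using one[of s u] one[of t v] st uv by auto
  next
    case 2
    define \<sigma> \<theta> where "\<sigma> = s + t" and "\<theta> = t / (s + t)"
    have \<sigma>: "0 < \<sigma>" "\<sigma> \<le> 1" and \<theta>: "0 \<le> \<theta>" "\<theta> \<le> 1"
      using 2 st by (auto simp: \<sigma>_def \<theta>_def)
    have eq: "s = \<sigma> * (1 - \<theta>)" "t = \<sigma> * \<theta>" using 2 by (auto simp: \<sigma>_def \<theta>_def field_simps)
    let ?w = "(1 - \<theta>) * u + \<theta> * v"
    have w: "?w powr q \<le> (1 - \<theta>) * u powr q + \<theta> * v powr q"
      using convex_onD[OF powr_convex[OF q], of \<theta> u v] 2 \<theta> by simp
    have "s * u + t * v = \<sigma> * ?w" by (simp add: eq algebra_simps)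
    also have "\<dots> powr q \<le> \<sigma> * ?w powr q" using \<sigma> \<theta> uv by (intro one) auto
    also have "\<dots> \<le> \<sigma> * ((1 - \<theta>) * u powr q + \<theta> * v powr q)" using w \<sigma> by (intro mult_left_mono) auto
    also have "\<dots> = s * u powr q + t * v powr q" by (simp add: eq algebra_simps)
    finally show ?thesis .
  qed
qed

lemma powr_le_one_iff:
  fixes s e :: real
  assumes "0 \<le> s" "0 < e"
  shows "s powr e \<le> 1 \<longleftrightarrow> s \<le> 1"
proof
  show "s \<le> 1" if "s powr e \<le> 1" using that assms gr_one_powr[of s e] by linarith
  show "s powr e \<le> 1" if "s \<le> 1" using that assms powr_mono2[of e s 1] by simp
qed

text \<open>
  For \<open>p = 1\<close> the unit ball of \<open>c\<^sub>0\<close> is enlarged to that of the bounded sequences, that is, to its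
  weak-star closure in the dual of \<open>\<ell>\<^sub>1\<close>. With this choice the coefficient ball is compact for
  coordinatewise convergence for every \<open>p \<ge> 1\<close>, which fails for \<open>c\<^sub>0\<close>.
\<close>
definition full_coeff_ball :: "real \<Rightarrow> (nat \<Rightarrow> complex) set" where
  "full_coeff_ball p = (if p = 1 then {a. \<forall>n. cmod (a n) \<le> 1} else coeff_ball p)"

definition full_pconv :: "real \<Rightarrow> (nat \<Rightarrow> 'f::complex_normed_vector) \<Rightarrow> 'f set" where
  "full_pconv p x = {y. \<exists>a \<in> full_coeff_ball p. (\<lambda>n. a n *\<^sub>C x n) sums y}"

lemma coeff_ball_subset_full: "coeff_ball p \<subseteq> full_coeff_ball p"
  by (auto simp: full_coeff_ball_def coeff_ball_def)

lemma pconv_subset_full_pconv: "pconv p x \<subseteq> full_pconv p x"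
  using coeff_ball_subset_full by (fastforce simp: pconv_def full_pconv_def)

lemma summable_lp: "x \<in> lp_seqs p \<Longrightarrow> summable (\<lambda>n. norm (x n) powr p)"
  by (simp add: lp_seqs_def)

lemma sum_powr_le_lp_norm:
  assumes "x \<in> lp_seqs p" "finite I" "0 < p"
  shows "(\<Sum>n\<in>I. norm (x n) powr p) powr (1 / p) \<le> lp_norm p x"
  unfolding lp_norm_def
  using assms by (intro powr_mono2 sum_le_suminf summable_lp sum_nonneg) auto

text \<open>
  Finite sums turn the norm condition into a family of conditions that are continuous in finitely many
  coordinates.
\<close>
lemma coeff_ball_iff_finite_sums:
  assumes p: "1 < p"
  defines "q \<equiv> p / (p - 1)"
  shows "a \<in> coeff_ball p \<longleftrightarrow> (\<forall>I. finite I \<longrightarrow> (\<Sum>n\<in>I. cmod (a n) powr q) \<le> 1)"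
proof -
  have q: "0 < q" using p by (simp add: q_def)
  have powr_le_1: "s powr (1 / q) \<le> 1 \<longleftrightarrow> s \<le> 1" if "0 \<le> s" for s :: real
    using that q by (simp add: powr_le_one_iff)
  show ?thesis
  proof
    assume "a \<in> coeff_ball p"
    then have a: "a \<in> lp_seqs q" "lp_norm q a \<le> 1"
      using p by (auto simp: coeff_ball_def q_def)
    have "(\<Sum>n\<in>I. cmod (a n) powr q) powr (1 / q) \<le> 1" if "finite I" for I
      using sum_powr_le_lp_norm[OF a(1) that q] a(2) by simp
    then show "\<forall>I. finite I \<longrightarrow> (\<Sum>n\<in>I. cmod (a n) powr q) \<le> 1"
      by (simp add: powr_le_1 sum_nonneg)
  next
    assume fin: "\<forall>I. finite I \<longrightarrow> (\<Sum>n\<in>I. cmod (a n) powr q) \<le> 1"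
    have sum: "summable (\<lambda>n. cmod (a n) powr q)"
      by (rule summableI_nonneg_bounded[of _ 1]) (use fin in auto)
    then have "(\<Sum>n. cmod (a n) powr q) \<le> 1"
      by (rule suminf_le_const) (use fin in auto)
    then have "lp_norm q a \<le> 1"
      unfolding lp_norm_def by (subst powr_le_1) (simp_all add: suminf_nonneg sum)
    with sum show "a \<in> coeff_ball p" using p by (simp add: coeff_ball_def lp_seqs_def q_def)
  qed
qed

lemma full_coeff_ball_iff:
  assumes "1 \<le> p"
  shows "a \<in> full_coeff_ball p \<longleftrightarrow>
    (if p = 1 then \<forall>n. cmod (a n) \<le> 1
     else \<forall>I. finite I \<longrightarrow> (\<Sum>n\<in>I. cmod (a n) powr (p / (p - 1))) \<le> 1)"
  using assms by (simp add: full_coeff_ball_def coeff_ball_iff_finite_sums)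

lemma full_coeff_ball_reindex:
  assumes p: "1 \<le> p" and a: "a \<in> full_coeff_ball p" and g: "inj g"
  shows "(\<lambda>n. a (g n)) \<in> full_coeff_ball p"
proof (cases "p = 1")
  case True
  then show ?thesis using a by (simp add: full_coeff_ball_iff)
next
  case False
  have "(\<Sum>n\<in>I. cmod (a (g n)) powr (p / (p - 1))) \<le> 1" if "finite I" for I
  proof -
    have "(\<Sum>n\<in>I. cmod (a (g n)) powr (p / (p - 1))) = (\<Sum>n\<in>g ` I. cmod (a n) powr (p / (p - 1)))"
      by (subst sum.reindex) (auto intro: inj_on_subset[OF g])
    also have "\<dots> \<le> 1" using a p False that by (simp add: full_coeff_ball_iff)
    finally show ?thesis .
  qed
  then show ?thesis using p False by (simp add: full_coeff_ball_iff)
qed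

lemma full_coeff_ball_le_1:
  assumes p: "1 \<le> p" and a: "a \<in> full_coeff_ball p"
  shows "cmod (a n) \<le> 1"
proof (cases "p = 1")
  case False
  then have "cmod (a n) powr (p / (p - 1)) \<le> 1"
    using a p by (auto simp: full_coeff_ball_iff dest: spec[of _ "{n}"])
  then show ?thesis using powr_le_one_iff[of "cmod (a n)" "p / (p - 1)"] p False by simp
qed (use a in \<open>simp add: full_coeff_ball_iff\<close>)

lemma full_coeff_ball_combination:
  assumes p: "1 \<le> p" and a: "a \<in> full_coeff_ball p" and b: "b \<in> full_coeff_ball p"
    and \<alpha>\<beta>: "cmod \<alpha> + cmod \<beta> \<le> 1"
  shows "(\<lambda>n. \<alpha> * a n + \<beta> * b n) \<in> full_coeff_ball p"
proof (cases "p = 1")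
  case True
  have "cmod (\<alpha> * a n + \<beta> * b n) \<le> 1" for n
  proof -
    have "cmod (\<alpha> * a n + \<beta> * b n) \<le> cmod \<alpha> * cmod (a n) + cmod \<beta> * cmod (b n)"
      by (metis norm_mult norm_triangle_ineq)
    also have "\<dots> \<le> cmod \<alpha> * 1 + cmod \<beta> * 1"
      using full_coeff_ball_le_1[OF p a] full_coeff_ball_le_1[OF p b]
      by (intro add_mono mult_left_mono) auto
    finally show ?thesis using \<alpha>\<beta> by simp
  qed
  then show ?thesis using True by (simp add: full_coeff_ball_iff)
next
  case False
  define q where "q = p / (p - 1)"
  have q: "1 \<le> q" using p False by (simp add: q_def)
  have fin: "(\<Sum>n\<in>I. cmod (a n) powr q) \<le> 1" "(\<Sum>n\<in>I. cmod (b n) powr q) \<le> 1" if "finite I" for I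
    using a b p False that by (auto simp: full_coeff_ball_iff q_def)
  have "(\<Sum>n\<in>I. cmod (\<alpha> * a n + \<beta> * b n) powr q) \<le> 1" if I: "finite I" for I
  proof -
    have "cmod (\<alpha> * a n + \<beta> * b n) powr q \<le> cmod \<alpha> * cmod (a n) powr q + cmod \<beta> * cmod (b n) powr q" for n
    proof -
      have "cmod (\<alpha> * a n + \<beta> * b n) powr q \<le> (cmod \<alpha> * cmod (a n) + cmod \<beta> * cmod (b n)) powr q"
        using q by (intro powr_mono2) (auto intro: norm_triangle_le simp: norm_mult)
      also have "\<dots> \<le> cmod \<alpha> * cmod (a n) powr q + cmod \<beta> * cmod (b n) powr q"
        using q \<alpha>\<beta> by (intro powr_weighted_le) auto
      finally show ?thesis .
    qed
    then have "(\<Sum>n\<in>I. cmod (\<alpha> * a n + \<beta> * b n) powr q)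
        \<le> cmod \<alpha> * (\<Sum>n\<in>I. cmod (a n) powr q) + cmod \<beta> * (\<Sum>n\<in>I. cmod (b n) powr q)"
      by (simp add: sum_distrib_left sum.distrib[symmetric] sum_mono)
    also have "\<dots> \<le> cmod \<alpha> * 1 + cmod \<beta> * 1" by (intro add_mono mult_left_mono fin I) auto
    finally show ?thesis using \<alpha>\<beta> by simp
  qed
  then show ?thesis using p False by (simp add: full_coeff_ball_iff q_def)
qed

text \<open>
  This is Hoelder's inequality on a finite index set, obtained from Young's inequality after normalising
  \<open>x\<close>. It contains the case \<open>p = 1\<close> with bounded coefficients.
\<close>
lemma holder_full_coeff_ball:
  assumes p: "1 \<le> p" and a: "a \<in> full_coeff_ball p" and I: "finite I"
  shows "(\<Sum>n\<in>I. cmod (a n) * norm (x n)) \<le> (\<Sum>n\<in>I. norm (x n) powr p) powr (1 / p)"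
proof (cases "p = 1")
  case True
  have "(\<Sum>n\<in>I. cmod (a n) * norm (x n)) \<le> (\<Sum>n\<in>I. norm (x n))"
    using full_coeff_ball_le_1[OF p a] by (intro sum_mono) (simp add: mult_left_le_one_le)
  then show ?thesis using True by (simp add: sum_nonneg)
next
  case False
  define q where "q = p / (p - 1)"
  define S where "S = (\<Sum>n\<in>I. norm (x n) powr p)"
  have p1: "1 < p" and q1: "1 < q" and pq: "1 / q + 1 / p = 1"
    using p False by (auto simp: q_def field_simps)
  show ?thesis
  proof (cases "S = 0")
    case True
    then have "norm (x n) powr p = 0" if "n \<in> I" for n
      using that I by (auto simp: S_def sum_nonneg_eq_0_iff)
    then show ?thesis by (simp add: sum_nonneg)
  next
    case False
    then have S: "S > 0" using sum_nonneg[of I "\<lambda>n. norm (x n) powr p"] by (simp add: S_def)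
    define r where "r = S powr (1 / p)"
    have r: "r > 0" "r powr p = S" using S p1 by (auto simp: r_def powr_powr)
    have "(\<Sum>n\<in>I. cmod (a n) * (norm (x n) / r))
        \<le> (\<Sum>n\<in>I. cmod (a n) powr q / q + (norm (x n) / r) powr p / p)"
      using p1 q1 pq r by (intro sum_mono Youngs_inequality) auto
    also have "\<dots> = (\<Sum>n\<in>I. cmod (a n) powr q) / q + (\<Sum>n\<in>I. norm (x n) powr p) / S / p"
      using r by (simp add: sum.distrib sum_divide_distrib powr_divide)
    also have "\<dots> \<le> 1 / q + 1 / p"
      using a p1 q1 S I
      by (intro add_mono divide_right_mono) (auto simp: full_coeff_ball_iff q_def S_def)
    finally have "(\<Sum>n\<in>I. cmod (a n) * norm (x n)) / r \<le> 1"
      using pq by (simp add: sum_divide_distrib)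
    then show ?thesis using r(1) by (simp add: r_def S_def)
  qed
qed

lemma coefficient_series_bounds:
  fixes x :: "nat \<Rightarrow> 'f::complex_banach"
  assumes p: "1 \<le> p" and a: "a \<in> full_coeff_ball p" and x: "x \<in> lp_seqs p"
  shows "summable (\<lambda>n. a n *\<^sub>C x n)" and "norm (\<Sum>n. a n *\<^sub>C x n) \<le> lp_norm p x"
proof -
  have bound: "(\<Sum>n<N. norm (a n *\<^sub>C x n)) \<le> lp_norm p x" for N
    using holder_full_coeff_ball[OF p a, of "{..<N}" x] sum_powr_le_lp_norm[OF x, of "{..<N}"] p
    by (simp add: norm_scaleC)
  have s: "summable (\<lambda>n. norm (a n *\<^sub>C x n))"
    by (rule summableI_nonneg_bounded[OF _ bound]) simp
  then show "summable (\<lambda>n. a n *\<^sub>C x n)" by (rule summable_norm_cancel)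
  have "norm (\<Sum>n. a n *\<^sub>C x n) \<le> (\<Sum>n. norm (a n *\<^sub>C x n))" by (rule summable_norm[OF s])
  also have "\<dots> \<le> lp_norm p x" by (rule suminf_le_const[OF s bound])
  finally show "norm (\<Sum>n. a n *\<^sub>C x n) \<le> lp_norm p x" .
qed

lemma norm_le_of_full_pconv:
  fixes x :: "nat \<Rightarrow> 'f::complex_banach"
  assumes "1 \<le> p" "x \<in> lp_seqs p" "y \<in> full_pconv p x"
  shows "norm y \<le> lp_norm p x"
  using assms coefficient_series_bounds(2)[of p _ x] by (auto simp: full_pconv_def dest!: sums_unique)

lemma lp_seqs_shift: "x \<in> lp_seqs p \<Longrightarrow> (\<lambda>n. x (n + N)) \<in> lp_seqs p"
  using summable_ignore_initial_segment[of "\<lambda>n. norm (x n) powr p" N] by (simp add: lp_seqs_def)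

lemma lp_norm_tail_tendsto_0:
  assumes x: "x \<in> lp_seqs p" and p: "1 \<le> p"
  shows "(\<lambda>N. lp_norm p (\<lambda>n. x (n + N))) \<longlonglongrightarrow> 0"
proof -
  let ?f = "\<lambda>n. norm (x n) powr p"
  have "(\<lambda>N. suminf ?f - (\<Sum>n<N. ?f n)) \<longlonglongrightarrow> suminf ?f - suminf ?f"
    by (intro tendsto_diff tendsto_const summable_LIMSEQ summable_lp x)
  then have "(\<lambda>N. \<Sum>n. ?f (n + N)) \<longlonglongrightarrow> 0"
    using suminf_minus_initial_segment[OF summable_lp[OF x]] by simp
  moreover have "\<forall>\<^sub>F N in sequentially. 0 \<le> (\<Sum>n. ?f (n + N))"
    using summable_ignore_initial_segment[OF summable_lp[OF x]]
    by (intro always_eventually allI suminf_nonneg) auto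
  ultimately show ?thesis unfolding lp_norm_def
    using p by (intro tendsto_zero_powrI[where b = "1 / p"]) auto
qed

text \<open>
  Tychonoff's theorem: in the product topology the ball is a closed subset of a product of discs.
\<close>
lemma compact_full_coeff_ball:
  assumes p: "1 \<le> p"
  shows "compact (full_coeff_ball p)"
proof -
  let ?B = "PiE UNIV (\<lambda>_. cball 0 1) :: (nat \<Rightarrow> complex) set"
  have B: "compact ?B"
    using compactin_PiE[of "\<lambda>_::nat. euclidean :: complex topology" UNIV "\<lambda>_. cball 0 1"]
    by (simp add: euclidean_product_topology)
  show ?thesis
  proof (cases "p = 1")
    case True
    then have "full_coeff_ball p = ?B" by (auto simp: full_coeff_ball_iff PiE_iff)
    with B show ?thesis by simp
  next
    case False
    define q where "q = p / (p - 1)"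
    have q: "0 < q" using p False by (simp add: q_def)
    let ?C = "\<Inter>I\<in>{I. finite I}. {a::nat \<Rightarrow> complex. (\<Sum>n\<in>I. cmod (a n) powr q) \<le> 1}"
    have "continuous_on UNIV (\<lambda>a::nat \<Rightarrow> complex. \<Sum>n\<in>I. cmod (a n) powr q)" for I
      using q by (intro continuous_on_sum continuous_on_powr' continuous_on_norm
          continuous_on_const continuous_on_product_coordinates) auto
    then have "closed ?C" by (intro closed_INT ballI closed_Collect_le continuous_on_const)
    moreover have "full_coeff_ball p = ?B \<inter> ?C"
      using full_coeff_ball_le_1[OF p] p False by (auto simp: full_coeff_ball_iff q_def PiE_iff)
    ultimately show ?thesis using B by (simp add: compact_Int_closed)
  qed
qed

text \<open>
  The hull is the image of a compact set under \<open>\<lambda>a. \<Sum>n. a n *\<^sub>C x n\<close>. This map is continuous because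
  Hoelder's inequality bounds the tails of the series by the \<open>p\<close>-norms of the tails of \<open>x\<close>, uniformly
  in the coefficients.
\<close>
lemma compact_full_pconv:
  fixes x :: "nat \<Rightarrow> 'f::complex_banach"
  assumes p: "1 \<le> p" and x: "x \<in> lp_seqs p"
  shows "compact (full_pconv p x)"
proof -
  let ?S = "\<lambda>a. \<Sum>n. a n *\<^sub>C x n"
  have "uniform_limit (full_coeff_ball p) (\<lambda>N a. \<Sum>n<N. a n *\<^sub>C x n) ?S sequentially"
  proof (rule uniform_limitI)
    fix e :: real assume "0 < e"
    then have "\<forall>\<^sub>F N in sequentially. lp_norm p (\<lambda>n. x (n + N)) < e"
      using order_tendstoD(2)[OF lp_norm_tail_tendsto_0[OF x p]] by blast
    then show "\<forall>\<^sub>F N in sequentially. \<forall>a\<in>full_coeff_ball p. dist (\<Sum>n<N. a n *\<^sub>C x n) (?S a) < e"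
    proof eventually_elim
      case (elim N)
      show ?case
      proof
        fix a assume a: "a \<in> full_coeff_ball p"
        have "?S a - (\<Sum>n<N. a n *\<^sub>C x n) = (\<Sum>n. a (n + N) *\<^sub>C x (n + N))"
          using suminf_minus_initial_segment[OF coefficient_series_bounds(1)[OF p a x], of N] by simp
        moreover have "norm (\<Sum>n. a (n + N) *\<^sub>C x (n + N)) \<le> lp_norm p (\<lambda>n. x (n + N))"
          by (rule coefficient_series_bounds(2)[OF p full_coeff_ball_reindex[OF p a] lp_seqs_shift[OF x]])
            (simp add: inj_def)
        ultimately show "dist (\<Sum>n<N. a n *\<^sub>C x n) (?S a) < e"
          using elim by (simp add: dist_norm norm_minus_commute)
      qed
    qed
  qed
  moreover have "continuous_on (full_coeff_ball p) (\<lambda>a. \<Sum>n<N. a n *\<^sub>C x n)" for N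
  proof (intro continuous_on_sum)
    fix n
    have "continuous_on (full_coeff_ball p) (\<lambda>a. a n)"
      by (rule continuous_on_subset[OF continuous_on_product_coordinates]) simp
    then show "continuous_on (full_coeff_ball p) (\<lambda>a. a n *\<^sub>C x n)"
      by (rule bounded_linear.continuous_on[OF bounded_linear_scaleC_left])
  qed
  ultimately have "continuous_on (full_coeff_ball p) ?S"
    by (intro uniform_limit_theorem[OF _ _ sequentially_bot]) (auto intro: always_eventually)
  then have "compact (?S ` full_coeff_ball p)" by (rule compact_continuous_image[OF _ compact_full_coeff_ball[OF p]])
  also have "?S ` full_coeff_ball p = full_pconv p x"
    using coefficient_series_bounds(1)[OF p _ x]
    by (auto simp: full_pconv_def image_iff sums_iff)
  finally show ?thesis .
qed

lemma absolutely_convex_full_pconv: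
  fixes x :: "nat \<Rightarrow> 'f::complex_banach"
  assumes p: "1 \<le> p"
  shows "absolutely_convex (full_pconv p x)"
  unfolding absolutely_convex_def
proof (intro conjI ballI allI impI)
  have "(\<lambda>_. 0) \<in> full_coeff_ball p" using p by (simp add: full_coeff_ball_iff)
  then show "0 \<in> full_pconv p x" unfolding full_pconv_def by (auto intro!: bexI[of _ "\<lambda>_. 0"])
next
  fix y z \<alpha> \<beta>
  assume y: "y \<in> full_pconv p x" and z: "z \<in> full_pconv p x" and \<alpha>\<beta>: "cmod \<alpha> + cmod \<beta> \<le> 1"
  obtain a where a: "a \<in> full_coeff_ball p" "(\<lambda>n. a n *\<^sub>C x n) sums y" using y by (auto simp: full_pconv_def)
  obtain b where b: "b \<in> full_coeff_ball p" "(\<lambda>n. b n *\<^sub>C x n) sums z" using z by (auto simp: full_pconv_def)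
  have "(\<lambda>n. \<alpha> *\<^sub>C (a n *\<^sub>C x n) + \<beta> *\<^sub>C (b n *\<^sub>C x n)) sums (\<alpha> *\<^sub>C y + \<beta> *\<^sub>C z)"
    by (intro sums_add bounded_linear.sums[OF bounded_linear_scaleC_right] a b)
  then have "(\<lambda>n. (\<alpha> * a n + \<beta> * b n) *\<^sub>C x n) sums (\<alpha> *\<^sub>C y + \<beta> *\<^sub>C z)"
    by (simp add: scaleC_add_left)
  then show "\<alpha> *\<^sub>C y + \<beta> *\<^sub>C z \<in> full_pconv p x"
    using full_coeff_ball_combination[OF p a(1) b(1) \<alpha>\<beta>] by (auto simp: full_pconv_def)
qed

text \<open>
  There is no slowest convergent series of positive terms: dividing the terms by the square roots of
  the tails \<open>R n\<close> keeps the series convergent, by comparison with the telescoping series of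
  \<open>2 * (sqrt (R n) - sqrt (R (Suc n)))\<close>.
\<close>
lemma summable_slowly_unbounded_factor:
  fixes u :: "nat \<Rightarrow> real"
  assumes u: "summable u" "\<And>n. 0 < u n"
  obtains r where "\<And>n. 0 < r n" and "r \<longlonglongrightarrow> 0" and "summable (\<lambda>n. u n / r n)"
proof -
  define R where "R n = (\<Sum>k. u (k + n))" for n
  have R_pos: "0 < R n" for n
    unfolding R_def by (intro suminf_pos summable_ignore_initial_segment u)
  have R_diff: "R n - R (Suc n) = u n" for n
    using suminf_split_head[OF summable_ignore_initial_segment[OF u(1), of n]] by (simp add: R_def)
  have "(\<lambda>n. suminf u - (\<Sum>k<n. u k)) \<longlonglongrightarrow> suminf u - suminf u"
    by (intro tendsto_diff tendsto_const summable_LIMSEQ u)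
  then have "R \<longlonglongrightarrow> 0" using suminf_minus_initial_segment[OF u(1)] by (simp add: R_def[abs_def])
  then have lim: "(\<lambda>n. sqrt (R n)) \<longlonglongrightarrow> 0" using tendsto_real_sqrt by fastforce
  have le: "u n / sqrt (R n) \<le> 2 * (sqrt (R n) - sqrt (R (Suc n)))" for n
  proof -
    have "R (Suc n) \<le> R n" using R_diff[of n] u(2)[of n] by simp
    then have s: "sqrt (R (Suc n)) \<le> sqrt (R n)" by simp
    have "u n = (sqrt (R n) - sqrt (R (Suc n))) * (sqrt (R n) + sqrt (R (Suc n)))"
      using R_diff[of n] R_pos[of n] R_pos[of "Suc n"] by (simp add: algebra_simps)
    also have "\<dots> \<le> (sqrt (R n) - sqrt (R (Suc n))) * (2 * sqrt (R n))"
      using s by (intro mult_left_mono) auto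
    finally show ?thesis using R_pos[of n] by (simp add: field_simps)
  qed
  have "summable (\<lambda>n. 2 * (sqrt (R n) - sqrt (R (Suc n))))"
    using telescope_sums'[OF lim] by (intro summable_mult) (auto simp: sums_iff)
  then have "summable (\<lambda>n. u n / sqrt (R n))"
    by (rule summable_comparison_test'[of _ 0]) (use le u(2) R_pos in \<open>auto simp: less_imp_le abs_of_pos\<close>)
  with lim R_pos that[of "\<lambda>n. sqrt (R n)"] show ?thesis by simp
qed

text \<open>
  Passing from the compact hull back to the original one costs arbitrarily little in norm. Only
  \<open>p = 1\<close> needs an argument: the vectors are multiplied by factors \<open>m n\<close> that tend to infinity so
  slowly that the norm grows by at most \<open>\<epsilon>\<close>, and dividing bounded coefficients by \<open>m n\<close> puts them
  into \<open>c\<^sub>0\<close>.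
\<close>
lemma full_pconv_subset_pconv:
  fixes x :: "nat \<Rightarrow> 'f::complex_banach"
  assumes p: "1 \<le> p" and x: "x \<in> lp_seqs p" and \<epsilon>: "0 < \<epsilon>"
  obtains z where "z \<in> lp_seqs p" and "full_pconv p x \<subseteq> pconv p z" and "lp_norm p z \<le> lp_norm p x + \<epsilon>"
proof (cases "p = 1")
  case False
  then have "full_pconv p x = pconv p x" by (simp add: full_pconv_def pconv_def full_coeff_ball_def)
  with x \<epsilon> that[of x] show ?thesis by simp
next
  case True
  have sx: "summable (\<lambda>n. norm (x n))" using x True by (simp add: lp_seqs_def)
  \<comment> \<open>the geometric summand makes all terms positive, also where \<open>x\<close> vanishes\<close>
  have "summable (\<lambda>n. norm (x n) + (1/2)^n)" by (intro summable_add sx summable_geometric) simp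
  moreover have "0 < norm (x n) + (1/2)^n" for n by (simp add: add_nonneg_pos)
  ultimately obtain r where r: "\<And>n. 0 < r n" "r \<longlonglongrightarrow> 0" "summable (\<lambda>n. (norm (x n) + (1/2)^n) / r n)"
    using summable_slowly_unbounded_factor by blast
  have sr: "summable (\<lambda>n. norm (x n) / r n)"
    by (rule summable_comparison_test'[OF r(3), of 0]) (use r(1) in \<open>auto simp: less_imp_le abs_of_pos divide_right_mono\<close>)
  define A where "A = (\<Sum>n. norm (x n) / r n)"
  have A: "0 \<le> A" unfolding A_def by (intro suminf_nonneg sr) (simp add: r(1) less_imp_le)
  define \<eta> where "\<eta> = \<epsilon> / (A + 1)"
  have \<eta>: "0 < \<eta>" "\<eta> * A \<le> \<epsilon>" using A \<epsilon> by (auto simp: \<eta>_def field_simps)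
  define m where "m n = 1 + \<eta> / r n" for n
  have m: "1 \<le> m n" for n using \<eta>(1) r(1)[of n] by (simp add: m_def)
  define z where "z n = complex_of_real (m n) *\<^sub>C x n" for n
  have nz: "norm (z n) = norm (x n) + \<eta> * (norm (x n) / r n)" for n
    using m[of n] unfolding z_def norm_scaleC norm_of_real by (simp add: m_def algebra_simps)
  have sz: "(\<lambda>n. norm (z n)) sums ((\<Sum>n. norm (x n)) + \<eta> * A)"
    unfolding nz A_def by (intro sums_add sums_mult summable_sums sx sr)
  then have "z \<in> lp_seqs p" using True by (simp add: lp_seqs_def sums_iff)
  moreover have "lp_norm p z \<le> lp_norm p x + \<epsilon>"
  proof -
    have "0 \<le> (\<Sum>n. norm (x n))" "0 \<le> (\<Sum>n. norm (z n))"
      using sx sums_summable[OF sz] by (auto intro!: suminf_nonneg)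
    then show ?thesis using True sz \<eta>(2) by (simp add: lp_norm_def sums_iff)
  qed
  moreover have "full_pconv p x \<subseteq> pconv p z"
  proof
    fix y assume "y \<in> full_pconv p x"
    then obtain a where a: "\<And>n. cmod (a n) \<le> 1" "(\<lambda>n. a n *\<^sub>C x n) sums y"
      using True by (auto simp: full_pconv_def full_coeff_ball_def)
    define b where "b n = a n / complex_of_real (m n)" for n
    have nb: "cmod (b n) = cmod (a n) / m n" for n
      using m[of n] by (simp add: b_def norm_divide)
    have "cmod (b n) \<le> 1" for n
      unfolding nb using a(1)[of n] m[of n] by (simp add: divide_le_eq_1)
    moreover have "b \<longlonglongrightarrow> 0"
    proof (rule Lim_null_comparison)
      show "\<forall>\<^sub>F n in sequentially. cmod (b n) \<le> r n / \<eta>"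
      proof (intro always_eventually allI)
        fix n
        have "cmod (b n) \<le> 1 / m n" unfolding nb using a(1)[of n] m[of n] by (simp add: divide_right_mono)
        also have "\<dots> \<le> 1 / (\<eta> / r n)" using \<eta>(1) r(1)[of n] by (intro divide_left_mono) (auto simp: m_def intro!: divide_pos_pos mult_pos_pos add_pos_pos)
        finally show "cmod (b n) \<le> r n / \<eta>" by simp
      qed
      show "(\<lambda>n. r n / \<eta>) \<longlonglongrightarrow> 0" using tendsto_divide_zero[OF r(2)] by simp
    qed
    ultimately have "b \<in> coeff_ball p" using True by (simp add: coeff_ball_def)
    moreover have "b n *\<^sub>C z n = a n *\<^sub>C x n" for n using m[of n] by (simp add: b_def z_def)
    ultimately show "y \<in> pconv p z" unfolding pconv_def using a(2) by (auto intro!: bexI[of _ b])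
  qed
  ultimately show ?thesis using that by blast
qed

section \<open>The measure of relative p-compactness\<close>

lemma lp_norm_nonneg: "0 \<le> lp_norm p x"
  by (simp add: lp_norm_def)

lemma m_p_le:
  assumes "x \<in> lp_seqs p" "K \<subseteq> pconv p x"
  shows "m_p p K \<le> lp_norm p x"
  unfolding m_p_def
  by (rule cInf_lower) (use assms lp_norm_nonneg in \<open>auto intro!: bdd_belowI[of _ 0]\<close>)

lemma m_p_greatest:
  assumes "rel_p_compact p K" "\<And>x. x \<in> lp_seqs p \<Longrightarrow> K \<subseteq> pconv p x \<Longrightarrow> c \<le> lp_norm p x"
  shows "c \<le> m_p p K"
  unfolding m_p_def
  by (rule cInf_greatest) (use assms in \<open>auto simp: rel_p_compact_def\<close>)

lemma m_p_approx:
  assumes "rel_p_compact p K" "m_p p K < r"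
  obtains x where "x \<in> lp_seqs p" "K \<subseteq> pconv p x" "lp_norm p x < r"
  using assms m_p_greatest[of p K r] by (meson not_less)

lemma m_p_nonneg: "rel_p_compact p K \<Longrightarrow> 0 \<le> m_p p K"
  by (rule m_p_greatest) (auto simp: lp_norm_nonneg)

lemma rel_p_compact_subset: "rel_p_compact p L \<Longrightarrow> K \<subseteq> L \<Longrightarrow> rel_p_compact p K"
  by (auto simp: rel_p_compact_def)

lemma m_p_mono: "rel_p_compact p L \<Longrightarrow> K \<subseteq> L \<Longrightarrow> m_p p K \<le> m_p p L"
  by (rule m_p_greatest) (auto intro: m_p_le)

lemma norm_le_m_p:
  fixes K :: "'f::complex_banach set"
  assumes "1 \<le> p" "rel_p_compact p K" "y \<in> K"
  shows "norm y \<le> m_p p K"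
  using assms pconv_subset_full_pconv norm_le_of_full_pconv by (intro m_p_greatest) blast+

lemma zero_in_coeff_ball: "1 \<le> p \<Longrightarrow> (\<lambda>_. 0) \<in> coeff_ball p"
  using full_coeff_ball_iff[of p "\<lambda>_. 0"] by (auto simp: full_coeff_ball_def coeff_ball_def split: if_splits)

lemma rel_p_compact_zero:
  assumes "1 \<le> p" "K \<subseteq> {0}"
  shows "rel_p_compact p K" "m_p p K = 0"
proof -
  have x: "(\<lambda>_. 0) \<in> lp_seqs p" "lp_norm p (\<lambda>_. 0 :: 'a) = 0" using assms(1) by (auto simp: lp_seqs_def lp_norm_def)
  have "0 \<in> pconv p (\<lambda>_. 0 :: 'a)"
    unfolding pconv_def using zero_in_coeff_ball[OF assms(1)] by (auto intro!: bexI[of _ "\<lambda>_. 0"])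
  then have K: "K \<subseteq> pconv p (\<lambda>_. 0)" using assms(2) by auto
  with x show rel: "rel_p_compact p K" by (auto simp: rel_p_compact_def)
  show "m_p p K = 0" using m_p_le[OF x(1) K] m_p_nonneg[OF rel] x(2) by simp
qed

lemma rel_p_compact_scaleC:
  fixes K :: "'f::complex_banach set"
  assumes p: "1 \<le> p" and K: "rel_p_compact p K"
  shows "rel_p_compact p ((*\<^sub>C) c ` K)" and "m_p p ((*\<^sub>C) c ` K) = cmod c * m_p p K"
proof -
  have scale: "(\<lambda>n. c *\<^sub>C x n) \<in> lp_seqs p \<and> lp_norm p (\<lambda>n. c *\<^sub>C x n) = cmod c * lp_norm p x \<and>
      (*\<^sub>C) c ` L \<subseteq> pconv p (\<lambda>n. c *\<^sub>C x n)"
    if x: "x \<in> lp_seqs p" and L: "L \<subseteq> pconv p x" for c and x :: "nat \<Rightarrow> 'f" and L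
  proof (intro conjI)
    have eq: "norm (c *\<^sub>C x n) powr p = cmod c powr p * norm (x n) powr p" for n
      by (simp add: norm_scaleC powr_mult)
    show "(\<lambda>n. c *\<^sub>C x n) \<in> lp_seqs p" using x by (simp add: lp_seqs_def eq summable_mult)
    have "lp_norm p (\<lambda>n. c *\<^sub>C x n) = (cmod c powr p * (\<Sum>n. norm (x n) powr p)) powr (1 / p)"
      unfolding lp_norm_def eq by (subst suminf_mult) (use x in \<open>auto simp: lp_seqs_def\<close>)
    also have "\<dots> = cmod c * lp_norm p x"
      using p by (simp add: lp_norm_def powr_mult powr_powr suminf_nonneg[OF summable_lp[OF x]])
    finally show "lp_norm p (\<lambda>n. c *\<^sub>C x n) = cmod c * lp_norm p x" .
    show "(*\<^sub>C) c ` L \<subseteq> pconv p (\<lambda>n. c *\<^sub>C x n)"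
    proof (rule image_subsetI)
      fix y assume "y \<in> L"
      then obtain a where a: "a \<in> coeff_ball p" "(\<lambda>n. a n *\<^sub>C x n) sums y"
        using L by (auto simp: pconv_def)
      have "(\<lambda>n. c *\<^sub>C (a n *\<^sub>C x n)) sums (c *\<^sub>C y)"
        by (rule bounded_linear.sums[OF bounded_linear_scaleC_right a(2)])
      then show "c *\<^sub>C y \<in> pconv p (\<lambda>n. c *\<^sub>C x n)"
        using a(1) by (auto simp: pconv_def mult.commute)
    qed
  qed
  have rel: "rel_p_compact p ((*\<^sub>C) c ` K)" if "rel_p_compact p K" for c and K :: "'f set"
    using that scale unfolding rel_p_compact_def by blast
  have le: "m_p p ((*\<^sub>C) c ` K) \<le> cmod c * m_p p K" if K: "rel_p_compact p K" and c: "c \<noteq> 0" for c and K :: "'f set"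
  proof -
    have "m_p p ((*\<^sub>C) c ` K) / cmod c \<le> m_p p K"
    proof (rule m_p_greatest[OF K])
      fix x assume "x \<in> lp_seqs p" "K \<subseteq> pconv p x"
      from scale[OF this, of c] have "m_p p ((*\<^sub>C) c ` K) \<le> cmod c * lp_norm p x" using m_p_le by metis
      then show "m_p p ((*\<^sub>C) c ` K) / cmod c \<le> lp_norm p x" using c by (simp add: field_simps)
    qed
    then show ?thesis using c by (simp add: field_simps)
  qed
  show rK: "rel_p_compact p ((*\<^sub>C) c ` K)" by (rule rel[OF K])
  show "m_p p ((*\<^sub>C) c ` K) = cmod c * m_p p K"
  proof (cases "c = 0")
    case True
    then have "(*\<^sub>C) c ` K \<subseteq> {0}" by auto
    from rel_p_compact_zero(2)[OF p this] show ?thesis using True by simp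
  next
    case False
    have "(*\<^sub>C) (1 / c) ` (*\<^sub>C) c ` K = K" using False by (simp add: image_image)
    then have "m_p p K \<le> cmod (1 / c) * m_p p ((*\<^sub>C) c ` K)" using le[OF rK, of "1 / c"] False by simp
    then have "cmod c * m_p p K \<le> m_p p ((*\<^sub>C) c ` K)" using False by (simp add: norm_divide field_simps)
    with le[OF K False] show ?thesis by simp
  qed
qed

definition interleave :: "(nat \<Rightarrow> 'a) \<Rightarrow> (nat \<Rightarrow> 'a) \<Rightarrow> nat \<Rightarrow> 'a" where
  "interleave x y n = (if even n then x (n div 2) else y (n div 2))"

lemma filterlim_div2: "filterlim (\<lambda>N. N div 2) at_top (sequentially :: nat filter)"
  unfolding filterlim_at_top eventually_sequentially
  by (metis div_le_mono nonzero_mult_div_cancel_left zero_neq_numeral)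

lemma interleave_sums:
  fixes f g :: "nat \<Rightarrow> 'a::real_normed_vector"
  assumes f: "f sums s" and g: "g sums t"
  shows "interleave f g sums (s + t)"
proof -
  have eq: "(\<Sum>n<N. interleave f g n) = (\<Sum>n<(N + 1) div 2. f n) + (\<Sum>n<N div 2. g n)" for N
    by (induction N) (auto simp: interleave_def algebra_simps elim!: evenE oddE)
  have "filterlim (\<lambda>N. (N + 1) div 2) at_top (sequentially :: nat filter)"
    by (rule filterlim_at_top_mono[OF filterlim_div2]) (auto intro: div_le_mono)
  with filterlim_div2 show ?thesis unfolding sums_def eq
    using f g by (intro tendsto_add) (auto simp: sums_def intro: filterlim_compose)
qed

lemma interleave_null:
  assumes "a \<longlonglongrightarrow> 0" "b \<longlonglongrightarrow> 0"
  shows "interleave a b \<longlonglongrightarrow> (0::complex)"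
proof -
  have "(\<lambda>n. cmod (a (n div 2)) + cmod (b (n div 2))) \<longlonglongrightarrow> 0 + 0"
    using assms filterlim_div2 by (intro tendsto_add tendsto_norm_zero) (auto intro: filterlim_compose)
  then show ?thesis
    by (intro Lim_null_comparison[of "interleave a b"]) (auto simp: interleave_def)
qed

text \<open>
  Here \<open>c = 1 / p*\<close>, so the weights \<open>s powr c\<close> and \<open>t powr c\<close> turn the \<open>p*\<close>-th powers of the norms
  of \<open>a\<close> and \<open>b\<close> into a convex combination. For \<open>p = 1\<close> both weights are \<open>1\<close>.
\<close>
lemma coeff_ball_interleave:
  assumes p: "1 \<le> p" and a: "a \<in> coeff_ball p" and b: "b \<in> coeff_ball p"
    and st: "0 < s" "0 < t" "s + t = 1"
  defines "c \<equiv> (p - 1) / p"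
  shows "interleave (\<lambda>n. complex_of_real (s powr c) * a n) (\<lambda>n. complex_of_real (t powr c) * b n) \<in> coeff_ball p"
    (is "?i \<in> _")
proof (cases "p = 1")
  case True
  then have "c = 0" by (simp add: c_def)
  then have "?i = interleave a b" using st by simp
  moreover have "interleave a b \<longlonglongrightarrow> 0" using a b True by (intro interleave_null) (auto simp: coeff_ball_def)
  moreover have "cmod (interleave a b n) \<le> 1" for n using a b True by (simp add: coeff_ball_def interleave_def)
  ultimately show ?thesis using True by (simp add: coeff_ball_def)
next
  case False
  define q where "q = p / (p - 1)"
  have p1: "1 < p" and q: "0 < q" and cq: "c * q = 1" using p False by (auto simp: q_def c_def)
  have le1: "lp_norm q d \<le> 1 \<longleftrightarrow> (\<Sum>n. cmod (d n) powr q) \<le> 1" if "d \<in> lp_seqs q" for d :: "nat \<Rightarrow> complex"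
    unfolding lp_norm_def using q by (intro powr_le_one_iff suminf_nonneg summable_lp that) auto
  have ab: "a \<in> lp_seqs q" "b \<in> lp_seqs q" "(\<Sum>n. cmod (a n) powr q) \<le> 1" "(\<Sum>n. cmod (b n) powr q) \<le> 1"
    using a b False le1 by (auto simp: coeff_ball_def q_def)
  have eq: "cmod (?i n) powr q = interleave (\<lambda>n. s * cmod (a n) powr q) (\<lambda>n. t * cmod (b n) powr q) n" for n
    using st by (simp add: interleave_def norm_mult powr_mult powr_powr cq)
  have "interleave (\<lambda>n. s * cmod (a n) powr q) (\<lambda>n. t * cmod (b n) powr q) sums
      (s * (\<Sum>n. cmod (a n) powr q) + t * (\<Sum>n. cmod (b n) powr q))"
    by (intro interleave_sums sums_mult summable_sums summable_lp ab)
  then have i: "(\<lambda>n. cmod (?i n) powr q) sums (s * (\<Sum>n. cmod (a n) powr q) + t * (\<Sum>n. cmod (b n) powr q))"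
    unfolding eq .
  have "s * (\<Sum>n. cmod (a n) powr q) + t * (\<Sum>n. cmod (b n) powr q) \<le> s * 1 + t * 1"
    using ab st by (intro add_mono mult_left_mono) auto
  with i le1[of ?i] st have "?i \<in> lp_seqs q" "lp_norm q ?i \<le> 1" by (auto simp: lp_seqs_def sums_iff)
  then show ?thesis using False by (simp add: coeff_ball_def q_def)
qed

text \<open>
  The two sequences are interleaved. Scaling the coefficients by \<open>s powr c\<close> and \<open>t powr c\<close> with
  \<open>s + t = 1\<close> forces the vectors to be scaled by \<open>s powr - c\<close> and \<open>t powr - c\<close>; the choice
  \<open>s = \<alpha> / (\<alpha> + \<beta>)\<close> makes the resulting \<open>p\<close>-norm at most \<open>\<alpha> + \<beta>\<close>, which is what the triangle
  inequality for \<open>m_p\<close> requires.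
\<close>
lemma pconv_add:
  fixes x y :: "nat \<Rightarrow> 'f::complex_banach"
  assumes p: "1 \<le> p" and x: "x \<in> lp_seqs p" "lp_norm p x \<le> \<alpha>" and y: "y \<in> lp_seqs p" "lp_norm p y \<le> \<beta>"
    and pos: "0 < \<alpha>" "0 < \<beta>"
  obtains z where "z \<in> lp_seqs p" and "lp_norm p z \<le> \<alpha> + \<beta>"
    and "\<And>k l. k \<in> pconv p x \<Longrightarrow> l \<in> pconv p y \<Longrightarrow> k + l \<in> pconv p z"
proof -
  define s where "s = \<alpha> / (\<alpha> + \<beta>)"
  define t where "t = \<beta> / (\<alpha> + \<beta>)"
  define c where "c = (p - 1) / p"
  have st: "0 < s" "0 < t" "s + t = 1" using pos by (auto simp: s_def t_def add_divide_distrib[symmetric])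
  define z where "z = interleave (\<lambda>n. complex_of_real (s powr - c) *\<^sub>C x n) (\<lambda>n. complex_of_real (t powr - c) *\<^sub>C y n)"
  have pw: "(\<Sum>n. norm (x n) powr p) \<le> \<alpha> powr p" if "x \<in> lp_seqs p" "lp_norm p x \<le> \<alpha>" "0 < \<alpha>"
    for x :: "nat \<Rightarrow> 'f" and \<alpha>
  proof -
    have "0 \<le> (\<Sum>n. norm (x n) powr p)" by (intro suminf_nonneg summable_lp that) auto
    then have "(\<Sum>n. norm (x n) powr p) = lp_norm p x powr p" using p by (simp add: lp_norm_def powr_powr)
    also have "\<dots> \<le> \<alpha> powr p" using that p by (intro powr_mono2 lp_norm_nonneg) auto
    finally show ?thesis .
  qed
  have weight: "(w powr - c) powr p * a powr p = (\<alpha> + \<beta>) powr p * w"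
    if "w = a / (\<alpha> + \<beta>)" "0 < a" for w a
  proof -
    have w: "0 < w" "a = w * (\<alpha> + \<beta>)" using that pos by auto
    have cp: "- c * p = 1 - p" using p by (simp add: c_def)
    have "(w powr - c) powr p * a powr p = w powr (1 - p) * (w powr p * (\<alpha> + \<beta>) powr p)"
      unfolding powr_powr cp using w pos by (simp add: powr_mult)
    also have "\<dots> = w powr (1 - p + p) * (\<alpha> + \<beta>) powr p" by (simp only: powr_add mult.assoc)
    finally show ?thesis using w by simp
  qed
  have eq: "norm (z n) powr p = interleave (\<lambda>n. (s powr - c) powr p * norm (x n) powr p)
      (\<lambda>n. (t powr - c) powr p * norm (y n) powr p) n" for n
    by (simp add: z_def interleave_def norm_scaleC powr_mult)
  have zs: "(\<lambda>n. norm (z n) powr p) sums ((s powr - c) powr p * (\<Sum>n. norm (x n) powr p)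
      + (t powr - c) powr p * (\<Sum>n. norm (y n) powr p))" (is "_ sums ?Z")
    unfolding eq by (intro interleave_sums sums_mult summable_sums summable_lp x y)
  have "?Z \<le> (s powr - c) powr p * \<alpha> powr p + (t powr - c) powr p * \<beta> powr p"
    by (intro add_mono mult_left_mono pw x y pos) auto
  also have "\<dots> = (\<alpha> + \<beta>) powr p * s + (\<alpha> + \<beta>) powr p * t"
    using weight[OF s_def] weight[OF t_def] pos by simp
  also have "\<dots> = (\<alpha> + \<beta>) powr p * (s + t)" by (simp only: distrib_left)
  finally have Z: "?Z \<le> (\<alpha> + \<beta>) powr p" using st by simp
  have z: "z \<in> lp_seqs p" using zs by (simp add: lp_seqs_def sums_iff)
  have "lp_norm p z = ?Z powr (1 / p)" using zs by (simp add: lp_norm_def sums_iff)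
  also have "\<dots> \<le> ((\<alpha> + \<beta>) powr p) powr (1 / p)"
    using p suminf_nonneg[OF sums_summable[OF zs]] sums_unique[OF zs] by (intro powr_mono2 Z) auto
  also have "\<dots> = \<alpha> + \<beta>" using pos p by (simp add: powr_powr)
  finally have nz: "lp_norm p z \<le> \<alpha> + \<beta>" .
  have "k + l \<in> pconv p z" if kl: "k \<in> pconv p x" "l \<in> pconv p y" for k l
  proof -
    obtain a b where a: "a \<in> coeff_ball p" "(\<lambda>n. a n *\<^sub>C x n) sums k"
      and b: "b \<in> coeff_ball p" "(\<lambda>n. b n *\<^sub>C y n) sums l"
      using kl by (auto simp: pconv_def)
    let ?i = "interleave (\<lambda>n. complex_of_real (s powr c) * a n) (\<lambda>n. complex_of_real (t powr c) * b n)"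
    have cancel: "complex_of_real (w powr c) * d * complex_of_real (w powr - c) = d" if "0 < w" for w d
      using that by (simp add: powr_minus)
    have "?i n *\<^sub>C z n = interleave (\<lambda>n. a n *\<^sub>C x n) (\<lambda>n. b n *\<^sub>C y n) n" for n
      unfolding z_def interleave_def using cancel st by simp
    then have "(\<lambda>n. ?i n *\<^sub>C z n) sums (k + l)" using interleave_sums[OF a(2) b(2)] by simp
    moreover have "?i \<in> coeff_ball p" unfolding c_def by (rule coeff_ball_interleave[OF p a(1) b(1) st])
    ultimately show ?thesis unfolding pconv_def by blast
  qed
  with z nz that show ?thesis by blast
qed

lemma rel_p_compact_add:
  fixes K L :: "'f::complex_banach set"
  assumes p: "1 \<le> p" and K: "rel_p_compact p K" and L: "rel_p_compact p L"
    and M: "\<And>m. m \<in> M \<Longrightarrow> \<exists>k\<in>K. \<exists>l\<in>L. m = k + l"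
  shows "rel_p_compact p M" and "m_p p M \<le> m_p p K + m_p p L"
proof -
  have ex: "\<exists>z\<in>lp_seqs p. M \<subseteq> pconv p z \<and> lp_norm p z \<le> m_p p K + m_p p L + \<epsilon>" if \<epsilon>: "0 < \<epsilon>" for \<epsilon>
  proof -
    obtain x where x: "x \<in> lp_seqs p" "K \<subseteq> pconv p x" "lp_norm p x < m_p p K + \<epsilon> / 2"
      using m_p_approx[OF K, of "m_p p K + \<epsilon> / 2"] \<epsilon> by auto
    obtain y where y: "y \<in> lp_seqs p" "L \<subseteq> pconv p y" "lp_norm p y < m_p p L + \<epsilon> / 2"
      using m_p_approx[OF L, of "m_p p L + \<epsilon> / 2"] \<epsilon> by auto
    obtain z where z: "z \<in> lp_seqs p" "lp_norm p z \<le> (m_p p K + \<epsilon> / 2) + (m_p p L + \<epsilon> / 2)"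
      "\<And>k l. k \<in> pconv p x \<Longrightarrow> l \<in> pconv p y \<Longrightarrow> k + l \<in> pconv p z"
      using pconv_add[OF p x(1) less_imp_le[OF x(3)] y(1) less_imp_le[OF y(3)]] \<epsilon>
        m_p_nonneg[OF K] m_p_nonneg[OF L] by (metis add_nonneg_pos half_gt_zero)
    have "M \<subseteq> pconv p z" using M z(3) x(2) y(2) by (metis subset_iff)
    then show ?thesis using z(1,2) by (intro bexI[of _ z]) auto
  qed
  show "rel_p_compact p M" using ex[of 1] by (auto simp: rel_p_compact_def)
  show "m_p p M \<le> m_p p K + m_p p L"
  proof (rule field_le_epsilon)
    fix \<epsilon> :: real assume "0 < \<epsilon>"
    from ex[OF this] show "m_p p M \<le> m_p p K + m_p p L + \<epsilon>" using m_p_le order_trans by metis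
  qed
qed

section \<open>Normed spaces of functions and operators\<close>

lemma sup_norm_upper:
  assumes "bounded (f ` S)" "x \<in> S"
  shows "norm (f x) \<le> sup_norm S f"
proof -
  obtain B where "\<And>x. x \<in> S \<Longrightarrow> norm (f x) \<le> B" using assms(1) by (auto simp: bounded_iff)
  then have "bdd_above (insert 0 ((\<lambda>x. norm (f x)) ` S))" by (intro bdd_aboveI[of _ "max 0 B"]) (auto simp: le_max_iff_disj)
  then show ?thesis unfolding sup_norm_def using assms(2) by (intro cSup_upper) auto
qed

lemma sup_norm_nonneg:
  assumes "bounded (f ` S)"
  shows "0 \<le> sup_norm S f"
proof -
  obtain B where "\<And>x. x \<in> S \<Longrightarrow> norm (f x) \<le> B" using assms(1) by (auto simp: bounded_iff)
  then have "bdd_above (insert 0 ((\<lambda>x. norm (f x)) ` S))" by (intro bdd_aboveI[of _ "max 0 B"]) (auto simp: le_max_iff_disj)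
  then show ?thesis unfolding sup_norm_def by (intro cSup_upper) auto
qed

lemma sup_norm_least: "0 \<le> c \<Longrightarrow> (\<And>x. x \<in> S \<Longrightarrow> norm (f x) \<le> c) \<Longrightarrow> sup_norm S f \<le> c"
  unfolding sup_norm_def by (rule cSup_least) auto

text \<open>
  Both spaces of bounded functions below are of this form: the supremum is taken over \<open>U\<close> for bounded
  holomorphic maps and over the unit ball for bounded operators.
\<close>
lemma cnormed_space_sup_norm:
  fixes X :: "('a \<Rightarrow> 'b::complex_normed_vector) set"
  assumes X: "complex_vector.subspace X" and bdd: "\<And>f. f \<in> X \<Longrightarrow> bounded (f ` S)"
    and zero: "\<And>f. f \<in> X \<Longrightarrow> (\<And>x. x \<in> S \<Longrightarrow> f x = 0) \<Longrightarrow> f = 0"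
  shows "cnormed_space X (sup_norm S)"
proof -
  have scale_le: "sup_norm S (c *\<^sub>C f) \<le> cmod c * sup_norm S f" if f: "f \<in> X" for c f
    using sup_norm_upper[OF bdd[OF f]] sup_norm_nonneg[OF bdd[OF f]]
    by (intro sup_norm_least) (auto simp: scaleC_fun_def norm_scaleC intro: mult_left_mono)
  have scale: "sup_norm S (c *\<^sub>C f) = cmod c * sup_norm S f" if f: "f \<in> X" for c f
  proof (cases "c = 0")
    case True
    have "sup_norm S (c *\<^sub>C f) \<ge> 0"
      using f X by (intro sup_norm_nonneg bdd) (auto simp: complex_vector.subspace_def)
    then show ?thesis using scale_le[OF f, of c] True by simp
  next
    case False
    have "c *\<^sub>C f \<in> X" using f X by (auto simp: complex_vector.subspace_def)
    then have "sup_norm S ((1 / c) *\<^sub>C (c *\<^sub>C f)) \<le> cmod (1 / c) * sup_norm S (c *\<^sub>C f)" by (rule scale_le)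
    then have "cmod c * sup_norm S f \<le> sup_norm S (c *\<^sub>C f)"
      using False by (simp add: norm_divide field_simps)
    with scale_le[OF f, of c] show ?thesis by simp
  qed
  have add: "sup_norm S (f + g) \<le> sup_norm S f + sup_norm S g" if "f \<in> X" "g \<in> X" for f g
  proof (rule sup_norm_least)
    show "0 \<le> sup_norm S f + sup_norm S g" using that by (intro add_nonneg_nonneg sup_norm_nonneg bdd)
    show "norm ((f + g) x) \<le> sup_norm S f + sup_norm S g" if "x \<in> S" for x
      unfolding plus_fun_apply
      using sup_norm_upper[OF bdd[OF \<open>f \<in> X\<close>] that] sup_norm_upper[OF bdd[OF \<open>g \<in> X\<close>] that]
      by (intro norm_triangle_le) simp
  qed
  have "f = 0" if f: "f \<in> X" "sup_norm S f = 0" for f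
    using sup_norm_upper[OF bdd[OF f(1)]] f(2) by (intro zero f) simp
  moreover have "sup_norm S (0 :: 'a \<Rightarrow> 'b) = 0"
  proof (rule antisym)
    show "sup_norm S (0 :: 'a \<Rightarrow> 'b) \<le> 0" by (rule sup_norm_least) simp_all
    show "0 \<le> sup_norm S (0 :: 'a \<Rightarrow> 'b)"
      using X by (intro sup_norm_nonneg bdd) (simp add: complex_vector.subspace_def)
  qed
  ultimately show ?thesis
    unfolding cnormed_space_def using X scale add bdd sup_norm_nonneg by blast
qed

lemma cnormed_spaceD:
  assumes "cnormed_space X N"
  shows "complex_vector.subspace X" "0 \<in> X"
    and "x \<in> X \<Longrightarrow> y \<in> X \<Longrightarrow> x + y \<in> X" "x \<in> X \<Longrightarrow> c *\<^sub>C x \<in> X"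
    and "x \<in> X \<Longrightarrow> 0 \<le> N x" "x \<in> X \<Longrightarrow> N x = 0 \<longleftrightarrow> x = 0"
    and "x \<in> X \<Longrightarrow> y \<in> X \<Longrightarrow> N (x + y) \<le> N x + N y"
    and "x \<in> X \<Longrightarrow> N (c *\<^sub>C x) = cmod c * N x"
  using assms by (simp_all add: cnormed_space_def complex_vector.subspace_def)

lemma cnormed_space_norm_zero: "cnormed_space X N \<Longrightarrow> N 0 = 0"
  using cnormed_spaceD(2,6) by metis

lemma cnormed_space_diff:
  assumes X: "cnormed_space X N" and xy: "x \<in> X" "y \<in> X"
  shows "x - y \<in> X" and "N (x - y) \<le> N x + N y"
proof -
  have y': "(- 1) *\<^sub>C y \<in> X" by (rule cnormed_spaceD(4)[OF X xy(2)])
  have eq: "x - y = x + (- 1) *\<^sub>C y" by simp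
  show "x - y \<in> X" unfolding eq by (rule cnormed_spaceD(3)[OF X xy(1) y'])
  have "N (x - y) \<le> N x + N ((- 1) *\<^sub>C y)" unfolding eq by (rule cnormed_spaceD(7)[OF X xy(1) y'])
  also have "N ((- 1) *\<^sub>C y) = cmod (- 1) * N y" by (rule cnormed_spaceD(8)[OF X xy(2)])
  finally show "N (x - y) \<le> N x + N y" by simp
qed

lemma cnormed_space_subspace:
  assumes "cnormed_space X N" "complex_vector.subspace Y" "Y \<subseteq> X"
  shows "cnormed_space Y N"
  using assms unfolding cnormed_space_def by (metis subsetD)

lemma scale_into_unit_ball:
  assumes X: "cnormed_space X N" and x: "x \<in> X"
  obtains c where "c > 0" and "complex_of_real c *\<^sub>C x \<in> unit_ball X N" and "c * (N x + 1) = 1"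
proof -
  define c where "c = 1 / (N x + 1)"
  have N: "0 \<le> N x" using X x by (simp add: cnormed_space_def)
  then have c: "c > 0" "c * (N x + 1) = 1" "c * N x \<le> 1" by (auto simp: c_def field_simps)
  have "complex_of_real c *\<^sub>C x \<in> X" using X x by (simp add: cnormed_space_def complex_vector.subspace_def)
  moreover have "N (complex_of_real c *\<^sub>C x) = c * N x"
    using cnormed_spaceD(8)[OF X x, of "complex_of_real c"] c(1) by simp
  ultimately show ?thesis using c by (intro that[of c]) (auto simp: unit_ball_def)
qed

lemma clinear_on_scaleC: "clinear_on X T \<Longrightarrow> x \<in> X \<Longrightarrow> T (c *\<^sub>C x) = c *\<^sub>C T x"
  by (simp add: clinear_on_def)

lemma clinear_on_add: "clinear_on X T \<Longrightarrow> x \<in> X \<Longrightarrow> y \<in> X \<Longrightarrow> T (x + y) = T x + T y"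
  by (simp add: clinear_on_def)

lemma clinear_on_diff:
  assumes T: "clinear_on X T" and X: "complex_vector.subspace X" and xy: "x \<in> X" "y \<in> X"
  shows "T (x - y) = T x - T y"
proof -
  have y': "(- 1) *\<^sub>C y \<in> X" by (rule complex_vector.subspace_scale[OF X xy(2)])
  have "T (x + (- 1) *\<^sub>C y) = T x + (- 1) *\<^sub>C T y"
    by (simp only: clinear_on_add[OF T xy(1) y'] clinear_on_scaleC[OF T xy(2)])
  then show ?thesis by simp
qed

lemma zero_of_zero_on_unit_ball:
  assumes X: "cnormed_space X N" and T: "clinear_on X T" "vanishes_off X T"
    and zero: "\<And>x. x \<in> unit_ball X N \<Longrightarrow> T x = 0"
  shows "T = 0"
proof
  fix x
  show "T x = 0 x"
  proof (cases "x \<in> X")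
    case True
    obtain c :: real where c: "c > 0" "complex_of_real c *\<^sub>C x \<in> unit_ball X N"
      using scale_into_unit_ball[OF X True] by blast
    have "complex_of_real c *\<^sub>C T x = 0" using zero[OF c(2)] clinear_on_scaleC[OF T(1) True] by simp
    then show ?thesis using c(1) by simp
  qed (use T(2) in \<open>simp add: vanishes_off_def\<close>)
qed

lemma bounded_operators_iff_bounded:
  assumes X: "cnormed_space X N" and T: "clinear_on X T" "vanishes_off X T"
  shows "T \<in> bounded_operators X N \<longleftrightarrow> bounded (T ` unit_ball X N)"
proof
  assume "T \<in> bounded_operators X N"
  then obtain K where K: "\<And>x. x \<in> X \<Longrightarrow> norm (T x) \<le> K * N x" by (auto simp: bounded_operators_def)
  have "norm (T x) \<le> \<bar>K\<bar>" if "x \<in> unit_ball X N" for x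
  proof -
    have x: "x \<in> X" "N x \<le> 1" "0 \<le> N x" using that X by (auto simp: unit_ball_def cnormed_space_def)
    have "norm (T x) \<le> \<bar>K\<bar> * N x" using K[OF x(1)] x(3) by (meson abs_ge_self mult_right_mono order_trans)
    also have "\<dots> \<le> \<bar>K\<bar> * 1" using x by (intro mult_left_mono) auto
    finally show ?thesis by simp
  qed
  then show "bounded (T ` unit_ball X N)" by (auto simp: bounded_iff)
next
  assume "bounded (T ` unit_ball X N)"
  then obtain B where B: "\<And>x. x \<in> unit_ball X N \<Longrightarrow> norm (T x) \<le> B" by (auto simp: bounded_iff)
  have "norm (T x) \<le> B * N x" if x: "x \<in> X" for x
  proof (cases "N x = 0")
    case True
    have "x = 0" using X x True by (simp add: cnormed_space_def)
    moreover have "T (0 *\<^sub>C x) = 0 *\<^sub>C T x" by (rule clinear_on_scaleC[OF T(1) x])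
    ultimately show ?thesis using True by simp
  next
    case False
    then have N: "N x > 0" using cnormed_spaceD(5)[OF X x] by simp
    let ?c = "complex_of_real (1 / N x)"
    have "N (?c *\<^sub>C x) = cmod ?c * N x" by (rule cnormed_spaceD(8)[OF X x])
    also have "\<dots> = 1" using N unfolding norm_of_real by simp
    finally have "?c *\<^sub>C x \<in> unit_ball X N"
      using X x by (simp add: unit_ball_def cnormed_space_def complex_vector.subspace_def)
    then have "norm (?c *\<^sub>C T x) \<le> B" using B clinear_on_scaleC[OF T(1) x] by metis
    then have "(1 / N x) * norm (T x) \<le> B" unfolding norm_scaleC norm_of_real using N by simp
    then show ?thesis using N by (simp add: field_simps)
  qed
  then show "T \<in> bounded_operators X N" using T by (auto simp: bounded_operators_def)
qed

lemma clinear_on_plus: "clinear_on X S \<Longrightarrow> clinear_on X T \<Longrightarrow> clinear_on X (S + T)"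
  by (simp add: clinear_on_def scaleC_add_right algebra_simps)

lemma clinear_on_scale: "clinear_on X T \<Longrightarrow> clinear_on X (c *\<^sub>C T)"
  by (simp add: clinear_on_def scaleC_fun_def scaleC_add_right mult.commute)

lemma clinear_on_zero: "clinear_on X 0"
  by (simp add: clinear_on_def)

lemma vanishes_off_zero: "vanishes_off X 0"
  by (simp add: vanishes_off_def)

lemma vanishes_off_plus: "vanishes_off X f \<Longrightarrow> vanishes_off X g \<Longrightarrow> vanishes_off X (f + g)"
  for f g :: "'a \<Rightarrow> 'b::monoid_add"
  by (simp add: vanishes_off_def)

lemma vanishes_off_scale: "vanishes_off X f \<Longrightarrow> vanishes_off X (c *\<^sub>C f)"
  for f :: "'a \<Rightarrow> 'b::complex_vector"
  by (simp add: vanishes_off_def scaleC_fun_def)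

lemma bounded_image_plus:
  fixes f g :: "'a \<Rightarrow> 'b::real_normed_vector"
  assumes "bounded (f ` S)" "bounded (g ` S)"
  shows "bounded ((f + g) ` S)"
  using bounded_plus_comp[OF assms] by (simp add: image_def)

lemma bounded_image_scale:
  fixes f :: "'a \<Rightarrow> 'b::complex_normed_vector"
  assumes "bounded (f ` S)"
  shows "bounded ((c *\<^sub>C f) ` S)"
proof -
  have "bounded ((*\<^sub>C) c ` (f ` S))" by (rule bounded_linear_image[OF assms bounded_linear_scaleC_right])
  then show ?thesis by (simp add: image_image scaleC_fun_def)
qed

lemma subspace_bounded_operators:
  assumes X: "cnormed_space X N"
  shows "complex_vector.subspace (bounded_operators X N :: ('v::complex_vector \<Rightarrow> 'w::complex_normed_vector) set)"
proof -
  have iff: "T \<in> bounded_operators X N \<longleftrightarrow> clinear_on X T \<and> vanishes_off X T \<and> bounded (T ` unit_ball X N)"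
    for T :: "'v \<Rightarrow> 'w"
    using bounded_operators_iff_bounded[OF X] by (auto simp: bounded_operators_def)
  have "bounded ((0 :: 'v \<Rightarrow> 'w) ` unit_ball X N)" by (auto simp: bounded_iff)
  then show ?thesis
    unfolding complex_vector.subspace_def using clinear_on_zero[of X] vanishes_off_zero[of X]
    by (auto simp only: iff intro!: clinear_on_plus clinear_on_scale vanishes_off_plus vanishes_off_scale
        bounded_image_plus bounded_image_scale)
qed

lemma cnormed_space_operator_norm:
  assumes X: "cnormed_space X N"
  shows "cnormed_space (bounded_operators X N :: ('v::complex_vector \<Rightarrow> 'w::complex_normed_vector) set) (operator_norm X N)"
proof -
  have "cnormed_space (bounded_operators X N :: ('v \<Rightarrow> 'w) set) (sup_norm (unit_ball X N))"
  proof (rule cnormed_space_sup_norm[OF subspace_bounded_operators[OF X]])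
    fix T :: "'v \<Rightarrow> 'w" assume T: "T \<in> bounded_operators X N"
    then have T': "clinear_on X T" "vanishes_off X T" by (auto simp: bounded_operators_def)
    show "bounded (T ` unit_ball X N)" using bounded_operators_iff_bounded[OF X T'] T by simp
    show "T = 0" if "\<And>x. x \<in> unit_ball X N \<Longrightarrow> T x = 0"
      by (rule zero_of_zero_on_unit_ball[OF X T' that])
  qed
  moreover have "operator_norm X N = (sup_norm (unit_ball X N) :: ('v \<Rightarrow> 'w) \<Rightarrow> real)"
    by (simp add: operator_norm_def fun_eq_iff)
  ultimately show ?thesis by simp
qed

lemma operator_norm_least:
  fixes T :: "'v::complex_vector \<Rightarrow> 'w::complex_normed_vector"
  assumes X: "cnormed_space X N" and c: "0 \<le> c" "\<And>x. x \<in> X \<Longrightarrow> norm (T x) \<le> c * N x"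
  shows "operator_norm X N T \<le> c"
  unfolding operator_norm_def
proof (rule sup_norm_least[OF c(1)])
  fix x assume "x \<in> unit_ball X N"
  then have x: "x \<in> X" "N x \<le> 1" by (auto simp: unit_ball_def)
  show "norm (T x) \<le> c" using c(2)[OF x(1)] mult_left_mono[OF x(2) c(1)] by simp
qed

lemma norm_le_operator_norm:
  fixes T :: "'v::complex_vector \<Rightarrow> 'w::complex_normed_vector"
  assumes X: "cnormed_space X N" and T: "T \<in> bounded_operators X N" and x: "x \<in> X"
  shows "norm (T x) \<le> operator_norm X N T * N x"
proof -
  have T': "clinear_on X T" "vanishes_off X T" using T by (auto simp: bounded_operators_def)
  have bdd: "bounded (T ` unit_ball X N)" using bounded_operators_iff_bounded[OF X T'] T by simp
  have N: "0 \<le> N x" using X x by (simp add: cnormed_space_def)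
  show ?thesis
  proof (cases "N x = 0")
    case True
    then show ?thesis using T x by (auto simp: bounded_operators_def)
  next
    case False
    then have pos: "N x > 0" using N by simp
    let ?c = "complex_of_real (1 / N x)"
    have "N (?c *\<^sub>C x) = cmod ?c * N x" by (rule cnormed_spaceD(8)[OF X x])
    also have "\<dots> = 1" using pos unfolding norm_of_real by simp
    finally have "?c *\<^sub>C x \<in> unit_ball X N"
      using X x by (simp add: unit_ball_def cnormed_space_def complex_vector.subspace_def)
    then have "norm (?c *\<^sub>C T x) \<le> operator_norm X N T"
      using sup_norm_upper[OF bdd] clinear_on_scaleC[OF T'(1) x] unfolding operator_norm_def by metis
    then have "(1 / N x) * norm (T x) \<le> operator_norm X N T" unfolding norm_scaleC norm_of_real using pos by simp
    then show ?thesis using pos by (simp add: field_simps)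
  qed
qed

section \<open>Bounded holomorphic functions, their dual and the predual\<close>

lemma holomorphic_map_zero: "holomorphic_map 0 U"
  unfolding holomorphic_map_def zero_fun_def
  by (intro ballI exI[of _ "\<lambda>_. 0"]) (auto simp: clinear_on_def)

lemma holomorphic_map_plus:
  assumes "holomorphic_map f U" "holomorphic_map g U"
  shows "holomorphic_map (f + g) U"
  unfolding holomorphic_map_def
proof
  fix x assume "x \<in> U"
  then have "\<exists>D. (f has_derivative D) (at x) \<and> clinear_on UNIV D"
    and gE: "\<exists>E. (g has_derivative E) (at x) \<and> clinear_on UNIV E"
    using assms by (simp_all add: holomorphic_map_def)
  then obtain D where D: "(f has_derivative D) (at x)" "clinear_on UNIV D" by (elim exE conjE)
  from gE obtain E where E: "(g has_derivative E) (at x)" "clinear_on UNIV E" by (elim exE conjE)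
  have "((f + g) has_derivative (D + E)) (at x)"
    unfolding func_plus by (rule has_derivative_add[OF D(1) E(1)])
  moreover have "clinear_on UNIV (D + E)" by (rule clinear_on_plus[OF D(2) E(2)])
  ultimately show "\<exists>D. ((f + g) has_derivative D) (at x) \<and> clinear_on UNIV D" by (intro exI conjI)
qed

lemma holomorphic_map_clinear_compose:
  assumes f: "holomorphic_map f U" and L: "bounded_linear L" "clinear_on UNIV L"
  shows "holomorphic_map (\<lambda>x. L (f x)) U"
  unfolding holomorphic_map_def
proof
  fix x assume "x \<in> U"
  then have "\<exists>D. (f has_derivative D) (at x) \<and> clinear_on UNIV D"
    using f by (simp add: holomorphic_map_def)
  then obtain D where D: "(f has_derivative D) (at x)" "clinear_on UNIV D" by (elim exE conjE)
  from bounded_linear.has_derivative[OF L(1) D(1)] D(2) L(2)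
  show "\<exists>D. ((\<lambda>x. L (f x)) has_derivative D) (at x) \<and> clinear_on UNIV D"
    by (intro exI[of _ "\<lambda>v. L (D v)"]) (auto simp: clinear_on_def)
qed

lemma holomorphic_map_scale: "holomorphic_map f U \<Longrightarrow> holomorphic_map (c *\<^sub>C f) U"
  unfolding scaleC_fun_def
  by (rule holomorphic_map_clinear_compose)
    (auto simp: bounded_linear_scaleC_right clinear_on_def scaleC_add_right mult.commute)

lemma subspace_Hinf: "complex_vector.subspace (Hinf U)"
proof -
  have "bounded ((0 :: 'a \<Rightarrow> 'b) ` U)" by (auto simp: bounded_iff)
  then show ?thesis
    unfolding complex_vector.subspace_def Hinf_def using holomorphic_map_zero[of U] vanishes_off_zero[of U]
    by (auto simp only: mem_Collect_eq intro!: holomorphic_map_plus holomorphic_map_scale vanishes_off_plus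
        vanishes_off_scale bounded_image_plus bounded_image_scale)
qed

lemma cnormed_space_Hinf: "cnormed_space (Hinf U) (sup_norm U)"
  by (rule cnormed_space_sup_norm[OF subspace_Hinf]) (auto simp: Hinf_def vanishes_off_def fun_eq_iff)

lemma bounded_functional_bounded_linear:
  assumes "bounded_functional \<psi>"
  shows "bounded_linear \<psi>"
proof -
  obtain K where "clinear_on UNIV \<psi>" "\<And>x. cmod (\<psi> x) \<le> K * norm x"
    using assms by (auto simp: bounded_functional_def)
  then show ?thesis
    by (intro bounded_linear_intro[of _ K])
      (auto simp: clinear_on_def scaleR_scaleC mult.commute)
qed

lemma Hinf_bounded_functional_compose:
  assumes f: "f \<in> Hinf U" and \<psi>: "bounded_functional \<psi>"
  shows "(\<lambda>x. \<psi> (f x)) \<in> Hinf U"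
proof -
  have lin: "bounded_linear \<psi>" "clinear_on UNIV \<psi>"
    using \<psi> bounded_functional_bounded_linear by (auto simp: bounded_functional_def)
  have "bounded (f ` U)" using f by (simp add: Hinf_def)
  then have "bounded (\<psi> ` (f ` U))" by (rule bounded_linear_image[OF _ lin(1)])
  then show ?thesis
    using f lin holomorphic_map_clinear_compose[of f U \<psi>] linear_simps(3)[OF lin(1)]
    by (auto simp: Hinf_def vanishes_off_def image_image)
qed

lemma cnormed_space_Hinf_dual: "cnormed_space (Hinf_dual U) (dual_norm U)"
  unfolding Hinf_dual_def dual_norm_def by (rule cnormed_space_operator_norm[OF cnormed_space_Hinf])

lemma Hinf_dual_bound: "\<phi> \<in> Hinf_dual U \<Longrightarrow> h \<in> Hinf U \<Longrightarrow> cmod (\<phi> h) \<le> dual_norm U \<phi> * sup_norm U h"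
  unfolding Hinf_dual_def dual_norm_def by (rule norm_le_operator_norm[OF cnormed_space_Hinf])

lemma Hinf_dualI:
  assumes "clinear_on (Hinf U) \<phi>" "vanishes_off (Hinf U) \<phi>" "0 \<le> K"
    "\<And>h. h \<in> Hinf U \<Longrightarrow> cmod (\<phi> h) \<le> K * sup_norm U h"
  shows "\<phi> \<in> Hinf_dual U" and "dual_norm U \<phi> \<le> K"
proof -
  show "\<phi> \<in> Hinf_dual U" using assms by (auto simp: Hinf_dual_def bounded_operators_def)
  show "dual_norm U \<phi> \<le> K" unfolding dual_norm_def
    by (rule operator_norm_least[OF cnormed_space_Hinf assms(3,4)])
qed

lemma eval_functional_unit_ball:
  assumes "x \<in> U"
  shows "eval_functional U x \<in> Hinf_dual U" and "dual_norm U (eval_functional U x) \<le> 1"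
proof -
  have lin: "clinear_on (Hinf U) (eval_functional U x)"
    unfolding clinear_on_def
  proof (intro conjI ballI allI)
    fix c :: complex and h k :: "'a \<Rightarrow> complex" assume h: "h \<in> Hinf U" and k: "k \<in> Hinf U"
    show "eval_functional U x (h + k) = eval_functional U x h + eval_functional U x k"
      using cnormed_spaceD(3)[OF cnormed_space_Hinf h k] h k by (simp add: eval_functional_def)
  next
    fix c :: complex and h :: "'a \<Rightarrow> complex" assume h: "h \<in> Hinf U"
    show "eval_functional U x (c *\<^sub>C h) = c *\<^sub>C eval_functional U x h"
      using cnormed_spaceD(4)[OF cnormed_space_Hinf h, of c] h unfolding eval_functional_def
      by (simp only: if_True scaleC_fun_def)
  qed
  have van: "vanishes_off (Hinf U) (eval_functional U x)" by (simp add: vanishes_off_def eval_functional_def)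
  have bd: "cmod (eval_functional U x h) \<le> 1 * sup_norm U h" if "h \<in> Hinf U" for h
    using that assms sup_norm_upper[of h U x] by (auto simp: eval_functional_def Hinf_def)
  show "eval_functional U x \<in> Hinf_dual U" "dual_norm U (eval_functional U x) \<le> 1"
    using Hinf_dualI[OF lin van _ bd] by auto
qed

lemma span_eval_subset_Hinf_dual: "complex_vector.span (eval_functional U ` U) \<subseteq> Hinf_dual U"
  using cnormed_space_Hinf_dual[of U] eval_functional_unit_ball(1)
  by (intro complex_vector.span_minimal) (auto simp: cnormed_space_def)

lemma span_eval_subset_Ginf: "complex_vector.span (eval_functional U ` U) \<subseteq> Ginf U"
proof
  fix \<phi> assume \<phi>: "\<phi> \<in> complex_vector.span (eval_functional U ` U)"
  have "dual_norm U (\<phi> - \<phi>) = 0" using cnormed_space_norm_zero[OF cnormed_space_Hinf_dual] by simp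
  then have "\<exists>\<psi>\<in>complex_vector.span (eval_functional U ` U). dual_norm U (\<phi> - \<psi>) < \<epsilon>" if "0 < \<epsilon>" for \<epsilon>
    using \<phi> that by (intro bexI[of _ \<phi>]) auto
  with \<phi> span_eval_subset_Hinf_dual show "\<phi> \<in> Ginf U" unfolding Ginf_def by blast
qed

lemma eval_functional_in_Ginf: "x \<in> U \<Longrightarrow> eval_functional U x \<in> Ginf U"
  using span_eval_subset_Ginf complex_vector.span_base by blast

lemma Ginf_subset_Hinf_dual: "Ginf U \<subseteq> Hinf_dual U"
  by (auto simp: Ginf_def)

lemma subspace_Ginf: "complex_vector.subspace (Ginf U)"
proof -
  let ?N = "dual_norm U" and ?S = "complex_vector.span (eval_functional U ` U)"
  note D = cnormed_space_Hinf_dual[of U]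
  have SD: "s \<in> Hinf_dual U" if "s \<in> ?S" for s using that span_eval_subset_Hinf_dual by blast
  have approx: "\<exists>s\<in>?S. ?N (\<phi> - s) < \<epsilon>" if "\<phi> \<in> Ginf U" "0 < \<epsilon>" for \<phi> \<epsilon>
    using that by (simp add: Ginf_def)
  have memI: "\<phi> \<in> Ginf U" if "\<phi> \<in> Hinf_dual U" "\<And>\<epsilon>. 0 < \<epsilon> \<Longrightarrow> \<exists>s\<in>?S. ?N (\<phi> - s) < \<epsilon>" for \<phi>
    using that by (simp add: Ginf_def)
  show ?thesis unfolding complex_vector.subspace_def
  proof (intro conjI ballI allI)
    show "0 \<in> Ginf U" using span_eval_subset_Ginf complex_vector.span_zero by blast
  next
    fix \<phi> \<psi> assume \<phi>: "\<phi> \<in> Ginf U" and \<psi>: "\<psi> \<in> Ginf U"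
    then have D2: "\<phi> \<in> Hinf_dual U" "\<psi> \<in> Hinf_dual U" using Ginf_subset_Hinf_dual by blast+
    show "\<phi> + \<psi> \<in> Ginf U"
    proof (rule memI)
      show "\<phi> + \<psi> \<in> Hinf_dual U" by (rule cnormed_spaceD(3)[OF D D2])
      fix \<epsilon> :: real assume "0 < \<epsilon>"
      then have e: "0 < \<epsilon> / 2" by simp
      obtain s where s: "s \<in> ?S" "?N (\<phi> - s) < \<epsilon> / 2" using approx[OF \<phi> e] by blast
      obtain t where t: "t \<in> ?S" "?N (\<psi> - t) < \<epsilon> / 2" using approx[OF \<psi> e] by blast
      have "?N ((\<phi> - s) + (\<psi> - t)) \<le> ?N (\<phi> - s) + ?N (\<psi> - t)"
        by (intro cnormed_spaceD(7)[OF D] cnormed_space_diff(1)[OF D] D2 SD s t)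
      moreover have "(\<phi> - s) + (\<psi> - t) = \<phi> + \<psi> - (s + t)" by simp
      ultimately have "?N (\<phi> + \<psi> - (s + t)) < \<epsilon>" using s(2) t(2) by simp
      then show "\<exists>s\<in>?S. ?N (\<phi> + \<psi> - s) < \<epsilon>" using complex_vector.span_add[OF s(1) t(1)] by blast
    qed
  next
    fix c \<phi> assume \<phi>: "\<phi> \<in> Ginf U"
    then have D2: "\<phi> \<in> Hinf_dual U" using Ginf_subset_Hinf_dual by blast
    show "c *\<^sub>C \<phi> \<in> Ginf U"
    proof (rule memI)
      show "c *\<^sub>C \<phi> \<in> Hinf_dual U" by (rule cnormed_spaceD(4)[OF D D2])
      fix \<epsilon> :: real assume "0 < \<epsilon>"
      have c: "0 < cmod c + 1" by (simp add: add_nonneg_pos)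
      with \<open>0 < \<epsilon>\<close> have e: "0 < \<epsilon> / (cmod c + 1)" by simp
      obtain s where s: "s \<in> ?S" "?N (\<phi> - s) < \<epsilon> / (cmod c + 1)" using approx[OF \<phi> e] by blast
      have d: "\<phi> - s \<in> Hinf_dual U" by (rule cnormed_space_diff(1)[OF D D2 SD[OF s(1)]])
      have "c *\<^sub>C \<phi> - c *\<^sub>C s = c *\<^sub>C (\<phi> - s)" by (simp only: complex_vector.scale_right_diff_distrib)
      then have "?N (c *\<^sub>C \<phi> - c *\<^sub>C s) = cmod c * ?N (\<phi> - s)" by (simp only: cnormed_spaceD(8)[OF D d])
      also have "\<dots> \<le> (cmod c + 1) * ?N (\<phi> - s)" using cnormed_spaceD(5)[OF D d] by (intro mult_right_mono) auto
      also have "\<dots> < \<epsilon>" using s(2) c by (simp add: field_simps)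
      finally show "\<exists>t\<in>?S. ?N (c *\<^sub>C \<phi> - t) < \<epsilon>" using complex_vector.span_scale[OF s(1), of c] by blast
    qed
  qed
qed

lemma cnormed_space_Ginf: "cnormed_space (Ginf U) (dual_norm U)"
  by (rule cnormed_space_subspace[OF cnormed_space_Hinf_dual subspace_Ginf Ginf_subset_Hinf_dual])

text \<open>
  The definition of \<open>Ginf\<close> speaks of approximation by the span only; an \<open>\<epsilon>/2\<close> argument extends it to
  approximation by elements of \<open>Ginf\<close>.
\<close>
lemma Ginf_closed:
  assumes \<phi>: "\<phi> \<in> Hinf_dual U" and approx: "\<And>\<epsilon>. 0 < \<epsilon> \<Longrightarrow> \<exists>\<psi>\<in>Ginf U. dual_norm U (\<phi> - \<psi>) < \<epsilon>"
  shows "\<phi> \<in> Ginf U"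
  unfolding Ginf_def
proof (intro CollectI conjI allI impI \<phi>)
  let ?N = "dual_norm U"
  have D: "cnormed_space (Hinf_dual U) ?N" by (rule cnormed_space_Hinf_dual)
  fix \<epsilon> :: real assume "0 < \<epsilon>"
  then have e: "0 < \<epsilon> / 2" by simp
  from approx[OF e] obtain \<psi> where \<psi>: "\<psi> \<in> Ginf U" "?N (\<phi> - \<psi>) < \<epsilon> / 2" by blast
  then obtain s where s: "s \<in> complex_vector.span (eval_functional U ` U)" "?N (\<psi> - s) < \<epsilon> / 2"
    using e unfolding Ginf_def mem_Collect_eq by meson
  have mem: "\<psi> \<in> Hinf_dual U" "s \<in> Hinf_dual U"
    using \<psi>(1) s(1) Ginf_subset_Hinf_dual span_eval_subset_Hinf_dual by blast+
  have "?N ((\<phi> - \<psi>) + (\<psi> - s)) \<le> ?N (\<phi> - \<psi>) + ?N (\<psi> - s)"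
    by (intro cnormed_spaceD(7)[OF D] cnormed_space_diff(1)[OF D] \<phi> mem)
  then show "\<exists>s\<in>complex_vector.span (eval_functional U ` U). ?N (\<phi> - s) < \<epsilon>"
    using s \<psi>(2) by (intro bexI[of _ s]) simp_all
qed

section \<open>The linearisation of a bounded holomorphic map\<close>

text \<open>
  The linearisation of \<open>f\<close> is characterised by its values under all bounded functionals. Working
  with this relation avoids checking that the operator is well defined on linear combinations of point evaluations.
\<close>
definition weak_value :: "'e::complex_normed_vector set \<Rightarrow> ('e \<Rightarrow> 'f::complex_normed_vector) \<Rightarrow>
    (('e \<Rightarrow> complex) \<Rightarrow> complex) \<Rightarrow> 'f \<Rightarrow> bool" where
  "weak_value U f \<phi> y \<longleftrightarrow> (\<forall>\<psi>. bounded_functional \<psi> \<longrightarrow> \<psi> y = \<phi> (\<lambda>x. \<psi> (f x)))"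

lemma bounded_functional_linear:
  assumes "bounded_functional \<psi>"
  shows "\<psi> (x + y) = \<psi> x + \<psi> y" "\<psi> (x - y) = \<psi> x - \<psi> y" "\<psi> (c *\<^sub>C x) = c * \<psi> x" "\<psi> 0 = 0"
  using linear_simps[OF bounded_functional_bounded_linear[OF assms]] assms
  by (auto simp: bounded_functional_def clinear_on_def scaleC_complex_def)

lemma weak_value_eval: "f \<in> Hinf U \<Longrightarrow> weak_value U f (eval_functional U x) (f x)"
  by (simp add: weak_value_def eval_functional_def Hinf_bounded_functional_compose)

lemma weak_value_add: "weak_value U f \<phi> y \<Longrightarrow> weak_value U f \<phi>' y' \<Longrightarrow> weak_value U f (\<phi> + \<phi>') (y + y')"
  by (simp add: weak_value_def bounded_functional_linear)

lemma weak_value_diff: "weak_value U f \<phi> y \<Longrightarrow> weak_value U f \<phi>' y' \<Longrightarrow> weak_value U f (\<phi> - \<phi>') (y - y')"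
  by (simp add: weak_value_def bounded_functional_linear)

lemma weak_value_scale: "weak_value U f \<phi> y \<Longrightarrow> weak_value U f (c *\<^sub>C \<phi>) (c *\<^sub>C y)"
  by (simp add: weak_value_def bounded_functional_linear scaleC_fun_def scaleC_complex_def)

lemma weak_value_zero: "weak_value U f 0 0"
  by (simp add: weak_value_def bounded_functional_linear)

text \<open>
  A functional bounded by \<open>1\<close> on \<open>C\<close> is bounded by \<open>1\<close> on the range of \<open>f\<close>, so its composite with \<open>f\<close>
  lies in the unit ball of the bounded holomorphic functions, where \<open>\<phi>\<close> is bounded by \<open>1\<close>. The bipolar
  theorem does the rest. This replaces the fact that the unit ball of the predual is the closed
  absolutely convex hull of the point evaluations, and it needs separation in the target space only.
\<close>
lemma weak_value_in_closed_absolutely_convex: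
  assumes f: "f \<in> Hinf U" and C: "absolutely_convex C" "closed C" "f ` U \<subseteq> C"
    and \<phi>: "\<phi> \<in> unit_ball (Hinf_dual U) (dual_norm U)" and y: "weak_value U f \<phi> y"
  shows "y \<in> C"
proof (rule bipolar[OF C(1,2)])
  fix \<psi> :: "'b \<Rightarrow> complex"
  assume \<psi>: "bounded_functional \<psi>" and le: "\<And>c. c \<in> C \<Longrightarrow> cmod (\<psi> c) \<le> 1"
  let ?h = "\<lambda>x. \<psi> (f x)"
  have \<phi>': "\<phi> \<in> Hinf_dual U" "dual_norm U \<phi> \<le> 1" using \<phi> by (auto simp: unit_ball_def)
  have h: "?h \<in> Hinf U" by (rule Hinf_bounded_functional_compose[OF f \<psi>])
  have "sup_norm U ?h \<le> 1" using le C(3) by (intro sup_norm_least) auto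
  moreover have "0 \<le> sup_norm U ?h" by (rule cnormed_spaceD(5)[OF cnormed_space_Hinf h])
  ultimately have "dual_norm U \<phi> * sup_norm U ?h \<le> 1 * 1"
    using \<phi>'(2) by (intro mult_mono) auto
  then have "cmod (\<phi> ?h) \<le> 1" using Hinf_dual_bound[OF \<phi>'(1) h] by simp
  then show "cmod (\<psi> y) \<le> 1" using y \<psi> by (simp add: weak_value_def)
qed

lemma absolutely_convex_cball:
  assumes "0 \<le> r"
  shows "absolutely_convex (cball (0 :: 'a::complex_normed_vector) r)"
  unfolding absolutely_convex_def
proof (intro conjI ballI allI impI)
  fix x y :: 'a and a b
  assume x: "x \<in> cball 0 r" and y: "y \<in> cball 0 r" and ab: "cmod a + cmod b \<le> 1"
  have "norm (a *\<^sub>C x + b *\<^sub>C y) \<le> cmod a * norm x + cmod b * norm y"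
    using norm_triangle_ineq[of "a *\<^sub>C x" "b *\<^sub>C y"] by (simp add: norm_scaleC)
  also have "\<dots> \<le> cmod a * r + cmod b * r" using x y by (intro add_mono mult_left_mono) auto
  also have "\<dots> \<le> 1 * r" unfolding distrib_right[symmetric] using ab assms by (rule mult_right_mono)
  finally show "a *\<^sub>C x + b *\<^sub>C y \<in> cball 0 r" by simp
qed (use assms in simp)

text \<open>
  Take balls for \<open>C\<close> in \<open>weak_value_in_closed_absolutely_convex\<close>, after scaling \<open>\<phi>\<close> into the unit ball. The scaling factor
  carries an extra \<open>\<epsilon>\<close> because \<open>\<phi>\<close> may vanish.
\<close>
lemma norm_weak_value_le:
  fixes f :: "'e::complex_normed_vector \<Rightarrow> 'f::complex_normed_vector"
  assumes f: "f \<in> Hinf U" and \<phi>: "\<phi> \<in> Hinf_dual U" and y: "weak_value U f \<phi> y"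
  shows "norm y \<le> dual_norm U \<phi> * sup_norm U f"
proof -
  note D = cnormed_space_Hinf_dual[of U]
  let ?d = "dual_norm U \<phi>" and ?K = "sup_norm U f"
  have d: "0 \<le> ?d" by (rule cnormed_spaceD(5)[OF D \<phi>])
  have bdd: "bounded (f ` U)" using f by (simp add: Hinf_def)
  have K: "0 \<le> ?K" by (rule sup_norm_nonneg[OF bdd])
  have le: "norm y \<le> (?d + \<epsilon>) * ?K" if "0 < \<epsilon>" for \<epsilon>
  proof -
    let ?c = "complex_of_real (1 / (?d + \<epsilon>))"
    have pos: "0 < ?d + \<epsilon>" using d that by simp
    have c: "cmod ?c = 1 / (?d + \<epsilon>)" unfolding norm_of_real using pos by simp
    have "dual_norm U (?c *\<^sub>C \<phi>) \<le> 1"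
      unfolding cnormed_spaceD(8)[OF D \<phi>] c using pos that by simp
    then have "?c *\<^sub>C \<phi> \<in> unit_ball (Hinf_dual U) (dual_norm U)"
      using cnormed_spaceD(4)[OF D \<phi>] by (simp add: unit_ball_def)
    moreover have "f ` U \<subseteq> cball 0 ?K" using sup_norm_upper[OF bdd] by auto
    ultimately have "?c *\<^sub>C y \<in> cball 0 ?K"
      using weak_value_in_closed_absolutely_convex[OF f absolutely_convex_cball[OF K] closed_cball]
        weak_value_scale[OF y] by blast
    then have "(1 / (?d + \<epsilon>)) * norm y \<le> ?K" unfolding mem_cball dist_0_norm norm_scaleC c .
    then show ?thesis using pos by (simp add: field_simps)
  qed
  show ?thesis
  proof (rule field_le_epsilon)
    fix e :: real assume e: "0 < e"
    have "norm y \<le> (?d + e / (?K + 1)) * ?K" using K e by (intro le) simp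
    also have "\<dots> = ?d * ?K + e * (?K / (?K + 1))" by (simp add: distrib_right)
    also have "e * (?K / (?K + 1)) \<le> e * 1" using K e by (intro mult_left_mono) auto
    finally show "norm y \<le> ?d * ?K + e" by simp
  qed
qed

lemma weak_value_unique:
  assumes "f \<in> Hinf U" "weak_value U f \<phi> y" "weak_value U f \<phi> y'"
  shows "y = y'"
proof -
  note D = cnormed_space_Hinf_dual[of U]
  have "norm (y - y') \<le> dual_norm U 0 * sup_norm U f"
    using weak_value_diff[OF assms(2,3)] by (intro norm_weak_value_le assms cnormed_spaceD(2)[OF D]) simp
  then show ?thesis by (simp add: cnormed_space_norm_zero[OF D])
qed

lemma weak_value_exists_span:
  assumes f: "f \<in> Hinf U" and \<phi>: "\<phi> \<in> complex_vector.span (eval_functional U ` U)"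
  shows "\<exists>y. weak_value U f \<phi> y"
proof -
  have "complex_vector.subspace {\<phi>. \<exists>y. weak_value U f \<phi> y}"
    unfolding complex_vector.subspace_def
    using weak_value_zero weak_value_add weak_value_scale by blast
  moreover have "eval_functional U ` U \<subseteq> {\<phi>. \<exists>y. weak_value U f \<phi> y}"
    using weak_value_eval[OF f] by blast
  ultimately show ?thesis using complex_vector.span_minimal \<phi> by blast
qed

text \<open>
  The norm estimate makes the values along an approximating sequence in the span a Cauchy sequence; its
  limit is the desired value.
\<close>
lemma weak_value_exists:
  fixes f :: "'e::complex_normed_vector \<Rightarrow> 'f::complex_banach"
  assumes f: "f \<in> Hinf U" and \<phi>: "\<phi> \<in> Ginf U"
  shows "\<exists>y. weak_value U f \<phi> y"
proof -
  note D = cnormed_space_Hinf_dual[of U]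
  let ?N = "dual_norm U" and ?S = "complex_vector.span (eval_functional U ` U)"
  let ?K = "sup_norm U f"
  have K: "0 \<le> ?K" using f by (intro sup_norm_nonneg) (simp add: Hinf_def)
  have \<phi>D: "\<phi> \<in> Hinf_dual U" using \<phi> by (simp add: Ginf_def)
  have "\<exists>s. s \<in> ?S \<and> ?N (\<phi> - s) < 1 / real (Suc n)" for n
  proof -
    have "0 < 1 / real (Suc n)" by simp
    with \<phi> show ?thesis unfolding Ginf_def mem_Collect_eq by meson
  qed
  then obtain s where s: "\<And>n. s n \<in> ?S" "\<And>n. ?N (\<phi> - s n) < 1 / real (Suc n)" by metis
  have sD: "s n \<in> Hinf_dual U" for n using s(1) span_eval_subset_Hinf_dual by blast
  have dD: "\<phi> - s n \<in> Hinf_dual U" for n by (rule cnormed_space_diff(1)[OF D \<phi>D sD])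
  from weak_value_exists_span[OF f s(1)] obtain y where y: "\<And>n. weak_value U f (s n) (y n)" by metis
  have ydist: "dist (y m) (y n) \<le> (1 / real (Suc m) + 1 / real (Suc n)) * ?K" for m n
  proof -
    have "dist (y m) (y n) \<le> ?N (s m - s n) * ?K" unfolding dist_norm
      by (rule norm_weak_value_le[OF f cnormed_space_diff(1)[OF D sD sD] weak_value_diff[OF y y]])
    also have "s m - s n = (\<phi> - s n) - (\<phi> - s m)" by simp
    also have "?N \<dots> * ?K \<le> (1 / real (Suc m) + 1 / real (Suc n)) * ?K"
      using cnormed_space_diff(2)[OF D dD dD, of n m] s(2)[of n] s(2)[of m] K by (intro mult_right_mono) auto
    finally show ?thesis .
  qed
  have "Cauchy y"
  proof (rule metric_CauchyI)
    fix e :: real assume e: "0 < e"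
    then have "0 < e / (2 * ?K + 1)" using K by simp
    then obtain M where M: "inverse (real (Suc M)) < e / (2 * ?K + 1)" using reals_Archimedean by blast
    have "dist (y m) (y n) < e" if "M \<le> m" "M \<le> n" for m n
    proof -
      have "1 / real (Suc m) \<le> inverse (real (Suc M))" "1 / real (Suc n) \<le> inverse (real (Suc M))"
        using that by (auto simp: inverse_eq_divide intro!: divide_left_mono)
      then have "dist (y m) (y n) \<le> (2 * inverse (real (Suc M))) * ?K"
        using ydist[of m n] K by (elim order_trans) (intro mult_right_mono, auto)
      also have "\<dots> \<le> inverse (real (Suc M)) * (2 * ?K + 1)" by (simp add: algebra_simps)
      also have "\<dots> < e" using M K by (simp add: pos_less_divide_eq)
      finally show ?thesis .
    qed
    then show "\<exists>M. \<forall>m\<ge>M. \<forall>n\<ge>M. dist (y m) (y n) < e" by blast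
  qed
  then obtain z where z: "y \<longlonglongrightarrow> z" using Cauchy_convergent_iff convergent_def by blast
  have "\<psi> z = \<phi> (\<lambda>x. \<psi> (f x))" if \<psi>: "bounded_functional \<psi>" for \<psi>
  proof -
    let ?h = "\<lambda>x. \<psi> (f x)"
    have h: "?h \<in> Hinf U" by (rule Hinf_bounded_functional_compose[OF f \<psi>])
    have h0: "0 \<le> sup_norm U ?h" by (rule cnormed_spaceD(5)[OF cnormed_space_Hinf h])
    have "(\<lambda>n. \<psi> (y n)) \<longlonglongrightarrow> \<psi> z"
      by (rule bounded_linear.tendsto[OF bounded_functional_bounded_linear[OF \<psi>] z])
    moreover have "(\<lambda>n. \<psi> (y n)) \<longlonglongrightarrow> \<phi> ?h"
    proof (rule LIM_zero_cancel)
      show "(\<lambda>n. \<psi> (y n) - \<phi> ?h) \<longlonglongrightarrow> 0"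
      proof (rule Lim_null_comparison)
        show "\<forall>\<^sub>F n in sequentially. norm (\<psi> (y n) - \<phi> ?h) \<le> (1 / real (Suc n)) * sup_norm U ?h"
        proof (intro always_eventually allI)
          fix n
          have "norm (\<psi> (y n) - \<phi> ?h) = cmod ((\<phi> - s n) ?h)" using y[of n] \<psi> by (simp add: weak_value_def norm_minus_commute)
          also have "\<dots> \<le> ?N (\<phi> - s n) * sup_norm U ?h" by (rule Hinf_dual_bound[OF dD h])
          also have "\<dots> \<le> (1 / real (Suc n)) * sup_norm U ?h"
            using s(2)[of n] h0 by (intro mult_right_mono) auto
          finally show "norm (\<psi> (y n) - \<phi> ?h) \<le> (1 / real (Suc n)) * sup_norm U ?h" .
        qed
        show "(\<lambda>n. (1 / real (Suc n)) * sup_norm U ?h) \<longlonglongrightarrow> 0"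
          using tendsto_mult_left_zero[OF LIMSEQ_inverse_real_of_nat] by (simp add: inverse_eq_divide)
      qed
    qed
    ultimately show ?thesis by (rule LIMSEQ_unique)
  qed
  then show ?thesis by (auto simp: weak_value_def)
qed

lemma bounded_operators_Ginf_eqI:
  fixes S T :: "(('e::complex_normed_vector \<Rightarrow> complex) \<Rightarrow> complex) \<Rightarrow> 'f::complex_normed_vector"
  assumes S: "S \<in> bounded_operators (Ginf U) (dual_norm U)" and T: "T \<in> bounded_operators (Ginf U) (dual_norm U)"
    and eq: "\<And>x. x \<in> U \<Longrightarrow> S (eval_functional U x) = T (eval_functional U x)"
  shows "S = T"
proof -
  note G = cnormed_space_Ginf[of U]
  let ?N = "dual_norm U" and ?span = "complex_vector.span (eval_functional U ` U)"
  note op = cnormed_space_operator_norm[OF G, where ?'w = 'f]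
  define R where "R = S - T"
  have R: "R \<in> bounded_operators (Ginf U) ?N" unfolding R_def by (rule cnormed_space_diff(1)[OF op S T])
  then have R': "clinear_on (Ginf U) R" "vanishes_off (Ginf U) R" by (auto simp: bounded_operators_def)
  have "complex_vector.subspace {\<phi> \<in> Ginf U. R \<phi> = 0}"
  proof -
    have "R 0 = 0" using clinear_on_scaleC[OF R'(1) cnormed_spaceD(2)[OF G], of 0] by simp
    then show ?thesis
      unfolding complex_vector.subspace_def using cnormed_spaceD(2,3,4)[OF G]
        clinear_on_add[OF R'(1)] clinear_on_scaleC[OF R'(1)] by simp
  qed
  moreover have "eval_functional U ` U \<subseteq> {\<phi> \<in> Ginf U. R \<phi> = 0}"
    using eq eval_functional_in_Ginf by (auto simp: R_def)
  ultimately have span: "R \<phi> = 0" if "\<phi> \<in> ?span" for \<phi>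
    using complex_vector.span_minimal that by blast
  have "R \<phi> = 0" if \<phi>: "\<phi> \<in> Ginf U" for \<phi>
  proof -
    let ?M = "operator_norm (Ginf U) ?N R"
    have M: "0 \<le> ?M" by (rule cnormed_spaceD(5)[OF op R])
    have "norm (R \<phi>) \<le> 0 + e" if e: "0 < e" for e
    proof -
      have "0 < e / (?M + 1)" using M e by simp
      then obtain s where s: "s \<in> ?span" "?N (\<phi> - s) < e / (?M + 1)" using \<phi> by (auto simp: Ginf_def)
      have sG: "s \<in> Ginf U" using s(1) span_eval_subset_Ginf by blast
      note d = cnormed_space_diff(1)[OF G \<phi> sG]
      have "R \<phi> = R (\<phi> - s)"
        using clinear_on_diff[OF R'(1) cnormed_spaceD(1)[OF G] \<phi> sG] span[OF s(1)] by simp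
      then have "norm (R \<phi>) \<le> ?M * ?N (\<phi> - s)" using norm_le_operator_norm[OF G R d] by simp
      also have "\<dots> \<le> (?M + 1) * ?N (\<phi> - s)" using cnormed_spaceD(5)[OF G d] by (intro mult_right_mono) auto
      also have "\<dots> \<le> e" using s(2) M by (simp add: pos_less_divide_eq mult.commute less_imp_le)
      finally show ?thesis by simp
    qed
    then have "norm (R \<phi>) \<le> 0" by (rule field_le_epsilon)
    then show ?thesis by simp
  qed
  then have "R = 0" using R'(2) by (auto simp: vanishes_off_def fun_eq_iff)
  then show ?thesis by (simp add: R_def)
qed

lemma linearisation_eqI:
  assumes "T \<in> bounded_operators (Ginf U) (dual_norm U)" "\<And>x. x \<in> U \<Longrightarrow> T (eval_functional U x) = f x"
  shows "linearisation U f = T"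
  unfolding linearisation_def
proof (rule the_equality)
  show "S = T" if "S \<in> bounded_operators (Ginf U) (dual_norm U) \<and> (\<forall>x\<in>U. S (eval_functional U x) = f x)" for S
    using that assms by (intro bounded_operators_Ginf_eqI[of S U T]) auto
qed (use assms in simp)

theorem linearisation_weak_value:
  fixes f :: "'e::complex_normed_vector \<Rightarrow> 'f::complex_banach"
  assumes f: "f \<in> Hinf U"
  shows "linearisation U f \<in> bounded_operators (Ginf U) (dual_norm U)"
    and "\<And>x. x \<in> U \<Longrightarrow> linearisation U f (eval_functional U x) = f x"
    and "\<And>\<phi>. \<phi> \<in> Ginf U \<Longrightarrow> weak_value U f \<phi> (linearisation U f \<phi>)"
proof -
  note G = cnormed_space_Ginf[of U]
  define T where "T \<phi> = (if \<phi> \<in> Ginf U then SOME y. weak_value U f \<phi> y else 0)" for \<phi>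
  have T: "weak_value U f \<phi> (T \<phi>)" if "\<phi> \<in> Ginf U" for \<phi>
    using someI_ex[OF weak_value_exists[OF f that]] that by (simp add: T_def)
  have Tu: "T \<phi> = y" if "\<phi> \<in> Ginf U" "weak_value U f \<phi> y" for \<phi> y
    using weak_value_unique[OF f T[OF that(1)] that(2)] .
  have "clinear_on (Ginf U) T"
    unfolding clinear_on_def
    by (intro conjI ballI allI Tu weak_value_add weak_value_scale T cnormed_spaceD(3,4)[OF G])
  moreover have "norm (T \<phi>) \<le> sup_norm U f * dual_norm U \<phi>" if "\<phi> \<in> Ginf U" for \<phi>
    using norm_weak_value_le[OF f _ T[OF that]] that Ginf_subset_Hinf_dual by (auto simp: mult.commute)
  ultimately have Tb: "T \<in> bounded_operators (Ginf U) (dual_norm U)"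
    by (auto simp: bounded_operators_def vanishes_off_def T_def)
  have Te: "T (eval_functional U x) = f x" if "x \<in> U" for x
    by (rule Tu[OF eval_functional_in_Ginf[OF that] weak_value_eval[OF f]])
  have "linearisation U f = T" by (rule linearisation_eqI[OF Tb Te])
  with T Tb Te show "linearisation U f \<in> bounded_operators (Ginf U) (dual_norm U)"
    "\<And>x. x \<in> U \<Longrightarrow> linearisation U f (eval_functional U x) = f x"
    "\<And>\<phi>. \<phi> \<in> Ginf U \<Longrightarrow> weak_value U f \<phi> (linearisation U f \<phi>)" by simp_all
qed

section \<open>Holomorphy of the point evaluations\<close>

text \<open>
  Cauchy's estimates bound the \<open>n\<close>-th Taylor coefficient by \<open>B / R ^ n\<close>; for \<open>R \<ge> 2\<close> the terms from
  the second one on are dominated by a geometric series with ratio \<open>1/2\<close>.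
\<close>
lemma taylor_remainder_bound:
  fixes g :: "complex \<Rightarrow> complex"
  assumes g: "g holomorphic_on cball 0 R" and R: "2 \<le> R" and B: "\<And>t. cmod t \<le> R \<Longrightarrow> cmod (g t) \<le> B"
  shows "cmod (g 1 - g 0 - deriv g 0) \<le> 2 * B / R\<^sup>2"
proof -
  let ?c = "\<lambda>n. (deriv ^^ n) g 0 / fact n"
  have gb: "g holomorphic_on ball 0 R" by (rule holomorphic_on_subset[OF g]) auto
  have B0: "0 \<le> B" using B[of 0] R by (metis norm_ge_zero norm_zero order_trans zero_le_numeral)
  have cn: "cmod (?c n) \<le> B / R ^ n" for n
  proof -
    have "cmod ((deriv ^^ n) g 0) \<le> fact n * B / R ^ n"
      by (rule Cauchy_inequality[OF gb holomorphic_on_imp_continuous_on[OF g]]) (use R B in auto)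
    then show ?thesis by (simp add: norm_divide field_simps)
  qed
  have "(\<lambda>n. ?c n * (1 - 0) ^ n) sums g 1"
    by (rule holomorphic_power_series[OF gb]) (use R in auto)
  then have "?c sums g 1" by simp
  then have "(\<lambda>n. ?c (n + 2)) sums (g 1 - (\<Sum>n<2. ?c n))" by (rule sums_split_initial_segment)
  then have tail: "(\<lambda>n. ?c (n + 2)) sums (g 1 - g 0 - deriv g 0)"
    by (simp add: numeral_2_eq_2 algebra_simps)
  have geo: "(\<lambda>n. B / R\<^sup>2 * (1/2)^n) sums (B / R\<^sup>2 * (1 / (1 - 1/2)))"
    by (intro sums_mult geometric_sums) simp
  have "cmod (?c (n + 2)) \<le> B / R\<^sup>2 * (1/2)^n" for n
  proof -
    have "cmod (?c (n + 2)) \<le> B / R\<^sup>2 * (1 / R) ^ n" using cn[of "n + 2"] by (simp add: power_add power_divide power2_eq_square)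
    also have "\<dots> \<le> B / R\<^sup>2 * (1 / 2) ^ n"
      using R B0 by (intro mult_left_mono power_mono divide_left_mono) auto
    finally show ?thesis .
  qed
  then have "cmod (\<Sum>n. ?c (n + 2)) \<le> (\<Sum>n. B / R\<^sup>2 * (1/2)^n)"
    using sums_summable[OF geo] by (intro norm_suminf_le) auto
  also have "\<dots> = 2 * B / R\<^sup>2" by (simp only: sums_unique[OF geo, symmetric]) simp
  finally show ?thesis by (simp only: sums_unique[OF tail, symmetric])
qed

lemma deriv_bound_Cauchy:
  fixes g :: "complex \<Rightarrow> complex"
  assumes g: "g holomorphic_on cball 0 R" and R: "0 < R" and B: "\<And>t. cmod t \<le> R \<Longrightarrow> cmod (g t) \<le> B"
  shows "cmod (deriv g 0) \<le> B / R"
proof -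
  have "cmod ((deriv ^^ 1) g 0) \<le> fact 1 * B / R ^ 1"
    by (rule Cauchy_inequality[OF holomorphic_on_subset[OF g] holomorphic_on_imp_continuous_on[OF g]])
      (use R B in auto)
  then show ?thesis by simp
qed

lemma Hinf_differential:
  assumes "h \<in> Hinf U" "x \<in> U"
  shows "(h has_derivative frechet_derivative h (at x)) (at x)"
    and "clinear_on UNIV (frechet_derivative h (at x))"
proof -
  have "\<exists>D. (h has_derivative D) (at x) \<and> clinear_on UNIV D"
    using assms by (simp add: Hinf_def holomorphic_map_def)
  then obtain D where D: "(h has_derivative D) (at x)" "clinear_on UNIV D" by (elim exE conjE)
  moreover have "D = frechet_derivative h (at x)" by (rule frechet_derivative_at[OF D(1)])
  ultimately show "(h has_derivative frechet_derivative h (at x)) (at x)"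
    "clinear_on UNIV (frechet_derivative h (at x))" by simp_all
qed

lemma Hinf_restrict_line:
  fixes h :: "'e::complex_normed_vector \<Rightarrow> complex"
  assumes h: "h \<in> Hinf U" and x: "x \<in> U" and ball: "ball x r \<subseteq> U" and R: "R * norm v < r" "0 \<le> R"
  defines "g \<equiv> \<lambda>t. h (x + t *\<^sub>C v)"
  shows "g holomorphic_on cball 0 R" and "deriv g 0 = frechet_derivative h (at x) v"
    and "\<And>t. cmod t \<le> R \<Longrightarrow> cmod (g t) \<le> sup_norm U h"
proof -
  have inU: "x + t *\<^sub>C v \<in> U" if "cmod t \<le> R" for t
  proof -
    have "cmod t * norm v \<le> R * norm v" using that by (rule mult_right_mono) simp
    then have "x + t *\<^sub>C v \<in> ball x r" using R(1) by (simp add: dist_norm norm_scaleC)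
    then show ?thesis using ball by blast
  qed
  have der: "(g has_field_derivative frechet_derivative h (at (x + t *\<^sub>C v)) v) (at t)" if "cmod t \<le> R" for t
  proof -
    let ?D = "frechet_derivative h (at (x + t *\<^sub>C v))"
    have "((\<lambda>t. x + t *\<^sub>C v) has_derivative (\<lambda>s. s *\<^sub>C v)) (at t)"
      by (rule derivative_eq_intros bounded_linear.has_derivative[OF bounded_linear_scaleC_left] has_derivative_const has_derivative_ident | simp)+
    then have "(g has_derivative (\<lambda>s. ?D (s *\<^sub>C v))) (at t)"
      unfolding g_def using Hinf_differential(1)[OF h inU[OF that]] by (rule has_derivative_compose)
    moreover have "?D (s *\<^sub>C v) = ?D v * s" for s
      using clinear_on_scaleC[OF Hinf_differential(2)[OF h inU[OF that]], of v s]
      by (simp add: scaleC_complex_def mult.commute)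
    ultimately show ?thesis by (simp add: has_field_derivative_def)
  qed
  show "g holomorphic_on cball 0 R"
    unfolding holomorphic_on_def field_differentiable_def
    using der by (meson has_field_derivative_at_within mem_cball_0)
  show "deriv g 0 = frechet_derivative h (at x) v" using DERIV_imp_deriv[OF der[of 0]] R(2) by simp
  have "bounded (h ` U)" using h by (simp add: Hinf_def)
  then show "cmod (g t) \<le> sup_norm U h" if "cmod t \<le> R" for t
    unfolding g_def by (rule sup_norm_upper[OF _ inU[OF that]])
qed

text \<open>
  Cauchy's estimates on complex lines through \<open>x\<close>. The point is that the constants depend on \<open>h\<close>
  through its supremum norm only, so that the bounds become norm estimates in the dual space. On the
  line in direction \<open>v\<close> the disc of radius \<open>r / (2 * norm v)\<close> stays within the ball; it has radius at
  least \<open>2\<close> when \<open>norm v \<le> r / 4\<close>.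
\<close>
lemma Hinf_differential_bounds:
  fixes h :: "'e::complex_normed_vector \<Rightarrow> complex"
  assumes h: "h \<in> Hinf U" and x: "x \<in> U" and r: "0 < r" and ball: "ball x r \<subseteq> U"
  shows "cmod (frechet_derivative h (at x) v) \<le> 2 * norm v / r * sup_norm U h"
    and "norm v \<le> r / 4 \<Longrightarrow>
      cmod (h (x + v) - h x - frechet_derivative h (at x) v) \<le> 8 * (norm v)\<^sup>2 / r\<^sup>2 * sup_norm U h"
proof -
  let ?B = "sup_norm U h"
  define R where "R = r / (2 * norm v)"
  have zero: "frechet_derivative h (at x) 0 = 0"
    using has_derivative_linear[OF Hinf_differential(1)[OF h x]] by (rule linear_0)
  have R: "R * norm v < r" "0 < R" if "v \<noteq> 0" using that r by (auto simp: R_def)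
  show "cmod (frechet_derivative h (at x) v) \<le> 2 * norm v / r * ?B"
  proof (cases "v = 0")
    case False
    note line = Hinf_restrict_line[OF h x ball R(1)[OF False] less_imp_le[OF R(2)[OF False]]]
    have "cmod (frechet_derivative h (at x) v) \<le> ?B / R"
      using deriv_bound_Cauchy[OF line(1) R(2)[OF False] line(3)] line(2) by simp
    then show ?thesis by (simp add: R_def mult.commute)
  qed (simp add: zero)
  show "cmod (h (x + v) - h x - frechet_derivative h (at x) v) \<le> 8 * (norm v)\<^sup>2 / r\<^sup>2 * ?B"
    if v: "norm v \<le> r / 4"
  proof (cases "v = 0")
    case False
    have R2: "2 \<le> R" using v False by (simp add: R_def pos_le_divide_eq)
    note line = Hinf_restrict_line[OF h x ball R(1)[OF False] less_imp_le[OF R(2)[OF False]]]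
    have "cmod (h (x + v) - h x - frechet_derivative h (at x) v) \<le> 2 * ?B / R\<^sup>2"
      using taylor_remainder_bound[OF line(1) R2 line(3)] line(2) by simp
    also have "\<dots> = 8 * (norm v)\<^sup>2 / r\<^sup>2 * ?B" by (simp add: R_def power_divide power_mult_distrib)
    finally show ?thesis .
  qed (simp add: zero)
qed

text \<open>
  This is the derivative of \<open>eval_functional U\<close> at \<open>x\<close> in direction \<open>v\<close>.
\<close>
definition derivative_functional ::
  "'e::complex_normed_vector set \<Rightarrow> 'e \<Rightarrow> 'e \<Rightarrow> ('e \<Rightarrow> complex) \<Rightarrow> complex" where
  "derivative_functional U x v = (\<lambda>h. if h \<in> Hinf U then frechet_derivative h (at x) v else 0)"

lemma frechet_derivative_Hinf_linear:
  fixes h k :: "'e::complex_normed_vector \<Rightarrow> complex"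
  assumes x: "x \<in> U" and h: "h \<in> Hinf U"
  shows "k \<in> Hinf U \<Longrightarrow>
      frechet_derivative (h + k) (at x) v = frechet_derivative h (at x) v + frechet_derivative k (at x) v"
    and "frechet_derivative (c *\<^sub>C h) (at x) v = c *\<^sub>C frechet_derivative h (at x) v"
proof -
  note dh = Hinf_differential(1)[OF h x]
  have "((c *\<^sub>C h) has_derivative (\<lambda>v. c *\<^sub>C frechet_derivative h (at x) v)) (at x)"
    unfolding scaleC_fun_def by (rule bounded_linear.has_derivative[OF bounded_linear_scaleC_right dh])
  from frechet_derivative_at[OF this]
  show "frechet_derivative (c *\<^sub>C h) (at x) v = c *\<^sub>C frechet_derivative h (at x) v" by metis
  assume "k \<in> Hinf U"
  then have "((h + k) has_derivative (\<lambda>v. frechet_derivative h (at x) v + frechet_derivative k (at x) v)) (at x)"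
    unfolding func_plus by (intro has_derivative_add dh Hinf_differential(1)[OF _ x])
  from frechet_derivative_at[OF this]
  show "frechet_derivative (h + k) (at x) v = frechet_derivative h (at x) v + frechet_derivative k (at x) v"
    by metis
qed

lemma derivative_functional_in_Hinf_dual:
  fixes x :: "'e::complex_normed_vector"
  assumes x: "x \<in> U" and r: "0 < r" and ball: "ball x r \<subseteq> U"
  shows "derivative_functional U x v \<in> Hinf_dual U"
    and "dual_norm U (derivative_functional U x v) \<le> 2 * norm v / r"
proof -
  note H = cnormed_space_Hinf[of U, where ?'b = complex]
  have lin: "clinear_on (Hinf U) (derivative_functional U x v)"
    unfolding clinear_on_def
  proof (intro conjI ballI allI)
    fix h k :: "'e \<Rightarrow> complex" assume "h \<in> Hinf U" "k \<in> Hinf U"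
    then show "derivative_functional U x v (h + k) = derivative_functional U x v h + derivative_functional U x v k"
      using frechet_derivative_Hinf_linear(1)[OF x, of h k v] cnormed_spaceD(3)[OF H, of h k]
      by (simp only: derivative_functional_def if_True)
  next
    fix c and h :: "'e \<Rightarrow> complex" assume "h \<in> Hinf U"
    then show "derivative_functional U x v (c *\<^sub>C h) = c *\<^sub>C derivative_functional U x v h"
      using frechet_derivative_Hinf_linear(2)[OF x, of h c v] cnormed_spaceD(4)[OF H, of h c]
      by (simp only: derivative_functional_def if_True)
  qed
  have van: "vanishes_off (Hinf U) (derivative_functional U x v)"
    by (simp add: vanishes_off_def derivative_functional_def)
  have bd: "cmod (derivative_functional U x v h) \<le> 2 * norm v / r * sup_norm U h" if "h \<in> Hinf U" for h
    using Hinf_differential_bounds(1)[OF that x r ball] that by (simp only: derivative_functional_def if_True)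
  show "derivative_functional U x v \<in> Hinf_dual U" "dual_norm U (derivative_functional U x v) \<le> 2 * norm v / r"
    using Hinf_dualI[OF lin van _ bd] r by auto
qed

lemma eval_functional_taylor:
  fixes x :: "'e::complex_normed_vector"
  assumes x: "x \<in> U" and r: "0 < r" and ball: "ball x r \<subseteq> U" and v: "norm v \<le> r / 4"
  shows "dual_norm U (eval_functional U (x + v) - eval_functional U x - derivative_functional U x v)
    \<le> 8 * (norm v)\<^sup>2 / r\<^sup>2"
proof -
  note D = cnormed_space_Hinf_dual[of U]
  let ?\<phi> = "eval_functional U (x + v) - eval_functional U x - derivative_functional U x v"
  have xv: "x + v \<in> U" using v r ball by (intro subsetD[OF ball]) (simp add: dist_norm)
  have "?\<phi> \<in> Hinf_dual U"
    by (intro cnormed_space_diff(1)[OF D] eval_functional_unit_ball(1) x xv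
        derivative_functional_in_Hinf_dual(1)[OF x r ball])
  then have lin: "clinear_on (Hinf U) ?\<phi>" "vanishes_off (Hinf U) ?\<phi>"
    by (auto simp: Hinf_dual_def bounded_operators_def)
  have "cmod (?\<phi> h) \<le> 8 * (norm v)\<^sup>2 / r\<^sup>2 * sup_norm U h" if h: "h \<in> Hinf U" for h
    using Hinf_differential_bounds(2)[OF h x r ball v] h
    by (simp only: derivative_functional_def eval_functional_def if_True minus_apply)
  then show ?thesis by (intro Hinf_dualI(2)[OF lin]) auto
qed

text \<open>
  The derivative is the limit of difference quotients of point evaluations, and these lie in the span.
\<close>
lemma derivative_functional_in_Ginf:
  fixes x :: "'e::complex_normed_vector"
  assumes x: "x \<in> U" and r: "0 < r" and ball: "ball x r \<subseteq> U"
  shows "derivative_functional U x v \<in> Ginf U"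
proof (rule Ginf_closed[OF derivative_functional_in_Hinf_dual(1)[OF x r ball]])
  note D = cnormed_space_Hinf_dual[of U] and G = cnormed_space_Ginf[of U]
  fix \<epsilon> :: real assume \<epsilon>: "0 < \<epsilon>"
  define n where "n = norm v + 1"
  have n: "0 < n" "norm v \<le> n" by (auto simp: n_def add_nonneg_pos)
  \<comment> \<open>the first bound keeps \<open>x + t v\<close> in the range of the Taylor estimate, the second makes its remainder, divided by \<open>t\<close>, small\<close>
  define t where "t = min (r / (4 * n)) (\<epsilon> * r\<^sup>2 / (16 * n\<^sup>2))"
  have t: "0 < t" "t * n \<le> r / 4" "t * (16 * n\<^sup>2) \<le> \<epsilon> * r\<^sup>2"
  proof -
    show "0 < t" using n r \<epsilon> by (simp add: t_def)
    have "t \<le> r / (4 * n)" by (simp add: t_def)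
    then show "t * n \<le> r / 4" using n by (simp add: field_simps)
    have "t \<le> \<epsilon> * r\<^sup>2 / (16 * n\<^sup>2)" by (simp add: t_def)
    then show "t * (16 * n\<^sup>2) \<le> \<epsilon> * r\<^sup>2" using n by (simp add: pos_le_divide_eq)
  qed
  let ?c = "complex_of_real (1 / t)"
  let ?v = "complex_of_real t *\<^sub>C v"
  let ?G = "derivative_functional U x"
  have nv: "norm ?v = t * norm v" using t(1) by (simp add: norm_scaleC)
  have "t * norm v \<le> t * n" using t(1) n by simp
  then have small: "norm ?v \<le> r / 4" unfolding nv using t(2) by simp
  have xv: "x + ?v \<in> U" using small r ball by (intro subsetD[OF ball]) (simp add: dist_norm)
  let ?e = "eval_functional U (x + ?v) - eval_functional U x"
  have eD: "?e \<in> Hinf_dual U" "?e \<in> Ginf U"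
    by (intro cnormed_space_diff(1)[OF D] cnormed_space_diff(1)[OF G] eval_functional_unit_ball(1)
        eval_functional_in_Ginf x xv)+
  have homog: "?G ?v = complex_of_real t *\<^sub>C ?G v"
  proof
    fix h :: "'e \<Rightarrow> complex"
    show "?G ?v h = (complex_of_real t *\<^sub>C ?G v) h"
      using clinear_on_scaleC[OF Hinf_differential(2)[OF _ x], of h v "complex_of_real t"]
      by (auto simp: derivative_functional_def scaleC_fun_def)
  qed
  have "?c *\<^sub>C (?G ?v - ?e) = ?G v - ?c *\<^sub>C ?e"
    unfolding homog complex_vector.scale_right_diff_distrib using t(1) by simp
  then have "dual_norm U (?G v - ?c *\<^sub>C ?e) = cmod ?c * dual_norm U (?G ?v - ?e)"
    using cnormed_spaceD(8)[OF D cnormed_space_diff(1)[OF D derivative_functional_in_Hinf_dual(1)[OF x r ball] eD(1)]]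
    by metis
  also have "dual_norm U (?G ?v - ?e) = dual_norm U (?e - ?G ?v)"
  proof -
    have "?G ?v - ?e = (- 1) *\<^sub>C (?e - ?G ?v)" by simp
    then show ?thesis
      using cnormed_spaceD(8)[OF D cnormed_space_diff(1)[OF D eD(1) derivative_functional_in_Hinf_dual(1)[OF x r ball]], of "- 1"]
      by simp
  qed
  also have "cmod ?c = 1 / t" unfolding norm_of_real using t(1) by simp
  also have "(1 / t) * dual_norm U (?e - ?G ?v) \<le> (1 / t) * (8 * (norm ?v)\<^sup>2 / r\<^sup>2)"
    by (rule mult_left_mono[OF eval_functional_taylor[OF x r ball small]]) (use t(1) in simp)
  also have "\<dots> = 8 * t * (norm v)\<^sup>2 / r\<^sup>2"
    unfolding nv using t(1) by (simp add: power2_eq_square)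
  also have "\<dots> \<le> 8 * t * n\<^sup>2 / r\<^sup>2"
    using n t(1) by (intro divide_right_mono mult_left_mono power_mono) auto
  also have "\<dots> < \<epsilon>"
  proof -
    have "8 * t * n\<^sup>2 < t * (16 * n\<^sup>2)" using t(1) n by simp
    then have "8 * t * n\<^sup>2 < \<epsilon> * r\<^sup>2" using t(3) by simp
    then show ?thesis using r by (simp add: pos_divide_less_eq)
  qed
  finally show "\<exists>\<psi>\<in>Ginf U. dual_norm U (?G v - \<psi>) < \<epsilon>"
    using cnormed_spaceD(4)[OF G eD(2)] by blast
qed

text \<open>
  Bounded operators on the predual turn the quadratic remainder estimate for the point evaluations into
  Frechet differentiability of \<open>\<lambda>x. T (eval_functional U x)\<close>. This gives surjectivity of the
  linearisation map.
\<close>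
theorem holomorphic_operator_eval:
  fixes U :: "'e::complex_normed_vector set"
    and T :: "(('e \<Rightarrow> complex) \<Rightarrow> complex) \<Rightarrow> 'f::complex_normed_vector"
  assumes U: "open U" and T: "T \<in> bounded_operators (Ginf U) (dual_norm U)"
  shows "holomorphic_map (\<lambda>x. if x \<in> U then T (eval_functional U x) else 0) U"
  unfolding holomorphic_map_def
proof
  note G = cnormed_space_Ginf[of U] and D = cnormed_space_Hinf_dual[of U]
  have lin: "clinear_on (Ginf U) T" using T by (simp add: bounded_operators_def)
  let ?f = "\<lambda>x. if x \<in> U then T (eval_functional U x) else 0"
  let ?M = "operator_norm (Ginf U) (dual_norm U) T"
  have M: "0 \<le> ?M" by (rule cnormed_spaceD(5)[OF cnormed_space_operator_norm[OF G] T])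
  have bound: "norm (T \<phi>) \<le> ?M * dual_norm U \<phi>" if "\<phi> \<in> Ginf U" for \<phi>
    by (rule norm_le_operator_norm[OF G T that])
  fix x assume x: "x \<in> U"
  obtain r where r: "0 < r" "ball x r \<subseteq> U" using U x open_contains_ball by blast
  let ?G = "derivative_functional U x"
  note GG = derivative_functional_in_Ginf[OF x r]
  define L where "L v = T (?G v)" for v
  have add: "L (v + w) = L v + L w" for v w
  proof -
    have "?G (v + w) = ?G v + ?G w"
    proof
      fix h :: "'e \<Rightarrow> complex"
      show "?G (v + w) h = (?G v + ?G w) h"
        using clinear_on_add[OF Hinf_differential(2)[OF _ x], of h v w] by (auto simp: derivative_functional_def)
    qed
    then show ?thesis by (simp add: L_def clinear_on_add[OF lin GG GG])
  qed
  have scale: "L (c *\<^sub>C v) = c *\<^sub>C L v" for c v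
  proof -
    have "?G (c *\<^sub>C v) = c *\<^sub>C ?G v"
    proof
      fix h :: "'e \<Rightarrow> complex"
      show "?G (c *\<^sub>C v) h = (c *\<^sub>C ?G v) h"
        using clinear_on_scaleC[OF Hinf_differential(2)[OF _ x], of h v c]
        by (auto simp: derivative_functional_def scaleC_fun_def)
    qed
    then show ?thesis by (simp add: L_def clinear_on_scaleC[OF lin GG])
  qed
  have "bounded_linear L"
  proof (rule bounded_linear_intro[of _ "?M * (2 / r)"])
    fix v w :: 'e and s :: real
    show "L (v + w) = L v + L w" by (rule add)
    show "L (s *\<^sub>R v) = s *\<^sub>R L v" by (simp only: scaleR_scaleC scale)
    have "norm (L v) \<le> ?M * (2 * norm v / r)"
      unfolding L_def
      using bound[OF GG] mult_left_mono[OF derivative_functional_in_Hinf_dual(2)[OF x r] M] by (rule order_trans)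
    then show "norm (L v) \<le> norm v * (?M * (2 / r))" by (simp add: mult_ac)
  qed
  moreover have "\<exists>d>0. \<forall>y. norm (y - x) < d \<longrightarrow> norm (?f y - ?f x - L (y - x)) \<le> e * norm (y - x)"
    if e: "0 < e" for e
  proof -
    let ?C = "?M * (8 / r\<^sup>2)"
    have C: "0 \<le> ?C" using M by simp
    let ?d = "min (r / 4) (e / (?C + 1))"
    have d: "0 < ?d" using r(1) e C by simp
    have "norm (?f y - ?f x - L (y - x)) \<le> e * norm (y - x)" if y: "norm (y - x) < ?d" for y
    proof -
      have v: "norm (y - x) \<le> r / 4" using y by simp
      have yU: "y \<in> U" using v r by (intro subsetD[OF r(2)]) (simp add: dist_norm norm_minus_commute)
      let ?\<phi> = "eval_functional U y - eval_functional U x - ?G (y - x)"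
      have mem: "eval_functional U y \<in> Ginf U" "eval_functional U x \<in> Ginf U"
        by (intro eval_functional_in_Ginf yU x)+
      have mem2: "eval_functional U y - eval_functional U x \<in> Ginf U" by (rule cnormed_space_diff(1)[OF G mem])
      have "T ?\<phi> = ?f y - ?f x - L (y - x)"
        using clinear_on_diff[OF lin cnormed_spaceD(1)[OF G] mem2 GG]
          clinear_on_diff[OF lin cnormed_spaceD(1)[OF G] mem] yU x by (simp add: L_def)
      then have "norm (?f y - ?f x - L (y - x)) \<le> ?M * dual_norm U ?\<phi>"
        using bound[OF cnormed_space_diff(1)[OF G mem2 GG]] by metis
      also have "\<dots> \<le> ?M * (8 * (norm (y - x))\<^sup>2 / r\<^sup>2)"
        using eval_functional_taylor[OF x r v] M by (intro mult_left_mono) simp_all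
      also have "\<dots> = ?C * norm (y - x) * norm (y - x)" by (simp add: power2_eq_square)
      also have "\<dots> \<le> e * norm (y - x)"
      proof (rule mult_right_mono)
        have "?C * norm (y - x) \<le> (?C + 1) * norm (y - x)" by (intro mult_right_mono) auto
        also have "\<dots> \<le> e" using y C by (simp add: pos_less_divide_eq mult.commute less_imp_le)
        finally show "?C * norm (y - x) \<le> e" .
      qed simp
      finally show ?thesis .
    qed
    with d show ?thesis by blast
  qed
  ultimately have "(?f has_derivative L) (at x)" by (simp only: has_derivative_at_alt) blast
  moreover have "clinear_on UNIV L" by (simp add: clinear_on_def add scale)
  ultimately show "\<exists>D. (?f has_derivative D) (at x) \<and> clinear_on UNIV D" by blast
qed

section \<open>Relatively p-compact ranges and p-compact linearisations\<close>

lemma rel_p_compact_bounded: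
  fixes K :: "'f::complex_banach set"
  assumes "1 \<le> p" "rel_p_compact p K"
  shows "bounded K"
  using norm_le_m_p[OF assms] by (auto simp: bounded_iff)

lemma linearisation_unit_ball_subset:
  fixes f :: "'e::complex_normed_vector \<Rightarrow> 'f::complex_banach"
  assumes f: "f \<in> Hinf U" and p: "1 \<le> p" and x: "x \<in> lp_seqs p" "f ` U \<subseteq> pconv p x"
  shows "linearisation U f ` unit_ball (Ginf U) (dual_norm U) \<subseteq> full_pconv p x"
proof (rule image_subsetI)
  fix \<phi> assume \<phi>: "\<phi> \<in> unit_ball (Ginf U) (dual_norm U)"
  then have "\<phi> \<in> Ginf U" "\<phi> \<in> unit_ball (Hinf_dual U) (dual_norm U)"
    by (auto simp: unit_ball_def Ginf_def)
  then show "linearisation U f \<phi> \<in> full_pconv p x"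
    using x(2) pconv_subset_full_pconv
    by (intro weak_value_in_closed_absolutely_convex[OF f absolutely_convex_full_pconv[OF p] _ _ _
          linearisation_weak_value(3)[OF f]] compact_imp_closed compact_full_pconv[OF p x(1)]) blast+
qed

lemma range_subset_linearisation_unit_ball:
  fixes f :: "'e::complex_normed_vector \<Rightarrow> 'f::complex_banach"
  assumes f: "f \<in> Hinf U"
  shows "f ` U \<subseteq> linearisation U f ` unit_ball (Ginf U) (dual_norm U)"
proof (rule image_subsetI)
  fix x assume x: "x \<in> U"
  then have "eval_functional U x \<in> unit_ball (Ginf U) (dual_norm U)"
    by (simp add: unit_ball_def eval_functional_in_Ginf eval_functional_unit_ball(2))
  with linearisation_weak_value(2)[OF f x] show "f x \<in> linearisation U f ` unit_ball (Ginf U) (dual_norm U)"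
    by (metis imageI)
qed

text \<open>
  One inclusion is immediate because point evaluations have norm at most \<open>1\<close>. Conversely, a hull that
  contains the range has a compact absolutely convex enlargement that contains the image of the unit ball, and the
  enlargement lies in the hull of a sequence whose norm is larger by at most \<open>\<epsilon>\<close>.
\<close>
lemma linearisation_unit_ball_p_compact:
  fixes f :: "'e::complex_normed_vector \<Rightarrow> 'f::complex_banach"
  assumes f: "f \<in> Hinf U" and p: "1 \<le> p"
  defines "K \<equiv> linearisation U f ` unit_ball (Ginf U) (dual_norm U)"
  shows "rel_p_compact p K \<longleftrightarrow> rel_p_compact p (f ` U)"
    and "rel_p_compact p (f ` U) \<Longrightarrow> m_p p K = m_p p (f ` U)"
proof -
  have sub: "f ` U \<subseteq> K" unfolding K_def by (rule range_subset_linearisation_unit_ball[OF f])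
  have ex: "\<exists>z\<in>lp_seqs p. K \<subseteq> pconv p z \<and> lp_norm p z \<le> lp_norm p x + \<epsilon>"
    if x: "x \<in> lp_seqs p" "f ` U \<subseteq> pconv p x" and \<epsilon>: "0 < \<epsilon>" for x \<epsilon>
  proof -
    have K: "K \<subseteq> full_pconv p x" unfolding K_def by (rule linearisation_unit_ball_subset[OF f p x])
    from full_pconv_subset_pconv[OF p x(1) \<epsilon>] obtain z
      where z: "z \<in> lp_seqs p" "full_pconv p x \<subseteq> pconv p z" "lp_norm p z \<le> lp_norm p x + \<epsilon>" .
    with K show ?thesis by (intro bexI[of _ z]) auto
  qed
  show iff: "rel_p_compact p K \<longleftrightarrow> rel_p_compact p (f ` U)"
  proof
    show "rel_p_compact p (f ` U)" if "rel_p_compact p K" by (rule rel_p_compact_subset[OF that sub])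
    assume "rel_p_compact p (f ` U)"
    then obtain x where "x \<in> lp_seqs p" "f ` U \<subseteq> pconv p x" by (auto simp: rel_p_compact_def)
    from ex[OF this zero_less_one] show "rel_p_compact p K" by (auto simp: rel_p_compact_def)
  qed
  assume rel: "rel_p_compact p (f ` U)"
  show "m_p p K = m_p p (f ` U)"
  proof (rule antisym)
    show "m_p p (f ` U) \<le> m_p p K" using rel iff sub by (intro m_p_mono) simp_all
    show "m_p p K \<le> m_p p (f ` U)"
    proof (rule m_p_greatest[OF rel])
      fix x assume x: "x \<in> lp_seqs p" "f ` U \<subseteq> pconv p x"
      show "m_p p K \<le> lp_norm p x"
      proof (rule field_le_epsilon)
        fix \<epsilon> :: real assume "0 < \<epsilon>"
        from ex[OF x this] show "m_p p K \<le> lp_norm p x + \<epsilon>" using m_p_le order_trans by metis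
      qed
    qed
  qed
qed

lemma rel_p_compact_image_plus:
  fixes f g :: "'a \<Rightarrow> 'f::complex_banach"
  assumes "1 \<le> p" "rel_p_compact p (f ` S)" "rel_p_compact p (g ` S)"
  shows "rel_p_compact p ((f + g) ` S)" "m_p p ((f + g) ` S) \<le> m_p p (f ` S) + m_p p (g ` S)"
  by (rule rel_p_compact_add[OF assms]; auto)+

lemma rel_p_compact_image_scale:
  fixes f :: "'a \<Rightarrow> 'f::complex_banach"
  assumes "1 \<le> p" "rel_p_compact p (f ` S)"
  shows "rel_p_compact p ((c *\<^sub>C f) ` S)" "m_p p ((c *\<^sub>C f) ` S) = cmod c * m_p p (f ` S)"
proof -
  have "(c *\<^sub>C f) ` S = (*\<^sub>C) c ` (f ` S)" by (simp add: image_image scaleC_fun_def)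
  then show "rel_p_compact p ((c *\<^sub>C f) ` S)" "m_p p ((c *\<^sub>C f) ` S) = cmod c * m_p p (f ` S)"
    using rel_p_compact_scaleC[OF assms, of c] by simp_all
qed

lemma rel_p_compact_image_zero:
  assumes "1 \<le> p"
  shows "rel_p_compact p ((0 :: 'a \<Rightarrow> 'f::complex_banach) ` S)" "m_p p ((0 :: 'a \<Rightarrow> 'f) ` S) = 0"
  by (rule rel_p_compact_zero[OF assms]; auto)+

lemma cnormed_space_m_p:
  fixes X :: "('a \<Rightarrow> 'f::complex_banach) set"
  assumes p: "1 \<le> p" and X: "complex_vector.subspace X" and rel: "\<And>f. f \<in> X \<Longrightarrow> rel_p_compact p (f ` S)"
    and zero: "\<And>f. f \<in> X \<Longrightarrow> (\<And>x. x \<in> S \<Longrightarrow> f x = 0) \<Longrightarrow> f = 0"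
  shows "cnormed_space X (\<lambda>f. m_p p (f ` S))"
  unfolding cnormed_space_def
proof (intro conjI ballI allI X)
  fix f assume f: "f \<in> X"
  show "0 \<le> m_p p (f ` S)" by (rule m_p_nonneg[OF rel[OF f]])
  show "m_p p (f ` S) = 0 \<longleftrightarrow> f = 0"
  proof
    assume "m_p p (f ` S) = 0"
    then show "f = 0" using norm_le_m_p[OF p rel[OF f]] by (intro zero[OF f]) force
  qed (simp only: rel_p_compact_image_zero(2)[OF p])
  show "m_p p ((c *\<^sub>C f) ` S) = cmod c * m_p p (f ` S)" for c
    by (rule rel_p_compact_image_scale(2)[OF p rel[OF f]])
  fix g assume g: "g \<in> X"
  show "m_p p ((f + g) ` S) \<le> m_p p (f ` S) + m_p p (g ` S)"
    by (rule rel_p_compact_image_plus(2)[OF p rel[OF f] rel[OF g]])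
qed

lemma cnormed_space_Hinf_Kp:
  fixes U :: "'e::complex_normed_vector set"
  assumes p: "1 \<le> p"
  shows "cnormed_space (Hinf_Kp p U :: ('e \<Rightarrow> 'f::complex_banach) set) (k_p_Hinf p U)"
  unfolding k_p_Hinf_def
proof (rule cnormed_space_m_p[OF p])
  show "complex_vector.subspace (Hinf_Kp p U :: ('e \<Rightarrow> 'f) set)"
    unfolding complex_vector.subspace_def Hinf_Kp_def
    by (auto simp only: mem_Collect_eq intro!: holomorphic_map_zero holomorphic_map_plus holomorphic_map_scale
        vanishes_off_zero vanishes_off_plus vanishes_off_scale rel_p_compact_image_zero[OF p]
        rel_p_compact_image_plus[OF p] rel_p_compact_image_scale[OF p])
qed (auto simp: Hinf_Kp_def vanishes_off_def fun_eq_iff)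

lemma cnormed_space_p_compact_operators:
  fixes X :: "'v::complex_vector set"
  assumes p: "1 \<le> p" and X: "cnormed_space X N"
  shows "cnormed_space (p_compact_operators p X N :: ('v \<Rightarrow> 'f::complex_banach) set) (k_p p X N)"
  unfolding k_p_def
proof (rule cnormed_space_m_p[OF p])
  show "complex_vector.subspace (p_compact_operators p X N :: ('v \<Rightarrow> 'f) set)"
    unfolding complex_vector.subspace_def p_compact_operators_def
    by (auto simp only: mem_Collect_eq intro!: clinear_on_zero clinear_on_plus clinear_on_scale
        vanishes_off_zero vanishes_off_plus vanishes_off_scale rel_p_compact_image_zero[OF p]
        rel_p_compact_image_plus[OF p] rel_p_compact_image_scale[OF p])
qed (auto simp: p_compact_operators_def intro: zero_of_zero_on_unit_ball[OF X])

text \<open>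
  Relatively \<open>p\<close>-compact sets are bounded, which puts this space inside the domain of the linearisation.
\<close>
lemma Hinf_Kp_eq:
  fixes U :: "'e::complex_normed_vector set"
  assumes "1 \<le> p"
  shows "Hinf_Kp p U = {f :: 'e \<Rightarrow> 'f::complex_banach. f \<in> Hinf U \<and> rel_p_compact p (f ` U)}"
  using rel_p_compact_bounded[OF assms] by (auto simp: Hinf_Kp_def Hinf_def)

lemma p_compact_operators_eq:
  fixes X :: "'v::complex_vector set"
  assumes p: "1 \<le> p" and X: "cnormed_space X N"
  shows "p_compact_operators p X N =
    {T :: 'v \<Rightarrow> 'f::complex_banach. T \<in> bounded_operators X N \<and> rel_p_compact p (T ` unit_ball X N)}"
proof (rule set_eqI)
  fix T :: "'v \<Rightarrow> 'f"
  show "T \<in> p_compact_operators p X N \<longleftrightarrow>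
      T \<in> {T. T \<in> bounded_operators X N \<and> rel_p_compact p (T ` unit_ball X N)}"
    using bounded_operators_iff_bounded[OF X, of T] rel_p_compact_bounded[OF p, of "T ` unit_ball X N"]
    by (auto simp: p_compact_operators_def bounded_operators_def)
qed

lemma linearisation_linear:
  fixes f g :: "'e::complex_normed_vector \<Rightarrow> 'f::complex_banach"
  assumes f: "f \<in> Hinf U"
  shows "g \<in> Hinf U \<Longrightarrow> linearisation U (f + g) = linearisation U f + linearisation U g"
    and "linearisation U (c *\<^sub>C f) = c *\<^sub>C linearisation U f"
proof -
  note op = cnormed_space_operator_norm[OF cnormed_space_Ginf[of U], where ?'w = 'f]
  show "linearisation U (c *\<^sub>C f) = c *\<^sub>C linearisation U f"
  proof (rule linearisation_eqI)
    show "c *\<^sub>C linearisation U f \<in> bounded_operators (Ginf U) (dual_norm U)"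
      by (rule cnormed_spaceD(4)[OF op linearisation_weak_value(1)[OF f]])
    show "(c *\<^sub>C linearisation U f) (eval_functional U x) = (c *\<^sub>C f) x" if "x \<in> U" for x
      by (simp only: scaleC_fun_def linearisation_weak_value(2)[OF f that])
  qed
  assume g: "g \<in> Hinf U"
  show "linearisation U (f + g) = linearisation U f + linearisation U g"
  proof (rule linearisation_eqI)
    show "linearisation U f + linearisation U g \<in> bounded_operators (Ginf U) (dual_norm U)"
      by (rule cnormed_spaceD(3)[OF op linearisation_weak_value(1)[OF f] linearisation_weak_value(1)[OF g]])
    show "(linearisation U f + linearisation U g) (eval_functional U x) = (f + g) x" if "x \<in> U" for x
      by (simp only: plus_fun_apply linearisation_weak_value(2)[OF f that] linearisation_weak_value(2)[OF g that])
  qed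
qed

lemma bij_betw_linearisation:
  fixes U :: "'e::complex_normed_vector set"
  assumes U: "open U" and p: "1 \<le> p"
  shows "bij_betw (linearisation U) (Hinf_Kp p U :: ('e \<Rightarrow> 'f::complex_banach) set)
    (p_compact_operators p (Ginf U) (dual_norm U))"
proof (rule bij_betwI')
  let ?X = "Hinf_Kp p U :: ('e \<Rightarrow> 'f) set"
  fix f g :: "'e \<Rightarrow> 'f" assume "f \<in> ?X" "g \<in> ?X"
  then have f: "f \<in> Hinf U" and g: "g \<in> Hinf U" by (auto simp: Hinf_Kp_eq[OF p])
  show "linearisation U f = linearisation U g \<longleftrightarrow> f = g"
  proof
    assume eq: "linearisation U f = linearisation U g"
    show "f = g"
    proof
      fix x
      show "f x = g x"
      proof (cases "x \<in> U")
        case True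
        then show ?thesis using linearisation_weak_value(2)[OF f True] linearisation_weak_value(2)[OF g True] eq by simp
      next
        case False
        then show ?thesis using f g by (simp add: Hinf_def vanishes_off_def)
      qed
    qed
  qed simp
next
  let ?X = "Hinf_Kp p U :: ('e \<Rightarrow> 'f) set" and ?Y = "p_compact_operators p (Ginf U) (dual_norm U)"
  note G = cnormed_space_Ginf[of U]
  fix f :: "'e \<Rightarrow> 'f" assume "f \<in> ?X"
  then show "linearisation U f \<in> ?Y"
    using linearisation_weak_value(1) linearisation_unit_ball_p_compact(1)[OF _ p]
    by (auto simp: Hinf_Kp_eq[OF p] p_compact_operators_eq[OF p G])
next
  let ?X = "Hinf_Kp p U :: ('e \<Rightarrow> 'f) set" and ?Y = "p_compact_operators p (Ginf U) (dual_norm U)"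
  note G = cnormed_space_Ginf[of U]
  fix T :: "(('e \<Rightarrow> complex) \<Rightarrow> complex) \<Rightarrow> 'f" assume "T \<in> ?Y"
  then have T: "T \<in> bounded_operators (Ginf U) (dual_norm U)"
    and rel: "rel_p_compact p (T ` unit_ball (Ginf U) (dual_norm U))"
    by (auto simp: p_compact_operators_eq[OF p G])
  define f where "f x = (if x \<in> U then T (eval_functional U x) else 0)" for x
  have "f ` U \<subseteq> T ` unit_ball (Ginf U) (dual_norm U)"
    by (auto simp: f_def unit_ball_def eval_functional_in_Ginf eval_functional_unit_ball(2))
  then have "rel_p_compact p (f ` U)" by (rule rel_p_compact_subset[OF rel])
  moreover have "holomorphic_map f U" unfolding f_def[abs_def] by (rule holomorphic_operator_eval[OF U T])
  ultimately have "f \<in> ?X" by (simp add: Hinf_Kp_def vanishes_off_def f_def)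
  moreover have "linearisation U f = T" by (rule linearisation_eqI[OF T]) (simp add: f_def)
  ultimately show "\<exists>f\<in>?X. T = linearisation U f" by blast
qed

theorem theorem1p3:
  fixes U :: "'e::complex_banach set"
    and f :: "'e \<Rightarrow> 'f::complex_banach"
    and p :: real
  assumes "open U" and "1 \<le> p" and "f \<in> Hinf U"
  shows "(rel_p_compact p (f ` U) \<longleftrightarrow>
            linearisation U f \<in> p_compact_operators p (Ginf U) (dual_norm U)) \<and>
         (rel_p_compact p (f ` U) \<longrightarrow>
            k_p_Hinf p U f = k_p p (Ginf U) (dual_norm U) (linearisation U f)) \<and>
         isometric_isomorphism
            (Hinf_Kp p U :: ('e \<Rightarrow> 'f) set) (k_p_Hinf p U)
            (p_compact_operators p (Ginf U) (dual_norm U)) (k_p p (Ginf U) (dual_norm U))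
            (linearisation U)"
proof (intro conjI impI)
  note p = \<open>1 \<le> p\<close> and G = cnormed_space_Ginf[of U]
  show "rel_p_compact p (f ` U) \<longleftrightarrow> linearisation U f \<in> p_compact_operators p (Ginf U) (dual_norm U)"
    using linearisation_weak_value(1)[OF assms(3)] linearisation_unit_ball_p_compact(1)[OF assms(3) p]
    by (simp add: p_compact_operators_eq[OF p G])
  have norm_eq: "k_p p (Ginf U) (dual_norm U) (linearisation U g) = k_p_Hinf p U g"
    if "g \<in> Hinf U" "rel_p_compact p (g ` U)" for g :: "'e \<Rightarrow> 'f"
    using linearisation_unit_ball_p_compact(2)[OF that(1) p that(2)] by (simp add: k_p_def k_p_Hinf_def)
  show "k_p_Hinf p U f = k_p p (Ginf U) (dual_norm U) (linearisation U f)" if "rel_p_compact p (f ` U)"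
    using norm_eq[OF assms(3) that] by simp
  have "clinear_on (Hinf_Kp p U :: ('e \<Rightarrow> 'f) set) (linearisation U)"
    unfolding clinear_on_def Hinf_Kp_eq[OF p] by (auto intro: linearisation_linear)
  then show "isometric_isomorphism
            (Hinf_Kp p U :: ('e \<Rightarrow> 'f) set) (k_p_Hinf p U)
            (p_compact_operators p (Ginf U) (dual_norm U)) (k_p p (Ginf U) (dual_norm U))
            (linearisation U)"
    unfolding isometric_isomorphism_def
    using cnormed_space_Hinf_Kp[OF p, of U, where ?'f = 'f] cnormed_space_p_compact_operators[OF p G, where ?'f = 'f]
      bij_betw_linearisation[OF assms(1) p, where ?'f = 'f] norm_eq
    by (simp add: Hinf_Kp_eq[OF p])
qed

end
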